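(* Each of the following planar quadratic differential systems in the variables $(z,y)$, with parameter $q$, has the indicated invariant curve $g=0$, of degree nine and genus one, with cofactor $K=9y$. (i) The system $$\dot z=zy+1,\qquad \dot y=3y^2-\tfrac{8}{13}qzy-\tfrac{24}{169}q^2z^2+q,$$ with $$\begin{aligned} g={}&y^3-\tfrac{9}{26}q^2z-\tfrac{2784}{28561}z^5q^4+\tfrac{296}{2197}z^3q^3+\tfrac{6144}{371293}z^7q^5-\tfrac{4096}{4826809}z^9q^6+\tfrac{9}{26}yq-\tfrac{60}{169}yq^2z^2\\ &+\tfrac{960}{2197}yz^4q^3-\tfrac{1536}{28561}yz^6q^4-\tfrac{12}{13}y^2qz-\tfrac{120}{169}y^2z^3q^2. \end{aligned}$$ (ii) The system $$\dot z=zy+1,\qquad \dot y=3y^2-\tfrac{14}{25}qzy-\tfrac{84}{125}q^2z^2+q,$$ with $$\begin{aligned} g={}&y^3+\tfrac{772}{3125}z^3q^3-\tfrac{39648}{390625}z^5q^4-\tfrac{9}{25}q^2z+\tfrac{9}{25}yq-\tfrac{312}{625}yq^2z^2+\tfrac{2688}{15625}yz^4q^3-\tfrac{9408}{78125}yz^6q^4\\ &-\tfrac{21}{25}y^2qz-\tfrac{192}{625}y^2z^3q^2-\tfrac{87808}{9765625}z^9q^6+\tfrac{65856}{1953125}z^7q^5. \end{aligned}$$ (iii) The system $$\dot z=zy+1,\qquad \dot y=3y^2-\tfrac{88}{53}qzy-\tfrac{3264}{2809}q^2z^2+q,$$ with $$\begin{aligned} g={}&y^3-\tfrac{9}{106}q^2z+\tfrac{7655424}{7890481}z^5q^4-\tfrac{190316544}{418195493}z^7q^5-\tfrac{105344}{148877}z^3q^3-\tfrac{132}{53}y^2qz+\tfrac{3840}{2809}y^2z^3q^2\\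 &+\tfrac{1568669696}{22164361129}z^9q^6+\tfrac{9}{106}yq+\tfrac{6240}{2809}yq^2z^2-\tfrac{337920}{148877}yz^4q^3+\tfrac{4325376}{7890481}yz^6q^4. \end{aligned}$$
   Context: For a polynomial differential system $\dot z=P(z,y)$, $\dot y=Q(z,y)$, an algebraic curve $g(z,y)=0$ (with $g$ a polynomial) is invariant with cofactor $K$, where $K$ is a polynomial, if $P\,\partial g/\partial z+Q\,\partial g/\partial y=K g$ identically. The degree of the curve is the total degree of $g$ in $(z,y)$; the genus is the genus of the algebraic curve $g=0$ in the usual sense. The system is quadratic if $\max(\deg P,\deg Q)=2$.
   Formalization: Degree nine and genus one are asserted only for q ≠ 0, since at q = 0 each g reduces to y^3, of degree three; that the system is quadratic and that g = 0 is invariant with cofactor 9y are stated for every complex q. *)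

theory Defs
  imports
    Complex_Main
    "HOL-Computational_Algebra.Polynomial_Factorial"
    "HOL-Algebra.QuotRing"
    "HOL-Algebra.Embedded_Algebras"
begin

section \<open>Plane polynomial systems and their invariant curves\<close>

text \<open>
  The polynomial ring \<open>\<complex>[z, y]\<close> is the type \<^typ>\<open>complex poly poly\<close>, read as \<open>\<complex>[z][y]\<close>:
  the outer variable is \<open>y\<close>, the inner one is \<open>z\<close>.
\<close>

definition var_z :: "complex poly poly" where
  "var_z = [:[:0, 1:]:]"

definition var_y :: "complex poly poly" where
  "var_y = [:0, 1:]"

definition cst :: "complex \<Rightarrow> complex poly poly" where
  "cst c = [:[:c:]:]"

definition total_degree :: "complex poly poly \<Rightarrow> nat" where
  "total_degree p =
     (if p = 0 then 0 else Max {i + j | i j. poly.coeff (poly.coeff p j) i \<noteq> 0})"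

definition partial_z :: "complex poly poly \<Rightarrow> complex poly poly" where
  "partial_z p = map_poly pderiv p"

definition partial_y :: "complex poly poly \<Rightarrow> complex poly poly" where
  "partial_y p = pderiv p"

definition quadratic_system :: "complex poly poly \<Rightarrow> complex poly poly \<Rightarrow> bool" where
  "quadratic_system P Q \<longleftrightarrow> max (total_degree P) (total_degree Q) = 2"

text \<open>The curve \<open>g = 0\<close> is invariant, with cofactor \<open>K\<close>, for \<open>z' = P(z, y)\<close>, \<open>y' = Q(z, y)\<close>.\<close>

definition invariant_curve ::
  "complex poly poly \<Rightarrow> complex poly poly \<Rightarrow> complex poly poly \<Rightarrow> complex poly poly \<Rightarrow> bool"
  where "invariant_curve P Q g K \<longleftrightarrow> P * partial_z g + Q * partial_y g = K * g"


section \<open>The genus of a function field\<close>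

text \<open>
  Throughout, \<open>F\<close> is an algebraic function field of one variable over a subfield \<open>K\<close> which is
  algebraically closed.  A place is given by its valuation ring; the maximal ideal of a
  valuation ring consists of its non-units.
\<close>

definition places :: "'a set \<Rightarrow> ('a, 'b) ring_scheme \<Rightarrow> 'a set set" where
  "places K F =
     {V. subring V F \<and> K \<subset> V \<and> V \<subset> carrier F \<and>
         (\<forall>x \<in> carrier F - {\<zero>\<^bsub>F\<^esub>}. x \<in> V \<or> inv\<^bsub>F\<^esub> x \<in> V)}"

definition local_parameter :: "('a, 'b) ring_scheme \<Rightarrow> 'a set \<Rightarrow> 'a \<Rightarrow> bool" where
  "local_parameter F V t \<longleftrightarrow>
     t \<in> V \<and> PIdl\<^bsub>F\<lparr>carrier := V\<rparr>\<^esub> t = V - Units (F\<lparr>carrier := V\<rparr>)"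

text \<open>The order at the place \<open>V\<close> of an element \<open>x \<noteq> 0\<close> of \<open>F\<close>.\<close>

definition place_ord :: "('a, 'b) ring_scheme \<Rightarrow> 'a set \<Rightarrow> 'a \<Rightarrow> int" where
  "place_ord F V x =
     (THE n. \<exists>t u. local_parameter F V t \<and> u \<in> Units (F\<lparr>carrier := V\<rparr>) \<and>
                   x = t [^]\<^bsub>F\<^esub> n \<otimes>\<^bsub>F\<^esub> u)"

definition divisors :: "'a set \<Rightarrow> ('a, 'b) ring_scheme \<Rightarrow> ('a set \<Rightarrow> int) set" where
  "divisors K F = {D. finite {V. D V \<noteq> 0} \<and> {V. D V \<noteq> 0} \<subseteq> places K F}"

text \<open>Since \<open>K\<close> is algebraically closed, every place has degree one.\<close>

definition divisor_degree :: "('a set \<Rightarrow> int) \<Rightarrow> int" where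
  "divisor_degree D = (\<Sum>V | D V \<noteq> 0. D V)"

definition riemann_roch_space ::
  "'a set \<Rightarrow> ('a, 'b) ring_scheme \<Rightarrow> ('a set \<Rightarrow> int) \<Rightarrow> 'a set" where
  "riemann_roch_space K F D =
     {x \<in> carrier F. x = \<zero>\<^bsub>F\<^esub> \<or> (\<forall>V \<in> places K F. place_ord F V x \<ge> - D V)}"

text \<open>
  The genus is the maximum of \<open>deg D - l(D) + 1\<close> over all divisors \<open>D\<close>, where \<open>l(D)\<close> is the
  dimension over \<open>K\<close> of the Riemann--Roch space of \<open>D\<close>.  The maximum exists by Riemann's
  theorem, and \<open>Sup\<close> on the integers is by definition the maximum.
\<close>

definition function_field_genus :: "'a set \<Rightarrow> ('a, 'b) ring_scheme \<Rightarrow> int" where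
  "function_field_genus K F =
     (SUP D \<in> divisors K F.
        divisor_degree D - int (ring.dim F K (riemann_roch_space K F D)) + 1)"


section \<open>The genus of a plane curve\<close>

text \<open>
  For irreducible \<open>g\<close>, the function field of the curve \<open>g = 0\<close>, that is, the field of fractions
  of \<open>\<complex>[z, y] / (g)\<close>, is the residue field of the localization of \<open>\<complex>[z, y]\<close> at the prime
  ideal \<open>(g)\<close>.
\<close>

definition local_ring :: "complex poly poly \<Rightarrow> complex poly poly fract ring" where
  "local_ring g =
     \<lparr>carrier = {Fract a b | a b. \<not> g dvd b}, mult = (*), one = 1, zero = 0, add = (+)\<rparr>"

definition local_ring_ideal :: "complex poly poly \<Rightarrow> complex poly poly fract set" where
  "local_ring_ideal g = {Fract a b | a b. g dvd a \<and> \<not> g dvd b}"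

definition function_field :: "complex poly poly \<Rightarrow> complex poly poly fract set ring" where
  "function_field g = local_ring g Quot local_ring_ideal g"

definition constants :: "complex poly poly \<Rightarrow> complex poly poly fract set set" where
  "constants g = range (\<lambda>c. local_ring_ideal g +>\<^bsub>local_ring g\<^esub> Fract (cst c) 1)"

text \<open>
  The genus of the curve \<open>g = 0\<close> is that of its function field, i.e. the geometric genus;
  it is defined for irreducible curves only.
\<close>

definition curve_has_genus :: "complex poly poly \<Rightarrow> int \<Rightarrow> bool" where
  "curve_has_genus g n \<longleftrightarrow>
     Factorial_Ring.irreducible g \<and> function_field_genus (constants g) (function_field g) = n"

end

(* Put Z = z^2. On each curve the rational function y / z and Z are invariant under the involution
   (z, y) -> (-z, -y), and the quotient by it is rational: for a parameter t there are polynomials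
   F of degree three and H of degree four such that Z = C t / F(t) and y / z = r H(t) / F(t) for
   constants C and r. With x = 1 / t this identifies the function field of the curve with that of
   w^2 = x^3 F(1 / x), a squarefree cubic in x: z is a multiple of x / w, and t is recovered from Z
   and y / z by the Euclidean algorithm. Since the curve is monic of degree three in y, it is
   irreducible as soon as it has no root in C[z], which a comparison of coefficients excludes.

   The field C(x, w) is embedded into Laurent series at every point of w^2 = f(x), the point at
   infinity included. Every place contains the local ring of such a point, hence is given by the
   order of these expansions. One step D, D + P raises the dimension of the Riemann-Roch space by
   at most one, so deg D - l(D) grows with D and it suffices to bound it for multiples of infinity
   plus zeros of polynomials in x, where enough functions can be written down. A function whose only
   pole is simple and at infinity is constant; so the bound is attained and the genus is one. *)

theory Submission
  imports
    Defs
    "HOL-Computational_Algebra.Formal_Laurent_Series"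
    "HOL-Computational_Algebra.Fundamental_Theorem_Algebra"
    "HOL-Computational_Algebra.Field_as_Ring"
begin

section \<open>Invariance of the genus under isomorphism\<close>

text \<open>The genus is a supremum over all divisors of a quotient of a local ring, where little
  can be computed directly. The computations therefore take place in one type, Laurent series in a
  local parameter at the point at infinity: C(x, w) is a subset of it, the expansions at the other
  points are maps out of that subset, and an isomorphism carries the result to the quotient.

  The parameter q scales away. With weights 2, 1, -1 for q, y, z each g is homogeneous of weight 3,
  so q z^2 and y / (q z) satisfy an equation with rational coefficients, and F and H do not involve
  q. The linear part of g is a multiple of y - q z; the branch through the origin has slope q and
  corresponds to t = 0, the point at infinity of the cubic. This fixes the factor of H / F in y / z
  as q / H(0), and F(0) = 1 makes the cubic in x monic.

  The genus is visible in the pole orders at infinity: x and w have orders 2 and 3, which generate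
  every positive integer except one.\<close>

locale field_iso = F: field F + G: field G for F (structure) and G (structure) +
  fixes h assumes iso: "h \<in> ring_iso F G"
begin

lemma hom: "h \<in> ring_hom F G"
  using iso by (simp add: ring_iso_def)

lemma ring_hom_ring: "ring_hom_ring F G h"
  using hom by (intro ring_hom_ringI2 F.ring_axioms G.ring_axioms)

sublocale H: ring_hom_ring F G h
  by (rule ring_hom_ring)

lemma bij: "bij_betw h (carrier F) (carrier G)"
  using iso by (simp add: ring_iso_def)

lemma inj: "inj_on h (carrier F)" and surj: "h ` carrier F = carrier G"
  using bij by (auto simp: bij_betw_def)

lemma h_eq_iff: "x \<in> carrier F \<Longrightarrow> y \<in> carrier F \<Longrightarrow> h x
  = h y \<longleftrightarrow> x = y"
  using inj by (auto dest: inj_onD)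

lemma h_zero_iff: "x \<in> carrier F \<Longrightarrow> h x
  = \<zero>\<^bsub>G\<^esub> \<longleftrightarrow> x = \<zero>\<^bsub>F\<^esub>"
  using h_eq_iff[of x "\<zero>\<^bsub>F\<^esub>"] by simp

lemma h_inv: "x \<in> carrier F \<Longrightarrow> x \<noteq> \<zero>\<^bsub>F\<^esub>
  \<Longrightarrow> h (inv\<^bsub>F\<^esub> x) = inv\<^bsub>G\<^esub> (h x)"
  using G.inv_unique'[of "h x" "h (inv\<^bsub>F\<^esub> x)"] F.field_Units
  by (simp flip: H.hom_mult H.hom_one)

lemma h_int_pow:
  assumes "t \<in> carrier F" "t \<noteq> \<zero>\<^bsub>F\<^esub>"
  shows "h (t [^]\<^bsub>F\<^esub> (n::int)) = h t [^]\<^bsub>G\<^esub> n"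
proof -
  have closed: "t [^]\<^bsub>F\<^esub> k \<in> carrier F" for k :: nat
    using assms(1) by (rule F.nat_pow_closed)
  have pow: "h (t [^]\<^bsub>F\<^esub> k) = h t [^]\<^bsub>G\<^esub> k" for k :: nat
  proof (induction k)
    case (Suc k)
    then show ?case using H.hom_mult[OF closed assms(1)] by (simp only: nat_pow_Suc)
  qed (simp only: nat_pow_0 H.hom_one)
  have nonzero: "t [^]\<^bsub>F\<^esub> k \<noteq> \<zero>\<^bsub>F\<^esub>" for k :: nat
  proof (induction k)
    case (Suc k)
    then show ?case
      using F.integral_iff[OF closed assms(1)] assms(2) by (simp only: nat_pow_Suc) simp
  qed (simp only: nat_pow_0 F.one_not_zero not_False_eq_True)
  show ?thesis
    by (cases "n < 0")
      (simp_all only: int_pow_def2 if_True if_False pow h_inv[OF closed nonzero])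
qed

lemma place_image:
  assumes "K \<subseteq> carrier F" "V \<in> places K F"
  shows "h ` V \<in> places (h ` K) G"
proof -
  have V: "subring V F" "K \<subset> V" "V \<subset> carrier F"
    "\<And>x. x \<in> carrier F - {\<zero>\<^bsub>F\<^esub>}
      \<Longrightarrow> x \<in> V \<or> inv\<^bsub>F\<^esub> x \<in> V"
    using assms by (auto simp: places_def)
  have "h ` K \<subset> h ` V"
    by (rule image_strict_mono[OF inj_on_subset[OF inj] V(2)]) (use V(3) in auto)
  moreover have "h ` V \<subset> h ` carrier F"
    by (rule image_strict_mono[OF inj V(3)])
  moreover have "y \<in> h ` V \<or> inv\<^bsub>G\<^esub> y \<in> h ` V" if y: "y \<in> carrier G
    - {\<zero>\<^bsub>G\<^esub>}" for y
  proof -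
    obtain x where x: "x \<in> carrier F" "y = h x"
      using y unfolding surj[symmetric] by blast
    moreover have "x \<noteq> \<zero>\<^bsub>F\<^esub>" using y x by auto
    ultimately have "x \<in> V \<or> inv\<^bsub>F\<^esub> x \<in> V" using V(4) x by simp
    then show ?thesis using h_inv[of x] x \<open>x \<noteq> \<zero>\<^bsub>F\<^esub>\<close> by (metis imageI)
  qed
  ultimately show ?thesis
    using V(1) H.img_is_subring surj by (auto simp: places_def)
qed

lemma Units_image:
  assumes "subring V F"
  shows "Units (G\<lparr>carrier := h ` V\<rparr>) = h ` Units (F\<lparr>carrier := V\<rparr>)"
proof -
  have "V \<subseteq> carrier F" using subringE(1)[OF assms] .
  then have "h x \<otimes>\<^bsub>G\<^esub> h y
    = \<one>\<^bsub>G\<^esub> \<longleftrightarrow> x \<otimes>\<^bsub>F\<^esub> y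
    = \<one>\<^bsub>F\<^esub>" if "x \<in> V" "y \<in> V" for x y
    using that h_eq_iff[of "x \<otimes>\<^bsub>F\<^esub> y" "\<one>\<^bsub>F\<^esub>"] by (simp add: subset_iff)
  then show ?thesis
    unfolding Units_def by fastforce
qed

lemma local_parameter_image:
  assumes V: "subring V F" and t: "local_parameter F V t"
  shows "local_parameter G (h ` V) (h t)"
proof -
  have sub: "V \<subseteq> carrier F" using subringE(1)[OF V] .
  have tV: "t \<in> V" and eq: "{x \<otimes>\<^bsub>F\<^esub> t | x. x \<in> V} = V - Units
    (F\<lparr>carrier := V\<rparr>)"
    using t by (auto simp: local_parameter_def cgenideal_def)
  have "{y \<otimes>\<^bsub>G\<^esub> h t | y. y \<in> h ` V}
    = h ` {x \<otimes>\<^bsub>F\<^esub> t | x. x \<in> V}"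
  proof -
    have "h x \<otimes>\<^bsub>G\<^esub> h t = h (x \<otimes>\<^bsub>F\<^esub> t)" if "x \<in> V" for x
      using that sub tV by (simp add: subset_iff)
    then show ?thesis by (auto simp: image_iff) metis+
  qed
  also have "\<dots> = h ` V - h ` Units (F\<lparr>carrier := V\<rparr>)"
    unfolding eq using sub inj
    by (intro inj_on_image_set_diff[of h "carrier F"]) (auto simp: Units_def)
  finally show ?thesis
    using tV by (simp add: local_parameter_def cgenideal_def Units_image[OF V])
qed

text \<open>If zero generated the maximal ideal, every nonzero element of \<open>V\<close> would be
  a unit of \<open>V\<close>. For \<open>x\<close> outside \<open>V\<close> the inverse lies in
  \<open>V\<close>, so \<open>x\<close> would lie there too. The transport of integer powers in
  \<open>h_int_pow\<close> requires a nonzero base.\<close>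

lemma local_parameter_nonzero:
  assumes V: "V \<in> places K F" and t: "local_parameter F V t"
  shows "t \<noteq> \<zero>\<^bsub>F\<^esub>"
proof
  assume t0: "t = \<zero>\<^bsub>F\<^esub>"
  have V': "subring V F" "V \<subset> carrier F"
    "\<And>x. x \<in> carrier F - {\<zero>\<^bsub>F\<^esub>}
      \<Longrightarrow> x \<in> V \<or> inv\<^bsub>F\<^esub> x \<in> V"
    using V by (auto simp: places_def)
  then obtain x where x: "x \<in> carrier F" "x \<notin> V" by auto
  have sub: "V \<subseteq> carrier F" and zV: "\<zero>\<^bsub>F\<^esub> \<in> V"
    using subringE[OF V'(1)] by auto
  have x0: "x \<noteq> \<zero>\<^bsub>F\<^esub>" using x zV by auto
  have xu: "x \<in> Units F" using x x0 F.field_Units by auto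
  have iV: "inv\<^bsub>F\<^esub> x \<in> V" using V'(3)[of x] x x0 by auto
  have "inv\<^bsub>F\<^esub> x \<noteq> \<zero>\<^bsub>F\<^esub>"
    using x xu by (metis F.Units_r_inv F.r_null F.zero_not_one)
  moreover have "V - Units (F\<lparr>carrier := V\<rparr>) \<subseteq> {\<zero>\<^bsub>F\<^esub>}"
    using t sub by (fastforce simp: local_parameter_def cgenideal_def t0)
  ultimately have "inv\<^bsub>F\<^esub> x \<in> Units (F\<lparr>carrier := V\<rparr>)" using iV by blast
  then obtain v where "v \<in> V" "inv\<^bsub>F\<^esub> x \<otimes>\<^bsub>F\<^esub> v
    = \<one>\<^bsub>F\<^esub>" by (auto simp: Units_def)
  moreover from this have "v \<in> carrier F" using sub by auto
  ultimately have "x \<otimes>\<^bsub>F\<^esub> inv\<^bsub>F\<^esub> x \<otimes>\<^bsub>F\<^esub> v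
    = x \<otimes>\<^bsub>F\<^esub> \<one>\<^bsub>F\<^esub>"
    using x xu F.m_assoc[of x "inv\<^bsub>F\<^esub> x" v] by (simp only: F.Units_inv_closed)
  then have "v = x"
    using x xu \<open>v \<in> carrier F\<close> by (simp only: F.Units_r_inv F.l_one F.r_one)
  then show False using x \<open>v \<in> V\<close> by simp
qed

abbreviation has_ord where
  "has_ord R V x n \<equiv> (\<exists>t u. local_parameter R V t \<and> u \<in> Units
    (R\<lparr>carrier := V\<rparr>) \<and>
     x = t [^]\<^bsub>R\<^esub> (n::int) \<otimes>\<^bsub>R\<^esub> u)"

lemma has_ord_image:
  assumes "V \<in> places K F" "has_ord F V x n"
  shows "has_ord G (h ` V) (h x) n"
proof -
  have V: "subring V F" and sub: "V \<subseteq> carrier F"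
    using assms(1) by (auto simp: places_def)
  obtain t u where tu: "local_parameter F V t" "u \<in> Units (F\<lparr>carrier := V\<rparr>)"
      "x = t [^]\<^bsub>F\<^esub> n \<otimes>\<^bsub>F\<^esub> u"
    using assms(2) by blast
  have t: "t \<in> carrier F" "t \<noteq> \<zero>\<^bsub>F\<^esub>" and u: "u \<in> carrier F"
    using tu sub local_parameter_nonzero[OF assms(1)] by (auto simp: local_parameter_def Units_def)
  then have "t \<in> Units F" using F.field_Units by auto
  then have pow: "t [^]\<^bsub>F\<^esub> n \<in> carrier F"
    using F.nat_pow_closed[OF t(1)] F.Units_inv_closed[OF F.Units_pow_closed]
    by (cases "n < 0") (simp_all only: int_pow_def2 if_True if_False)
  have "h x = h t [^]\<^bsub>G\<^esub> n \<otimes>\<^bsub>G\<^esub> h u"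
    unfolding tu(3) H.hom_mult[OF pow u] h_int_pow[OF t] ..
  then show ?thesis
    using local_parameter_image[OF V tu(1)] imageI[OF tu(2), of h]
    unfolding Units_image[OF V] by metis
qed

lemma dimension_image:
  assumes "subfield K F" "F.dimension n K E"  "E \<subseteq> carrier F"
  shows "G.dimension n (h ` K) (h ` E)"
  using H.inj_hom_dimension[OF assms(1) G.one_not_zero inj_on_subset[OF inj assms(3)] assms(2)] .

end

lemma (in field_iso) field_iso_inverse: "field_iso G F (inv_into (carrier F) h)"
  by unfold_locales (rule ring_iso_set_sym[OF F.ring_axioms iso])

lemma (in field_iso) inverse_image: "V \<subseteq> carrier F \<Longrightarrow> inv_into
  (carrier F) h ` h ` V = V"
  by (rule inv_into_image_cancel[OF inj])

text \<open>By \<open>has_ord_image\<close> for \<open>h\<close> and for its inverse, the same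
  integers satisfy the predicate under the definite description on both sides.\<close>

lemma (in field_iso) place_ord_image:
  assumes K: "K \<subseteq> carrier F" and V: "V \<in> places K F" and x: "x \<in> carrier F"
  shows "place_ord G (h ` V) (h x) = place_ord F V x"
proof -
  interpret I: field_iso G F "inv_into (carrier F) h" by (rule field_iso_inverse)
  have sub: "V \<subseteq> carrier F" using V by (auto simp only: places_def)
  have "has_ord G (h ` V) (h x) n \<longleftrightarrow> has_ord F V x n" for n
    using has_ord_image[OF V, of x n] I.has_ord_image[OF place_image[OF K V], of "h x" n]
    unfolding inverse_image[OF sub] inv_into_f_f[OF inj x] by (rule iffI[rotated])
  then show ?thesis by (simp only: place_ord_def)
qed

lemma (in field_iso) riemann_roch_image:
  assumes K: "K \<subseteq> carrier F" and D: "D \<in> divisors K F"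
  obtains D' where "D' \<in> divisors (h ` K) G" "divisor_degree D' = divisor_degree D"
    "riemann_roch_space (h ` K) G D' = h ` riemann_roch_space K F D"
proof -
  let ?i = "inv_into (carrier F) h"
  interpret I: field_iso G F ?i by (rule field_iso_inverse)
  have supp: "{V. D V \<noteq> 0} \<subseteq> places K F" "finite {V. D V \<noteq> 0}"
    using D by (auto simp: divisors_def)
  have sub: "V \<subseteq> carrier F" if "V \<in> places K F" for V using that by (auto simp: places_def)
  have Kinv: "?i ` h ` K = K" using inverse_image[OF K] .
  have K': "h ` K \<subseteq> carrier G" using K surj by blast
  \<comment> \<open>A divisor has to vanish off the places, where pulling back along
    \<open>h\<close> would give arbitrary values; hence the case distinction.\<close>
  define D' where "D' = (\<lambda>W. if W \<in> places (h ` K) G then D (?i ` W) else 0)"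
  have D'h: "D' (h ` V) = D V" if "V \<in> places K F" for V
    using that place_image[OF K that] inverse_image[OF sub[OF that]] by (simp add: D'_def)
  have back1: "?i ` W \<in> places K F" if "W \<in> places (h ` K) G" for W
    using I.place_image[OF K' that] unfolding Kinv .
  have back2: "h ` ?i ` W = W" if "W \<in> places (h ` K) G" for W
    using image_inv_into_cancel[OF surj, of W] that by (auto simp only: places_def)
  have supp': "{W. D' W \<noteq> 0} = (`) h ` {V. D V \<noteq> 0}"
  proof (intro subset_antisym subsetI)
    fix W assume "W \<in> {W. D' W \<noteq> 0}"
    then have "W \<in> places (h ` K) G \<and> D (?i ` W) \<noteq> 0"
      unfolding D'_def mem_Collect_eq by presburger
    then have "W = h ` ?i ` W" "?i ` W \<in> {V. D V \<noteq> 0}"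
      using back2 by (fast+)
    then show "W \<in> (`) h ` {V. D V \<noteq> 0}"
      by (rule image_eqI[where f = "(`) h"])
  next
    fix W assume "W \<in> (`) h ` {V. D V \<noteq> 0}"
    then obtain V where "W = h ` V" "D V \<noteq> 0" by blast
    then show "W \<in> {W. D' W \<noteq> 0}" using D'h[of V] supp(1) by fastforce
  qed
  have injh: "inj_on ((`) h) {V. D V \<noteq> 0}"
  proof (rule inj_onI)
    fix V W assume "V \<in> {V. D V \<noteq> 0}" "W \<in> {V. D V \<noteq> 0}" "h ` V = h ` W"
    then have places: "V \<in> places K F" "W \<in> places K F" and eq: "h ` V = h ` W"
      using supp(1) by blast+
    show "V = W"
      using inverse_image[OF sub[OF places(1)]] inverse_image[OF sub[OF places(2)]]
      unfolding eq by (rule trans[OF sym])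
  qed
  have "D' \<in> divisors (h ` K) G"
    unfolding divisors_def mem_Collect_eq supp' using supp place_image[OF K] by blast
  moreover have "divisor_degree D' = divisor_degree D"
  proof -
    have "(\<Sum>V | D V \<noteq> 0. D' (h ` V)) = (\<Sum>V | D V \<noteq> 0. D V)"
      using supp(1) D'h by (intro sum.cong[OF refl]) blast
    then show ?thesis
      unfolding divisor_degree_def supp' sum.reindex[OF injh] o_def .
  qed
  moreover have "riemann_roch_space (h ` K) G D' = h ` riemann_roch_space K F D"
  proof -
    have "h x \<in> riemann_roch_space (h ` K) G D' \<longleftrightarrow> x \<in> riemann_roch_space K F D"
      if x: "x \<in> carrier F" for x
    proof -
      have "(\<forall>W\<in>places (h ` K) G. place_ord G W (h x) \<ge> - D' W) \<longleftrightarrow>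
          (\<forall>V\<in>places K F. place_ord F V x \<ge> - D V)"
      proof safe
        fix V assume *: "\<forall>W\<in>places (h ` K) G. place_ord G W (h x) \<ge>
          - D' W" and V: "V \<in> places K F"
        show "place_ord F V x \<ge> - D V"
          using bspec[OF * place_image[OF K V]] place_ord_image[OF K V x] D'h[OF V] by simp
      next
        fix W assume *: "\<forall>V\<in>places K F. place_ord F V x \<ge> - D V" and W: "W \<in> places
          (h ` K) G"
        show "place_ord G W (h x) \<ge> - D' W"
          using bspec[OF * back1[OF W]] place_ord_image[OF K back1[OF W] x] D'h[OF back1[OF W]]
          unfolding back2[OF W] by simp
      qed
      then show ?thesis
        using x h_zero_iff[OF x] by (simp add: riemann_roch_space_def)
    qed
    moreover have "riemann_roch_space (h ` K) G D' \<subseteq> h ` carrier F"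
        "riemann_roch_space K F D \<subseteq> carrier F"
      unfolding surj by (auto simp only: riemann_roch_space_def)
    ultimately show ?thesis by blast
  qed
  ultimately show ?thesis by (rule that)
qed

lemma (in field_iso) dim_image:
  assumes "subfield K F" "E \<subseteq> carrier F"
  shows "G.dim (h ` K) (h ` E) = F.dim K E"
proof -
  interpret I: field_iso G F "inv_into (carrier F) h" by (rule field_iso_inverse)
  have K: "K \<subseteq> carrier F" using subfieldE(3)[OF assms(1)] .
  have "subfield (h ` K) G" using H.img_is_subfield(2)[OF assms(1)] by simp
  moreover have "h ` E \<subseteq> carrier G" using assms(2) surj by blast
  ultimately have dim_back: "F.dimension n K E" if "G.dimension n (h ` K) (h ` E)" for n
    using I.dimension_image[OF _ that] unfolding inverse_image[OF K] inverse_image[OF assms(2)] by fast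
  have "G.dimension n (h ` K) (h ` E) \<longleftrightarrow> F.dimension n K E" for n
    using dimension_image[OF assms(1) _ assms(2)] dim_back by (rule iffI[rotated])
  then show ?thesis by (simp only: F.dim_def G.dim_def)
qed

text \<open>Used for \<open>h\<close> and for its inverse, this inclusion makes the two sets of
  values equal, and with them their suprema.\<close>

lemma (in field_iso) genus_values_image:
  assumes K: "subfield K F"
  shows "(\<lambda>D. divisor_degree D - int (F.dim K (riemann_roch_space K F D)) + 1) ` divisors K F
    \<subseteq> (\<lambda>D. divisor_degree D - int (G.dim (h ` K) (riemann_roch_space (h ` K) G D)) + 1) `
         divisors (h ` K) G"
proof (intro image_subsetI)
  fix D assume D: "D \<in> divisors K F"
  obtain D' where D': "D' \<in> divisors (h ` K) G" "divisor_degree D' = divisor_degree D"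
    "riemann_roch_space (h ` K) G D' = h ` riemann_roch_space K F D"
    using riemann_roch_image[OF subfieldE(3)[OF K] D] .
  have "riemann_roch_space K F D \<subseteq> carrier F" by (auto simp only: riemann_roch_space_def)
  from dim_image[OF K this] D'(2,3) show "divisor_degree D - int (F.dim K (riemann_roch_space K F D)) + 1 \<in>
    (\<lambda>D. divisor_degree D - int (G.dim (h ` K) (riemann_roch_space (h ` K) G D)) + 1) `
         divisors (h ` K) G"
    by (intro image_eqI[OF _ D'(1)]) (simp only:)
qed

theorem (in field_iso) function_field_genus_image:
  assumes K: "subfield K F"
  shows "function_field_genus (h ` K) G = function_field_genus K F"
proof -
  interpret I: field_iso G F "inv_into (carrier F) h" by (rule field_iso_inverse)
  have "subfield (h ` K) G" using H.img_is_subfield(2)[OF K] by simp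
  from subset_antisym[OF I.genus_values_image[OF this, unfolded inverse_image[OF subfieldE(3)[OF K]]]
      genus_values_image[OF K]]
  show ?thesis
    unfolding function_field_genus_def by (rule arg_cong)
qed

section \<open>Subfields of a field given by a type\<close>

text \<open>The genus is defined for ring records, while the computations use the arithmetic of a
  field type; this wraps a subset of such a type as a record.\<close>

definition set_ring :: "'a::field set \<Rightarrow> 'a ring" where
  "set_ring S = \<lparr>carrier = S, mult = (*), one = 1, zero = 0, add = (+)\<rparr>"

lemma set_ring_simps [simp]:
  "carrier (set_ring S) = S" "x \<otimes>\<^bsub>set_ring S\<^esub> y
    = x * y" "\<one>\<^bsub>set_ring S\<^esub> = 1"
  "\<zero>\<^bsub>set_ring S\<^esub> = 0" "x \<oplus>\<^bsub>set_ring S\<^esub> y = x + y"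
  by (simp_all add: set_ring_def)

locale set_field =
  fixes S :: "'a::field set"
  assumes one_mem [simp, intro]: "1 \<in> S"
    and diff_mem [intro]: "x \<in> S \<Longrightarrow> y \<in> S \<Longrightarrow> x - y \<in> S"
    and mult_mem [intro]: "x \<in> S \<Longrightarrow> y \<in> S \<Longrightarrow> x * y \<in> S"
    and inverse_mem [intro]: "x \<in> S \<Longrightarrow> inverse x \<in> S"
begin

lemma zero_mem [simp, intro]: "0 \<in> S"
  using diff_mem[of 1 1] by simp

lemma uminus_mem [intro]: "x \<in> S \<Longrightarrow> - x \<in> S"
  using diff_mem[of 0 x] by simp

lemma add_mem [intro]: "x \<in> S \<Longrightarrow> y \<in> S \<Longrightarrow> x + y \<in> S"
  using diff_mem[of x "- y"] by auto

lemma divide_mem [intro]: "x \<in> S \<Longrightarrow> y \<in> S \<Longrightarrow> x / y \<in> S"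
  by (auto simp: divide_inverse)

lemma power_mem [intro]: "x \<in> S \<Longrightarrow> x ^ n \<in> S"
  by (induction n) auto

lemma power_int_mem [intro]: "x \<in> S \<Longrightarrow> x powi n \<in> S"
  by (auto simp: power_int_def)

lemma field_set_ring: "Ring.field (set_ring S)"
proof -
  have "cring (set_ring S)"
  proof (rule cringI)
    show "abelian_group (set_ring S)"
    proof (rule abelian_groupI)
      fix x assume "x \<in> carrier (set_ring S)"
      then show "\<exists>y\<in>carrier (set_ring S). y \<oplus>\<^bsub>set_ring S\<^esub> x
        = \<zero>\<^bsub>set_ring S\<^esub>"
        by (intro bexI[of _ "- x"]) auto
    qed (auto simp: algebra_simps)
    show "comm_monoid (set_ring S)"
      by (rule comm_monoidI) (auto simp: algebra_simps)
  qed (auto simp: algebra_simps)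
  then show ?thesis
  proof (rule cring.cring_fieldI2)
    fix x assume "x \<in> carrier (set_ring S)" "x \<noteq> \<zero>\<^bsub>set_ring S\<^esub>"
    then show "\<exists>y\<in>carrier (set_ring S). x \<otimes>\<^bsub>set_ring S\<^esub> y
      = \<one>\<^bsub>set_ring S\<^esub>"
      by (intro bexI[of _ "inverse x"]) auto
  qed simp
qed

sublocale T: Ring.field "set_ring S"
  by (rule field_set_ring)

lemma inv_set_ring: "x \<in> S \<Longrightarrow> x \<noteq> 0
  \<Longrightarrow> inv\<^bsub>set_ring S\<^esub> x = inverse x"
  by (rule T.inv_unique'[symmetric]) auto

lemma uminus_set_ring: "x \<in> S \<Longrightarrow> \<ominus>\<^bsub>set_ring S\<^esub> x = - x"
  by (rule T.minus_equality) auto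

lemma nat_pow_set_ring: "x [^]\<^bsub>set_ring S\<^esub> (n::nat) = x ^ n"
  by (induction n) auto

lemma int_pow_set_ring: "x \<in> S \<Longrightarrow> x \<noteq> 0
  \<Longrightarrow> x [^]\<^bsub>set_ring S\<^esub> (n::int) = x powi n"
  using inv_set_ring[OF power_mem, of x "nat (- n)"]
  by (cases "n < 0") (simp_all only: int_pow_def2 nat_pow_set_ring if_True if_False power_int_def
        power_inverse power_not_zero not_le[symmetric], simp_all add: power_inverse)

lemma subring_set_ring_iff:
  "subring V (set_ring S) \<longleftrightarrow> V \<subseteq> S \<and> 1 \<in> V \<and>
    (\<forall>x\<in>V. - x \<in> V) \<and>
     (\<forall>x\<in>V. \<forall>y\<in>V. x * y \<in> V) \<and> (\<forall>x\<in>V. \<forall>y\<in>V. x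
       + y \<in> V)"
proof
  assume V: "subring V (set_ring S)"
  then have sub: "V \<subseteq> S" using subringE(1) by fastforce
  have "- x \<in> V" if "x \<in> V" for x
    using subringE(5)[OF V that] uminus_set_ring[of x] that sub by auto
  with sub show "V \<subseteq> S \<and> 1 \<in> V \<and> (\<forall>x\<in>V. - x \<in> V) \<and>
     (\<forall>x\<in>V. \<forall>y\<in>V. x * y \<in> V) \<and> (\<forall>x\<in>V. \<forall>y\<in>V. x
       + y \<in> V)"
    using subringE(3,6,7)[OF V] by auto
next
  assume V: "V \<subseteq> S \<and> 1 \<in> V \<and> (\<forall>x\<in>V. - x \<in> V) \<and>
     (\<forall>x\<in>V. \<forall>y\<in>V. x * y \<in> V) \<and> (\<forall>x\<in>V. \<forall>y\<in>V. x
       + y \<in> V)"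
  then show "subring V (set_ring S)"
    by (intro T.subringI) (auto simp: uminus_set_ring subset_iff)
qed

lemma subfield_set_ring:
  assumes "set_field K" "K \<subseteq> S"
  shows "subfield K (set_ring S)"
proof (rule T.subfieldI')
  interpret K: set_field K by fact
  show "subring K (set_ring S)"
    using assms(2) by (auto simp: subring_set_ring_iff)
  show "inv\<^bsub>set_ring S\<^esub> k \<in> K" if "k \<in> K - {\<zero>\<^bsub>set_ring S\<^esub>}" for k
    using that assms(2) by (auto simp: inv_set_ring subset_iff)
qed

text \<open>In the ring of an additive integer-valued \<open>v\<close> that takes the value one, the
  units are the elements of value zero and the local parameters those of value one. So the exponent
  in \<open>x = t^n u\<close> can only be \<open>v x\<close>.\<close>

lemma place_ord_eqI:
  fixes v :: "'a \<Rightarrow> int"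
  assumes V: "V = {x \<in> S. x = 0 \<or> v x \<ge> 0}"
    and mult: "\<And>x y. x \<in> S \<Longrightarrow> y \<in> S
      \<Longrightarrow> x \<noteq> 0 \<Longrightarrow> y \<noteq> 0 \<Longrightarrow> v (x * y) = v x + v y"
    and t: "t \<in> S" "t \<noteq> 0" "v t = 1" and x: "x \<in> S" "x \<noteq> 0"
  shows "place_ord (set_ring S) V x = v x"
proof -
  have v1: "v 1 = 0" using mult[of 1 1] by simp
  have v_inv: "v (inverse y) = - v y" if "y \<in> S" "y \<noteq> 0" for y
    using mult[OF that(1) inverse_mem[OF that(1)]] that v1 by simp
  have v_pow: "v (y ^ n) = int n * v y" if "y \<in> S" "y \<noteq> 0" for y n
    by (induction n) (use that v1 mult power_mem in \<open>auto simp: algebra_simps\<close>)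
  have v_powi: "v (y powi n) = n * v y" if "y \<in> S" "y \<noteq> 0" for y n
    using that by (auto simp: power_int_def v_inv v_pow inverse_mem)
  have Units: "Units (set_ring S\<lparr>carrier := V\<rparr>) = {y \<in> S. y \<noteq> 0 \<and> v y = 0}"
  proof (intro subset_antisym subsetI)
    fix y assume "y \<in> Units (set_ring S\<lparr>carrier := V\<rparr>)"
    then obtain z where yz: "y \<in> V" "z \<in> V" "y * z = 1" by (auto simp: Units_def)
    then have nz: "y \<noteq> 0" "z \<noteq> 0" by auto
    then have "v y + v z = 0" "v y \<ge> 0" "v z \<ge> 0"
      using mult[of y z] yz v1 by (auto simp: V)
    then show "y \<in> {y \<in> S. y \<noteq> 0 \<and> v y = 0}" using yz nz by (auto simp: V)
  next
    fix y assume y: "y \<in> {y \<in> S. y \<noteq> 0 \<and> v y = 0}"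
    then have "inverse y \<in> V" "y \<in> V" using v_inv[of y] by (auto simp: V)
    then show "y \<in> Units (set_ring S\<lparr>carrier := V\<rparr>)"
      using y by (auto simp: Units_def intro!: bexI[of _ "inverse y"])
  qed
  have local_parameter: "local_parameter (set_ring S) V s \<longleftrightarrow> s \<in> S
    \<and> s \<noteq> 0 \<and> v s = 1" for s
  proof
    assume "local_parameter (set_ring S) V s"
    then have s: "s \<in> V" and eq: "{y * s | y. y \<in> V} = V - {y \<in> S. y \<noteq> 0 \<and> v y = 0}"
      by (auto simp: local_parameter_def cgenideal_def Units)
    \<comment> \<open>The given \<open>t\<close> of value one lies in the maximal ideal, so
      \<open>t = y * s\<close>. As \<open>s\<close> is a nonunit, \<open>v y + v s = 1\<close>
      permits only \<open>v s = 1\<close>.\<close>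
    have "t \<in> {y * s | y. y \<in> V}" unfolding eq using t by (auto simp: V)
    then obtain y where y: "y \<in> V" "t = y * s" by auto
    then have nz: "y \<noteq> 0" "s \<noteq> 0" using t by auto
    have "1 \<in> V" using v1 by (simp add: V)
    then have "s \<in> {y * s | y. y \<in> V}" by (auto intro!: exI[of _ 1])
    then have "v s \<noteq> 0" unfolding eq using nz by (auto simp: V)
    moreover have "v y \<ge> 0" "v s \<ge> 0" "v y + v s = 1"
      using y s nz mult[of y s] t by (auto simp: V)
    ultimately show "s \<in> S \<and> s \<noteq> 0 \<and> v s = 1" using s nz by (auto simp: V)
  next
    assume s: "s \<in> S \<and> s \<noteq> 0 \<and> v s = 1"
    have "{y * s | y. y \<in> V} = V - {y \<in> S. y \<noteq> 0 \<and> v y = 0}"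
    proof (intro subset_antisym subsetI)
      fix z assume "z \<in> {y * s | y. y \<in> V}"
      then obtain y where y: "z = y * s" "y \<in> S" "y = 0 \<or> v y \<ge> 0" by (auto simp: V)
      then show "z \<in> V - {y \<in> S. y \<noteq> 0 \<and> v y = 0}"
        using s mult[OF y(2), of s] mult_mem[OF y(2), of s] by (cases "y = 0") (simp_all add: V)
    next
      fix z assume z: "z \<in> V - {y \<in> S. y \<noteq> 0 \<and> v y = 0}"
      have "z / s \<in> V"
        using z s mult[of z "inverse s", OF _ inverse_mem] v_inv[of s]
        by (cases "z = 0") (auto simp: V divide_inverse)
      moreover have "z = (z / s) * s" using s by simp
      ultimately show "z \<in> {y * s | y. y \<in> V}" by blast
    qed
    moreover have "s \<in> V" using s by (simp add: V)
    ultimately show "local_parameter (set_ring S) V s"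
      by (simp add: local_parameter_def cgenideal_def Units)
  qed
  show ?thesis
    unfolding place_ord_def
  proof (rule the_equality)
    have p: "t powi v x \<in> S" "t powi v x \<noteq> 0" using t by auto
    have "v (x / t powi v x) = v x + v (inverse (t powi v x))"
      unfolding divide_inverse using x p inverse_mem[OF p(1)] by (intro mult) auto
    also have "\<dots> = 0"
      using v_inv[OF p] v_powi[OF t(1,2), of "v x"] t(3) by simp
    finally have "v (x / t powi v x) = 0" .
    moreover have "x = t powi v x * (x / t powi v x)" using t by simp
    moreover have "x / t powi v x \<in> S" "x / t powi v x \<noteq> 0" using x t by auto
    ultimately show "\<exists>s u. local_parameter (set_ring S) V s \<and>
        u \<in> Units (set_ring S\<lparr>carrier := V\<rparr>) \<and> x
          = s [^]\<^bsub>set_ring S\<^esub> v x \<otimes>\<^bsub>set_ring S\<^esub> u"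
      using t unfolding local_parameter Units
      by (intro exI[of _ t] exI[of _ "x / t powi v x"]) (simp add: int_pow_set_ring)
  next
    fix n :: int
    assume "\<exists>s u. local_parameter (set_ring S) V s \<and>
        u \<in> Units (set_ring S\<lparr>carrier := V\<rparr>) \<and> x
          = s [^]\<^bsub>set_ring S\<^esub> n \<otimes>\<^bsub>set_ring S\<^esub> u"
    then obtain s u where su: "s \<in> S" "s \<noteq> 0" "v s = 1" "u \<in> S" "u \<noteq> 0" "v u
      = 0" "x = s powi n * u"
      unfolding local_parameter Units by (auto simp: int_pow_set_ring)
    then show "n = v x"
      using mult[of "s powi n" u, OF power_int_mem] v_powi[of s n] by auto
  qed
qed

end

section \<open>Dimensions of Riemann--Roch spaces\<close>

text \<open>The assumption \<open>residue\<close> expresses that all places have degree one: the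
  leading coefficients of functions of equal order are proportional over \<open>K\<close>.\<close>

locale valued_field = set_field S for S :: "'a::field set" +
  fixes K :: "'a set" and Pl :: "'p set" and ord :: "'p \<Rightarrow> 'a \<Rightarrow> int"
  assumes K: "set_field K" "K \<subseteq> S"
    and ord_add: "P \<in> Pl \<Longrightarrow> x \<in> S \<Longrightarrow> y \<in> S
      \<Longrightarrow> x \<noteq> 0 \<Longrightarrow> y \<noteq> 0 \<Longrightarrow> x
      + y \<noteq> 0 \<Longrightarrow>
      ord P (x + y) \<ge> min (ord P x) (ord P y)"
    and ord_scale: "P \<in> Pl \<Longrightarrow> k \<in> K \<Longrightarrow> x \<in> S
      \<Longrightarrow> k \<noteq> 0 \<Longrightarrow> x \<noteq> 0 \<Longrightarrow> ord P (k * x) = ord P x"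
    and residue: "P \<in> Pl \<Longrightarrow> x \<in> S \<Longrightarrow> y \<in> S
      \<Longrightarrow> x \<noteq> 0 \<Longrightarrow> y \<noteq> 0 \<Longrightarrow> ord P x
      = ord P y \<Longrightarrow>
      \<exists>k\<in>K. x - k * y = 0 \<or> ord P (x - k * y) > ord P x"
begin

definition L :: "('p \<Rightarrow> int) \<Rightarrow> 'a set" where
  "L D = {x \<in> S. x = 0 \<or> (\<forall>P\<in>Pl. ord P x \<ge> - D P)}"

interpretation K: set_field K by (rule K)

lemma subfield_K: "subfield K (set_ring S)"
  by (rule subfield_set_ring[OF K])

lemma zero_L [simp]: "0 \<in> L D"
  by (simp add: L_def)

lemma scale_L: "k \<in> K \<Longrightarrow> x \<in> L D \<Longrightarrow> k * x \<in> L D"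
  using K(2) ord_scale by (auto simp: L_def)

lemma add_L: "x \<in> L D \<Longrightarrow> y \<in> L D \<Longrightarrow> x + y \<in> L D"
proof (cases "x = 0 \<or> y = 0 \<or> x + y = 0")
  case False
  assume "x \<in> L D" "y \<in> L D"
  then have xy: "x \<in> S" "y \<in> S" "\<And>P. P \<in> Pl \<Longrightarrow> ord P x \<ge>
    - D P" "\<And>P. P \<in> Pl \<Longrightarrow> ord P y \<ge> - D P"
    using False by (auto simp: L_def)
  have "ord P (x + y) \<ge> - D P" if "P \<in> Pl" for P
    using ord_add[OF that xy(1,2)] False xy(3,4)[OF that] by linarith
  then show ?thesis using xy by (auto simp: L_def)
qed auto

lemma uminus_L: "x \<in> L D \<Longrightarrow> - x \<in> L D"
  using scale_L[of "- 1" x D] by auto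

lemma L_mono: "(\<And>P. P \<in> Pl \<Longrightarrow> D P \<le> D' P) \<Longrightarrow> L D \<subseteq> L D'"
  by (auto simp: L_def) (meson neg_le_iff_le order_trans)

lemma subalgebra_L: "subalgebra K (L D) (set_ring S)"
proof (rule subalgebra.intro)
  show "subgroup (L D) (add_monoid (set_ring S))"
  proof (rule T.add.subgroupI)
    show "\<ominus>\<^bsub>set_ring S\<^esub> a \<in> L D" if "a \<in> L D" for a
      using uminus_L[OF that] uminus_set_ring[of a] that by (auto simp: L_def)
  qed (use zero_L add_L in \<open>auto simp: L_def\<close>)
  show "subalgebra_axioms K (L D) (set_ring S)"
    by unfold_locales (use scale_L in auto)
qed

text \<open>A function in the larger space but not in \<open>L D\<close> has order exactly
  \<open>- D P - 1\<close> at \<open>P\<close>. By \<open>residue\<close> it agrees with a multiple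
  of \<open>y\<close> up to higher order, and the difference lies in \<open>L D\<close>.\<close>

lemma L_step:
  assumes P: "P \<in> Pl" and y: "y \<in> L (D(P := D P + 1))" "y \<notin> L D"
  shows "L (D(P := D P + 1)) = T.line_extension K y (L D)"
proof (intro subset_antisym subsetI)
  let ?D = "D(P := D P + 1)"
  have key: "z \<in> L D" if "z \<in> L ?D" "z = 0 \<or> ord P z \<ge> - D P" for z
  proof (cases "z = 0")
    case False
    have "ord Q z \<ge> - D Q" if "Q \<in> Pl" for Q
      using \<open>z \<in> L ?D\<close> \<open>z = 0 \<or> ord P z \<ge> - D P\<close> False that
      by (cases "Q = P") (auto simp: L_def)
    then show ?thesis using that by (auto simp: L_def)
  qed simp
  have y0: "y \<noteq> 0" "y \<in> S" and yQ: "\<And>Q. Q \<in> Pl \<Longrightarrow> ord Q y \<ge> - ?D Q"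
    using y by (auto simp: L_def)
  have yP: "ord P y = - D P - 1"
  proof (rule ccontr)
    assume "ord P y \<noteq> - D P - 1"
    then have "ord P y \<ge> - D P" using yQ[OF P] by simp
    then have "y \<in> L D" using key y(1) by blast
    with y show False by simp
  qed
  fix x assume x: "x \<in> L ?D"
  have "\<exists>k\<in>K. x - k * y \<in> L D"
  proof (cases "x \<in> L D")
    case True
    then show ?thesis by (intro bexI[of _ 0]) auto
  next
    case False
    then have x0: "x \<noteq> 0" "x \<in> S" and xQ: "\<And>Q. Q \<in> Pl
      \<Longrightarrow> ord Q x \<ge> - ?D Q"
      using x by (auto simp: L_def)
    have xP: "ord P x = - D P - 1"
    proof (rule ccontr)
      assume "ord P x \<noteq> - D P - 1"
      then have "ord P x \<ge> - D P" using xQ[OF P] by simp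
      then have "x \<in> L D" using key x by blast
      with False show False by simp
    qed
    obtain k where k: "k \<in> K" "x - k * y = 0 \<or> ord P (x - k * y) > ord P x"
      using residue[OF P x0(2) y0(2) x0(1) y0(1)] xP yP by auto
    have "x - k * y \<in> L ?D"
      using add_L[OF x uminus_L[OF scale_L[OF k(1) y(1)]]] by simp
    then have "x - k * y \<in> L D"
      using k(2) xP by (intro key) auto
    with k(1) show ?thesis by blast
  qed
  then show "x \<in> T.line_extension K y (L D)"
    unfolding T.line_extension_mem_iff by (metis diff_add_cancel set_ring_simps(2,5) add.commute)
next
  let ?D = "D(P := D P + 1)"
  fix x assume "x \<in> T.line_extension K y (L D)"
  then obtain k v where "k \<in> K" "v \<in> L D" "x = k * y + v"
    unfolding T.line_extension_mem_iff by auto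
  moreover have "L D \<subseteq> L ?D" by (rule L_mono) auto
  ultimately show "x \<in> L ?D" using add_L[OF scale_L[OF _ y(1)]] by auto
qed

lemma dimension_step:
  assumes "P \<in> Pl" "T.dimension n K (L D)"
  obtains m where "T.dimension m K (L (D(P := D P + 1)))" "m \<le> n + 1"
    "L D \<noteq> L (D(P := D P + 1)) \<Longrightarrow> m = n + 1"
proof (cases "L D = L (D(P := D P + 1))")
  case True
  then show ?thesis using that[of n] assms by simp
next
  case False
  moreover have "L D \<subseteq> L (D(P := D P + 1))" by (rule L_mono) auto
  ultimately obtain y where y: "y \<in> L (D(P := D P + 1))" "y \<notin> L D" by blast
  then have "y \<in> carrier (set_ring S)" by (auto simp: L_def)
  then have "T.dimension (Suc n) K (L (D(P := D P + 1)))"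
    unfolding L_step[OF assms(1) y] using y(2) assms(2) by (intro T.Suc_dim)
  then show ?thesis using that[of "Suc n"] by simp
qed

text \<open>Iterating the step shows that \<open>deg D - l(D)\<close> can only grow with
  \<open>D\<close>. The induction runs over the degree of \<open>D' - D\<close>.\<close>

lemma dimension_mono:
  fixes D D' :: "'p \<Rightarrow> int"
  assumes "finite A" "A \<subseteq> Pl" "\<And>P. D P \<le> D' P" "\<And>P. P \<notin> A
    \<Longrightarrow> D P = D' P"
    and "T.dimension n K (L D)"
  shows "\<exists>m. T.dimension m K (L D') \<and> int m \<le> int n + (\<Sum>P\<in>A. D' P - D P)"
  using assms(3-)
proof (induction "nat (\<Sum>P\<in>A. D' P - D P)" arbitrary: D n)
  case 0
  have "(\<Sum>P\<in>A. D' P - D P) = 0"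
    using 0 by (intro antisym sum_nonneg) auto
  then have "\<forall>P\<in>A. D' P - D P = 0"
    using 0(2) assms(1) by (subst (asm) sum_nonneg_eq_0_iff) auto
  then have "D' = D" using 0(3) by (intro ext) (metis diff_eq_diff_eq diff_self eq_iff_diff_eq_0)
  then show ?case using 0 by auto
next
  case (Suc k)
  have "\<exists>P\<in>A. D P < D' P"
  proof (rule ccontr)
    assume "\<not> ?thesis"
    then have "(\<Sum>P\<in>A. D' P - D P) \<le> 0" by (intro sum_nonpos) auto
    with Suc(2) show False by simp
  qed
  then obtain P where P: "P \<in> A" "D P < D' P" by blast
  let ?D = "D(P := D P + 1)"
  have "(\<Sum>Q\<in>A. D' Q - D Q) = (\<Sum>Q\<in>A. (D' Q - ?D Q) + (if Q = P then 1 else 0))"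
    by (intro sum.cong) auto
  also have "\<dots> = (\<Sum>Q\<in>A. D' Q - ?D Q) + 1"
    using P assms(1) by (subst sum.distrib) simp
  finally have sum: "(\<Sum>Q\<in>A. D' Q - D Q) = (\<Sum>Q\<in>A. D' Q - ?D Q) + 1" .
  obtain m where m: "T.dimension m K (L ?D)" "m \<le> n + 1"
    using dimension_step[OF _ Suc(5), of P] P(1) assms(2) by blast
  have "k = nat (\<Sum>Q\<in>A. D' Q - ?D Q)" using Suc(2) sum by linarith
  moreover have "\<And>Q. ?D Q \<le> D' Q" using Suc(3) P by auto
  moreover have "\<And>Q. Q \<notin> A \<Longrightarrow> ?D Q = D' Q" using Suc(4) P by auto
  ultimately have "\<exists>m'. T.dimension m' K (L D') \<and> int m' \<le> int m +
    (\<Sum>Q\<in>A. D' Q - ?D Q)"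
    using Suc(1)[of ?D m] m(1) by blast
  then obtain m' where "T.dimension m' K (L D')" "int m' \<le> int m + (\<Sum>Q\<in>A. D' Q - ?D Q)"
    by blast
  then show ?case using sum m(2) by (intro exI[of _ m']) auto
qed

text \<open>The positive part of \<open>D\<close> lies above both zero and \<open>D\<close>: it is
  reached from zero by finitely many steps, and its space contains \<open>L D\<close>.\<close>

lemma finite_dimension_L:
  assumes "T.dimension n K (L
    (\<lambda>_. 0))" "finite A" "A \<subseteq> Pl" "\<And>P. P \<notin> A \<Longrightarrow> D P = 0"
  shows "\<exists>m. T.dimension m K (L D)"
proof -
  obtain m where "T.dimension m K (L (\<lambda>P. max 0 (D P)))"
    using dimension_mono[OF assms(2,3) _ _ assms(1), of "\<lambda>P. max 0 (D P)"] assms(4) by auto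
  then have "T.finite_dimension K (L (\<lambda>P. max 0 (D P)))" by (rule T.finite_dimensionI)
  moreover have "L D \<subseteq> L (\<lambda>P. max 0 (D P))" by (rule L_mono) auto
  ultimately have "T.finite_dimension K (L D)"
    using T.subalbegra_incl_imp_finite_dimension[OF subfield_K _ subalgebra_L] by blast
  then show ?thesis by (auto simp: T.finite_dimension_def)
qed

lemma dim_L: "T.dimension n K (L D) \<Longrightarrow> T.dim K (L D) = n"
  using T.dimI[OF subfield_K] by (simp add: over_def)

end

section \<open>Evaluation of polynomials along ring homomorphisms\<close>

locale hom_of_rings =
  fixes h :: "'a::comm_ring_1 \<Rightarrow> 'b::comm_ring_1"
  assumes one: "h 1 = 1" and add: "h (x + y) = h x + h y" and mult: "h (x * y) = h x * h y"
begin

lemma zero: "h 0 = 0"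
  using add[of 0 0] by simp

lemma minus: "h (- x) = - h x"
  using add[of x "- x"] zero by (simp add: eq_neg_iff_add_eq_0 add.commute)

lemma diff: "h (x - y) = h x - h y"
  using add[of x "- y"] minus by simp

lemma power: "h (x ^ n) = h x ^ n"
  by (induction n) (simp_all add: one mult)

lemma of_nat: "h (of_nat n) = of_nat n"
  by (induction n) (simp_all add: zero one add)

lemma numeral: "h (numeral n) = numeral n"
  using of_nat[of "numeral n"] by simp

lemma prod: "h (\<Prod>i\<in>A. g i) = (\<Prod>i\<in>A. h (g i))"
  by (induction A rule: infinite_finite_induct) (simp_all add: one mult)

end

text \<open>Since the result is again a ring homomorphism, the construction can be iterated: with
  \<open>h\<close> an evaluation of C[z], it evaluates C[z][y] at a pair.\<close>

definition eval_along :: "('a::comm_ring_1 \<Rightarrow> 'b::comm_ring_1) \<Rightarrow> 'b \<Rightarrow>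
  'a poly \<Rightarrow> 'b" where
  "eval_along h X p = poly (map_poly h p) X"

lemma (in hom_of_rings) eval_along_0 [simp]: "eval_along h X 0 = 0"
  by (simp add: eval_along_def)

lemma (in hom_of_rings) eval_along_pCons: "eval_along h X (pCons c p) = h c + X * eval_along h X p"
  by (simp add: eval_along_def map_poly_pCons zero)

lemma (in hom_of_rings) hom_eval_along: "hom_of_rings (eval_along h X)"
proof
  show "eval_along h X 1 = 1"
    by (simp add: one_pCons eval_along_pCons one)
  show add': "eval_along h X (p + q) = eval_along h X p + eval_along h X q" for p q
    by (induction p q rule: poly_induct2) (simp_all add: eval_along_pCons add algebra_simps)
  have smult': "eval_along h X (Polynomial.smult c q) = h c * eval_along h X q" for c q
    by (induction q) (simp_all add: eval_along_pCons mult algebra_simps)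
  show "eval_along h X (p * q) = eval_along h X p * eval_along h X q" for p q
    by (induction p) (simp_all add: eval_along_pCons add' smult' zero algebra_simps)
qed

section \<open>Laurent series\<close>

lemma hom_fls_const: "hom_of_rings (fls_const :: complex \<Rightarrow> complex fls)"
  by unfold_locales (simp_all add: fls_const_mult_const fls_plus_const)

lemma set_field_constants: "set_field (range (fls_const :: complex \<Rightarrow> complex fls))"
proof
  show "1 \<in> range (fls_const :: complex \<Rightarrow> complex fls)" by (rule range_eqI[of _ _ 1]) simp
qed (auto simp: fls_minus_const fls_inverse_const)

abbreviation ev :: "complex fls \<Rightarrow> complex poly \<Rightarrow> complex fls" where
  "ev X \<equiv> eval_along fls_const X"

interpretation fls_const: hom_of_rings "fls_const :: complex \<Rightarrow> complex fls"
  by (rule hom_fls_const)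

interpretation ev: hom_of_rings "ev X" for X
  by (rule fls_const.hom_eval_along)

lemmas ev_pCons = fls_const.eval_along_pCons

lemma ev_const [simp]: "ev X [:c:] = fls_const c"
  by (simp add: ev_pCons)

lemma ev_linear [simp]: "ev X [:c, d:] = fls_const c + X * fls_const d"
  by (simp add: ev_pCons)

text \<open>Shifting by the order leaves a power series with nonzero constant term, which has a
  root; the even order allows the shift to be halved.\<close>

lemma fls_sqrt_exists:
  fixes u :: "complex fls"
  assumes "even (fls_subdegree u)"
  shows "\<exists>v. v ^ 2 = u"
proof (cases "u = 0")
  case False
  define a where "a = fls_base_factor_to_fps u"
  have a0: "a $ 0 \<noteq> 0" using False by (simp add: a_def)
  define r where "r = fps_radical (\<lambda>_. csqrt) (Suc 1) a"
  have "csqrt (a $ 0) ^ Suc 1 = a $ 0" by (simp only: Suc_1 power2_csqrt)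
  then have "r ^ Suc 1 = a"
    unfolding r_def using power_radical[OF a0, of "\<lambda>_. csqrt" 1] by (rule iffD1[rotated])
  then have "r ^ 2 = a" by (simp only: Suc_1)
  obtain k where k: "fls_subdegree u = 2 * k" using assms by (rule evenE)
  have "fls_shift (- k) (fps_to_fls r) ^ 2 = fls_shift (- k + - k) (fps_to_fls (r ^ 2))"
    unfolding power2_eq_square fls_times_fps_to_fls
    by (simp only: fls_shifted_times_simps fls_shift_fls_shift)
  also have "- k + - k = - fls_subdegree u" using k by simp
  also have "fls_shift (- fls_subdegree u) (fps_to_fls (r ^ 2)) = u"
    unfolding \<open>r ^ 2 = a\<close> a_def by (rule fls_conv_base_factor_to_fps_shift_subdegree[symmetric])
  finally show ?thesis by blast
qed (auto intro: exI[of _ 0])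

lemma fls_regular_mult:
  fixes u v :: "complex fls"
  assumes "fls_subdegree u \<ge> 0" "fls_subdegree v \<ge> 0"
  shows "fls_nth (u * v) 0 = fls_nth u 0 * fls_nth v 0"
proof -
  obtain a b where "u = fps_to_fls a" "v = fps_to_fls b"
    using assms fls_regpart_to_fls_trivial by metis
  then show ?thesis by (simp add: fls_times_fps_to_fls[symmetric])
qed

lemma fls_regular_add:
  fixes u v :: "complex fls"
  assumes "fls_subdegree u \<ge> n" "fls_subdegree v \<ge> n" "n \<le> 0"
  shows "fls_subdegree (u + v) \<ge> n"
  using assms fls_plus_subdegree[of u v] by (cases "u + v = 0") auto

lemma ev_regular:
  assumes "fls_subdegree X \<ge> 0"
  shows "fls_subdegree (ev X p) \<ge> 0" "fls_nth (ev X p) 0 = poly p (fls_nth X 0)"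
proof -
  have "fls_subdegree (ev X p) \<ge> 0 \<and> fls_nth (ev X p) 0 = poly p (fls_nth X 0)"
  proof (induction p)
    case (pCons c p)
    then have "fls_subdegree (X * ev X p) \<ge> 0" using fls_mult_subdegree_ge_0 assms by blast
    then show ?case
      using pCons assms fls_regular_add[of 0 "fls_const c" "X * ev X p"]
      by (simp add: ev_pCons fls_regular_mult fls_const_subdegree)
  qed simp
  then show "fls_subdegree (ev X p) \<ge> 0" "fls_nth (ev X p) 0 = poly p (fls_nth X 0)" by auto
qed

text \<open>When the power of the factor with root \<open>a\<close> is split off from
  \<open>p\<close>, the cofactor has a nonzero value, and the factor itself evaluates to
  \<open>u\<close>.\<close>

lemma ev_subdegree_affine:
  fixes p :: "complex poly"
  assumes X: "X = fls_const a + u" "fls_subdegree u = e" "e > 0" and p: "p \<noteq> 0"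
  shows "fls_subdegree (ev X p) = e * int (Polynomial.order a p)" "ev X p \<noteq> 0"
proof -
  have u0: "u \<noteq> 0" using X by auto
  have Xreg: "fls_subdegree X \<ge> 0"
    unfolding X(1) by (rule fls_regular_add) (use X in auto)
  have X0: "fls_nth X 0 = a"
    using X by (simp add: fls_eq0_below_subdegree)
  obtain q where q: "p = [:- a, 1:] ^ Polynomial.order a p * q" "\<not> [:- a, 1:] dvd q"
    using order_decomp[OF p] by blast
  have "poly q a \<noteq> 0" using q(2) by (simp add: poly_eq_0_iff_dvd)
  then have nth: "fls_nth (ev X q) 0 \<noteq> 0" using ev_regular(2)[OF Xreg, of q] X0 by simp
  then have q0: "ev X q \<noteq> 0" by auto
  have "fls_subdegree (ev X q) = 0"
    using ev_regular(1)[OF Xreg, of q] fls_subdegree_leI[OF nth] by linarith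
  moreover have eq: "ev X p = u ^ Polynomial.order a p * ev X q"
    by (subst q(1)) (simp add: ev.mult ev.power X(1) fls_const_uminus)
  ultimately show "fls_subdegree (ev X p) = e * int (Polynomial.order a p)" "ev X p \<noteq> 0"
    using u0 q0 X(2) by (simp_all add: fls_subdegree_pow)
qed

text \<open>In Horner's scheme the term multiplied by \<open>X\<close> has negative order and so
  dominates the constant added to it.\<close>

lemma ev_subdegree_infinity:
  fixes p :: "complex poly"
  assumes "fls_subdegree X < 0" "p \<noteq> 0"
  shows "fls_subdegree (ev X p) = fls_subdegree X * int (degree p) \<and> ev X p \<noteq> 0"
  using assms(2)
proof (induction p)
  case (pCons c p)
  show ?case
  proof (cases "p = 0")
    case True
    then show ?thesis using pCons by (simp add: fls_const_subdegree)
  next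
    case False
    have X0: "X \<noteq> 0" using assms by auto
    have IH: "fls_subdegree (ev X p) = fls_subdegree X * int (degree p)" "ev X p \<noteq> 0"
      using pCons False by auto
    have sub: "fls_subdegree (X * ev X p) = fls_subdegree X * int (Suc (degree p))"
      using IH X0 by (simp add: algebra_simps)
    have "fls_subdegree X * int (Suc (degree p)) < 0" using assms(1) by (simp add: mult_neg_pos)
    then have less: "fls_subdegree (X * ev X p) < fls_subdegree (fls_const c)"
      unfolding sub by (simp add: fls_const_subdegree)
    have nz: "X * ev X p \<noteq> 0" using IH X0 by simp
    have "ev X (pCons c p) \<noteq> 0"
    proof
      assume "ev X (pCons c p) = 0"
      then have "X * ev X p = fls_const (- c)"
        by (simp add: ev_pCons fls_const_uminus eq_neg_iff_add_eq_0 add.commute)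
      then show False using less by (simp add: fls_const_subdegree)
    qed
    then show ?thesis
      using fls_subdegree_add_eq2[OF nz less] sub False
      by (simp add: ev_pCons)
  qed
qed simp

lemma fls_subdegree_sq: "fls_subdegree ((v :: complex fls) ^ 2) = 2 * fls_subdegree v"
  by (simp add: fls_subdegree_pow)

lemma fls_residue:
  fixes u v :: "complex fls"
  assumes "u \<noteq> 0" "v \<noteq> 0" "fls_subdegree u = fls_subdegree v"
  shows "\<exists>c. u - fls_const c * v = 0 \<or> fls_subdegree (u - fls_const c * v) > fls_subdegree u"
proof (intro exI disjCI)
  let ?n = "fls_subdegree u"
  define c where "c = fls_nth u ?n / fls_nth v ?n"
  let ?d = "u - fls_const c * v"
  assume not_greater: "\<not> fls_subdegree ?d > ?n"
  have c: "c * fls_nth v ?n = fls_nth u ?n" using assms by (simp add: c_def)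
  have nth: "fls_nth ?d k = 0" if "k \<le> ?n" for k
  proof -
    have "fls_nth ?d k = fls_nth u k - c * fls_nth v k" by (simp add: fls_mult_const_nth)
    moreover have "k = ?n \<or> (fls_nth u k = 0 \<and> fls_nth v k = 0)"
      using that assms(3) by (cases "k = ?n") simp_all
    ultimately show ?thesis using c by auto
  qed
  show "?d = 0"
  proof (rule ccontr)
    assume "?d \<noteq> 0"
    then have "fls_subdegree ?d > ?n" using nth by (intro fls_subdegree_greaterI) auto
    with not_greater show False by simp
  qed
qed

lemma fls_add_subdegree_neq:
  fixes u v :: "complex fls"
  assumes "u \<noteq> 0" "fls_subdegree u < fls_subdegree v"
  shows "u + v \<noteq> 0" "fls_subdegree (u + v) = fls_subdegree u"
proof -
  show "u + v \<noteq> 0"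
  proof
    assume "u + v = 0"
    then have "u = - v" by (simp only: eq_neg_iff_add_eq_0)
    then show False using assms(2) by simp
  qed
  show "fls_subdegree (u + v) = fls_subdegree u" using fls_subdegree_add_eq1[OF assms] .
qed

text \<open>Orders of different parity are different, so the leading terms cannot cancel and the
  smaller order survives.\<close>

lemma fls_subdegree_even_plus_odd:
  fixes u v :: "complex fls"
  assumes "u \<noteq> 0 \<Longrightarrow> even (fls_subdegree u)" "v \<noteq> 0 \<Longrightarrow> odd
    (fls_subdegree v)" "u \<noteq> 0 \<or> v \<noteq> 0"
  shows "u + v \<noteq> 0 \<and> (u \<noteq> 0 \<longrightarrow> fls_subdegree (u
    + v) \<le> fls_subdegree u) \<and>
    (v \<noteq> 0 \<longrightarrow> fls_subdegree (u + v) \<le> fls_subdegree v)"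
proof (cases "u = 0 \<or> v = 0")
  case False
  then consider "fls_subdegree u < fls_subdegree v" | "fls_subdegree v < fls_subdegree u"
    using assms(1,2) by (metis linorder_neqE)
  then show ?thesis
    by cases (use fls_add_subdegree_neq[of u v] fls_add_subdegree_neq[of v u] False in
      \<open>simp_all add: add.commute\<close>)
qed (use assms(3) in auto)

section \<open>The function field of an elliptic curve\<close>

text \<open>Simple roots make the affine curve w^2 = f(x) smooth, and the odd degree leaves a single
  point at infinity.\<close>

locale elliptic =
  fixes f :: "complex poly"
  assumes degree_f: "degree f = 3" and monic_f: "lead_coeff f = 1"
    and squarefree_f: "poly f a = 0 \<Longrightarrow> poly (pderiv f) a \<noteq> 0"
begin

text \<open>\<open>None\<close> is the point at infinity. The charts below expand the coordinates
  \<open>x\<close> and \<open>w\<close> of \<open>w\<^sup>2 = f(x)\<close> in a local parameter at each point,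
  chosen such that \<open>x\<close> is even and \<open>w\<close> is odd at the points fixed by \<open>w \<mapsto> - w\<close>.\<close>

definition points :: "(complex \<times> complex) option set" where
  "points = insert None {Some (a, b) | a b. b ^ 2 = poly f a}"

definition X :: "(complex \<times> complex) option \<Rightarrow> complex fls" where
  "X P = (case P of None \<Rightarrow> fls_X_inv ^ 2
     | Some (a, b) \<Rightarrow> fls_const a + (if b = 0 then fls_X ^ 2 else fls_X))"

lemma f_nonzero: "f \<noteq> 0"
  using degree_f by auto

lemma order_f: "poly f a = 0 \<Longrightarrow> Polynomial.order a f = 1"
  using order_pderiv[OF f_nonzero, of a] order_0I[OF squarefree_f, of a] by simp

lemma affine_subdegree:
  assumes "p \<noteq> 0"
  shows "fls_subdegree (ev (X (Some (a, b))) p) = (if b = 0 then 2 else 1) * int (Polynomial.order a p)"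
    "ev (X (Some (a, b))) p \<noteq> 0"
proof -
  let ?u = "if b = 0 then fls_X ^ 2 else fls_X :: complex fls"
  have X: "X (Some (a, b)) = fls_const a + ?u" by (simp add: X_def)
  have u: "fls_subdegree ?u = (if b = 0 then 2 else 1)"
    by (simp add: fls_subdegree_sq fls_X_subdegree)
  have e: "0 < (if b = 0 then 2 else 1 :: int)" by simp
  show "fls_subdegree (ev (X (Some (a, b))) p) = (if b = 0 then 2 else 1) * int (Polynomial.order a p)"
    "ev (X (Some (a, b))) p \<noteq> 0"
    by (rule ev_subdegree_affine[OF X u e assms])+
qed

lemma X_infinity: "fls_subdegree (X None) = - 2"
  by (simp add: X_def fls_subdegree_sq)

lemma infinity_subdegree:
  assumes "p \<noteq> 0"
  shows "fls_subdegree (ev (X None) p) = - 2 * int (degree p)" "ev (X None) p \<noteq> 0"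
  using ev_subdegree_infinity[OF _ assms, of "X None"] X_infinity by simp_all

lemma X_regular: "fls_subdegree (X (Some (a, b))) \<ge> 0" "fls_nth (X (Some (a, b))) 0 = a"
proof -
  let ?u = "if b = 0 then fls_X ^ 2 else fls_X :: complex fls"
  have X: "X (Some (a, b)) = fls_const a + ?u" by (simp add: X_def)
  have u: "fls_subdegree ?u = (if b = 0 then 2 else 1)"
    by (simp add: fls_subdegree_sq fls_X_subdegree)
  have "fls_subdegree ?u \<ge> 0" unfolding u by simp
  then show "fls_subdegree (X (Some (a, b))) \<ge> 0"
    unfolding X by (intro fls_regular_add) (simp_all only: fls_const_subdegree order_refl)
  have "fls_nth ?u 0 = 0" by (rule fls_eq0_below_subdegree) (simp only: u split: if_split, simp)
  then show "fls_nth (X (Some (a, b))) 0 = a" unfolding X by simp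
qed

lemma den_nonzero: "C \<noteq> 0 \<Longrightarrow> ev (X P) C \<noteq> 0"
  using affine_subdegree(2) infinity_subdegree(2) by (cases P) auto

text \<open>Where \<open>b = 0\<close>, the simple root of \<open>f\<close> counts twice because
  \<open>x - a\<close> is a square in the chart. This gives \<open>w\<close> the order one
  there.\<close>

lemma f_subdegree: "Some (a, b) \<in> points \<Longrightarrow>
    fls_subdegree (ev (X (Some (a, b))) f) = (if b = 0 then 2 else 0)"
  using affine_subdegree(1)[OF f_nonzero, of a b] order_f[of a] order_0I[of f a] zero_eq_power2[of b]
  by (cases "b = 0") (simp_all add: points_def)

lemma f_subdegree_infinity: "fls_subdegree (ev (X None) f) = - 6"
  using infinity_subdegree(1)[OF f_nonzero] degree_f by simp

text \<open>The order of \<open>f(x)\<close> is even in every chart, so a root exists, and one of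
  its two signs takes the value \<open>b\<close> at \<open>(a, b)\<close>. At infinity the sign is a
  free choice that fixes the embedding of the field.\<close>

lemma W_exists:
  assumes "P \<in> points"
  shows "\<exists>v. v ^ 2 = ev (X P) f \<and> (\<forall>a b. P = Some
    (a, b) \<longrightarrow> fls_nth v 0 = b)"
proof -
  have "even (fls_subdegree (ev (X P) f))"
  proof (cases P)
    case (Some ab)
    then show ?thesis using f_subdegree[of "fst ab" "snd ab"] assms by simp
  qed (simp add: f_subdegree_infinity)
  then obtain v where v: "v ^ 2 = ev (X P) f" using fls_sqrt_exists by blast
  show ?thesis
  proof (cases P)
    case (Some ab)
    obtain a b where ab: "P = Some (a, b)" using Some by (cases ab) auto
    have b: "b ^ 2 = poly f a" using assms ab by (auto simp: points_def)
    have "2 * fls_subdegree v = fls_subdegree (ev (X P) f)" using v fls_subdegree_sq by metis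
    then have reg: "fls_subdegree v \<ge> 0" using f_subdegree[of a b] assms ab by (simp split: if_splits)
    have "fls_nth v 0 ^ 2 = fls_nth (ev (X P) f) 0"
      unfolding v[symmetric] power2_eq_square by (rule fls_regular_mult[OF reg reg, symmetric])
    also have "\<dots> = b ^ 2"
      unfolding ab b using ev_regular(2)[OF X_regular(1)] X_regular(2) by simp
    finally have "fls_nth v 0 = b \<or> fls_nth (- v) 0 = b"
      by (simp add: power2_eq_iff) (metis minus_equation_iff)
    moreover have "(- v) ^ 2 = ev (X P) f" using v by simp
    ultimately show ?thesis using v ab by (metis option.inject prod.inject)
  qed (use v in auto)
qed

definition W :: "(complex \<times> complex) option \<Rightarrow> complex fls" where
  "W P = (SOME v. v ^ 2 = ev (X P) f \<and> (\<forall>a b. P = Some (a, b) \<longrightarrow> fls_nth v 0 = b))"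

lemma W_sq: "P \<in> points \<Longrightarrow> W P * W P = ev (X P) f"
  using someI_ex[OF W_exists, of P] unfolding W_def power2_eq_square by blast

lemma W_nth: "Some (a, b) \<in> points \<Longrightarrow> fls_nth (W (Some (a, b))) 0 = b"
  using someI_ex[OF W_exists, of "Some (a, b)"] unfolding W_def by blast

lemma W_subdegree: "Some (a, b) \<in> points \<Longrightarrow> fls_subdegree (W (Some (a, b))) = (if b
  = 0 then 1 else 0)"
  using f_subdegree[of a b] W_sq[of "Some (a, b)"] fls_subdegree_sq[of "W (Some (a, b))"]
  by (auto simp: power2_eq_square split: if_splits)

lemma None_point [simp]: "None \<in> points"
  by (simp add: points_def)

lemma W_infinity: "fls_subdegree (W None) = - 3"
  using f_subdegree_infinity W_sq[OF None_point] fls_subdegree_sq[of "W None"]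
  by (simp add: power2_eq_square)

lemma W_nonzero: "P \<in> points \<Longrightarrow> W P \<noteq> 0"
  using W_sq[of P] den_nonzero[OF f_nonzero, of P] by auto

section \<open>Expansions of the functions A(x) + B(x) w\<close>

definition num :: "(complex \<times> complex) option \<Rightarrow> complex poly \<Rightarrow> complex
  poly \<Rightarrow> complex fls" where
  "num P A B = ev (X P) A + ev (X P) B * W P"

lemma num_mult: "P \<in> points \<Longrightarrow> num P A B * num P A' B' = num P (A * A' + B * B' * f)
  (A * B' + B * A')"
proof -
  assume P: "P \<in> points"
  have "num P A B * num P A' B' = ev (X P) A * ev (X P) A' + ev (X P) B * ev (X P) B' * (W P * W P)
      + (ev (X P) A * ev (X P) B' + ev (X P) B * ev (X P) A') * W P"
    unfolding num_def by (simp only: ring_distribs ac_simps)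
  then show ?thesis unfolding W_sq[OF P] num_def ev.add ev.mult .
qed

lemma num_scale: "num P A B * ev (X P) C = num P (A * C) (B * C)"
  unfolding num_def ev.mult by (simp only: ring_distribs ac_simps)

lemma num_diff: "num P A B - num P A' B' = num P (A - A') (B - B')"
  unfolding num_def ev.diff by (simp only: ring_distribs add_diff_add)

lemma num_add: "num P A B + num P A' B' = num P (A + A') (B + B')"
  unfolding num_def ev.add by (simp only: ring_distribs ac_simps)

lemma num_0 [simp]: "num P A 0 = ev (X P) A"
  unfolding num_def by (simp add: ev.zero)

text \<open>At the points fixed by \<open>w \<mapsto> - w\<close> the two parts of
  \<open>A(x) + B(x) w\<close> have orders of different parity and cannot cancel.\<close>

lemma num_ramified:
  assumes "P = None \<or> (\<exists>a. P = Some (a, 0))" "P \<in> points" "A \<noteq> 0 \<or> B \<noteq> 0"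
  shows "num P A B \<noteq> 0"
    "A \<noteq> 0 \<Longrightarrow> fls_subdegree (num P A B) \<le> fls_subdegree (ev (X P) A)"
    "B \<noteq> 0 \<Longrightarrow> fls_subdegree (num P A B) \<le> fls_subdegree (ev (X P) B)
      + fls_subdegree (W P)"
proof -
  have even: "even (fls_subdegree (ev (X P) p))" if "p \<noteq> 0" for p
    using assms(1) affine_subdegree(1)[OF that] infinity_subdegree(1)[OF that] by auto
  have W: "odd (fls_subdegree (W P))" "W P \<noteq> 0"
    using assms(1,2) W_subdegree W_infinity W_nonzero by auto
  have sub: "fls_subdegree (ev (X P) B * W P) = fls_subdegree (ev (X P) B) + fls_subdegree (W P)"
    if "B \<noteq> 0" using den_nonzero[OF that] W(2) by (rule fls_subdegree_mult)
  have 1: "even (fls_subdegree (ev (X P) A))" if "ev (X P) A \<noteq> 0"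
    using that even[of A] by (cases "A = 0") (auto simp: ev.zero)
  have 2: "odd (fls_subdegree (ev (X P) B * W P))" if "ev (X P) B * W P \<noteq> 0"
    using that even[of B] W sub by (cases "B = 0") (auto simp: ev.zero)
  have 3: "ev (X P) A \<noteq> 0 \<or> ev (X P) B * W P \<noteq> 0"
    using assms(3) den_nonzero W(2) by auto
  note parity = fls_subdegree_even_plus_odd[OF 1 2 3, folded num_def]
  show "num P A B \<noteq> 0" using parity by blast
  show "fls_subdegree (num P A B) \<le> fls_subdegree (ev (X P) A)" if "A \<noteq> 0"
    using parity den_nonzero[OF that] by blast
  show "fls_subdegree (num P A B) \<le> fls_subdegree (ev (X P) B) + fls_subdegree (W P)" if "B \<noteq> 0"
    unfolding sub[OF that, symmetric] using parity den_nonzero[OF that] W(2) by (simp only: mult_eq_0_iff) blast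
qed

text \<open>The parities at infinity make 1 and \<open>w\<close> linearly independent over C(x), so
  the chart at infinity embeds the whole field C(x, w).\<close>

lemma num_eq_0_iff: "num None A B = 0 \<longleftrightarrow> A = 0 \<and> B = 0"
  using num_ramified(1)[of None A B] by auto

text \<open>This is the field C(x, w), realised by expansions at infinity.\<close>

definition S :: "complex fls set" where
  "S = {num None A B / ev (X None) C | A B C. C \<noteq> 0}"

text \<open>The change of chart from infinity to \<open>P\<close>, by means of some representation
  of \<open>s\<close> as a quotient; \<open>expand_eq\<close> shows that all representations give
  the same series.\<close>

definition expand :: "(complex \<times> complex) option \<Rightarrow> complex fls \<Rightarrow> complex
  fls" where
  "expand P s = (SOME r. \<exists>A B C. C \<noteq> 0 \<and> s = num None A B / ev (X None) C \<and> r
    = num P A B / ev (X P) C)"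

lemma expand_eq:
  assumes "C \<noteq> 0"
  shows "expand P (num None A B / ev (X None) C) = num P A B / ev (X P) C"
  unfolding expand_def
proof (rule some_equality)
  show "\<exists>A' B' C'. C' \<noteq> 0 \<and> num None A B / ev (X None) C = num None A' B' / ev
    (X None) C' \<and>
      num P A B / ev (X P) C = num P A' B' / ev (X P) C'"
    using assms by blast
  fix r assume "\<exists>A' B' C'. C' \<noteq> 0 \<and> num None A B / ev (X None) C
    = num None A' B' / ev (X None) C' \<and>
      r = num P A' B' / ev (X P) C'"
  then obtain A' B' C' where C': "C' \<noteq> 0"
    and eq: "num None A B / ev (X None) C = num None A' B' / ev (X None) C'"
    and r: "r = num P A' B' / ev (X P) C'" by blast
  have "num None A B * ev (X None) C' = num None A' B' * ev (X None) C"
    using eq frac_eq_eq[OF den_nonzero[OF assms] den_nonzero[OF C']] by blast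
  then have "num None (A * C' - A' * C) (B * C' - B' * C) = 0"
    unfolding num_scale num_diff[symmetric] by (simp only: right_minus_eq)
  then have "A * C' = A' * C" "B * C' = B' * C" unfolding num_eq_0_iff by simp_all
  then have "num P A B * ev (X P) C' = num P A' B' * ev (X P) C" unfolding num_scale by simp
  then show "r = num P A B / ev (X P) C"
    unfolding r using frac_eq_eq[OF den_nonzero[OF C'] den_nonzero[OF assms]] by simp
qed

lemma S_cases:
  assumes "s \<in> S"
  obtains A B C where "C \<noteq> 0" "s = num None A B / ev (X None) C"
  using assms unfolding S_def by blast

lemma S_intro: "C \<noteq> 0 \<Longrightarrow> num None A B / ev (X None) C \<in> S"
  unfolding S_def by blast

lemma num_S: "num P A B / ev (X P) 1 = num P A B"
  by (simp only: ev.one div_by_1)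

lemma num_in_S: "num None A B \<in> S"
  using S_intro[of 1 A B] unfolding num_S by simp

lemma expand_num: "expand P (num None A B) = num P A B"
  using expand_eq[of 1 P A B] unfolding num_S by simp

lemma quotient_add:
  assumes "C \<noteq> 0" "C' \<noteq> 0"
  shows "num P A B / ev (X P) C + num P A' B' / ev (X P) C' =
    num P (A * C' + A' * C) (B * C' + B' * C) / ev (X P) (C * C')"
  unfolding add_frac_eq[OF den_nonzero[OF assms(1)] den_nonzero[OF assms(2)]] num_scale num_add ev.mult ..

lemma quotient_mult:
  assumes "P \<in> points"
  shows "num P A B / ev (X P) C * (num P A' B' / ev (X P) C') =
    num P (A * A' + B * B' * f) (A * B' + B * A') / ev (X P) (C * C')"
  unfolding times_divide_times_eq num_mult[OF assms] ev.mult ..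

lemma expand_add:
  assumes "P \<in> points" "s \<in> S" "s' \<in> S"
  shows "expand P (s + s') = expand P s + expand P s'" "s + s' \<in> S"
proof -
  obtain A B C where s: "C \<noteq> 0" "s = num None A B / ev (X None) C" using assms(2) by (rule S_cases)
  obtain A' B' C' where s': "C' \<noteq> 0" "s' = num None A' B' / ev (X None) C'" using assms(3) by
    (rule S_cases)
  have C: "C * C' \<noteq> 0" using s(1) s'(1) by simp
  show "expand P (s + s') = expand P s + expand P s'" "s + s' \<in> S"
    unfolding s(2) s'(2) quotient_add[OF s(1) s'(1)] expand_eq[OF s(1)] expand_eq[OF s'(1)]
      expand_eq[OF C] quotient_add[OF s(1) s'(1)] by (rule refl, rule S_intro[OF C])
qed

lemma expand_mult:
  assumes "P \<in> points" "s \<in> S" "s' \<in> S"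
  shows "expand P (s * s') = expand P s * expand P s'" "s * s' \<in> S"
proof -
  obtain A B C where s: "C \<noteq> 0" "s = num None A B / ev (X None) C" using assms(2) by (rule S_cases)
  obtain A' B' C' where s': "C' \<noteq> 0" "s' = num None A' B' / ev (X None) C'" using assms(3) by
    (rule S_cases)
  have C: "C * C' \<noteq> 0" using s(1) s'(1) by simp
  show "expand P (s * s') = expand P s * expand P s'" "s * s' \<in> S"
    unfolding s(2) s'(2) quotient_mult[OF None_point] expand_eq[OF s(1)] expand_eq[OF s'(1)]
      expand_eq[OF C] quotient_mult[OF assms(1)] by (rule refl, rule S_intro[OF C])
qed

lemma expand_const: "expand P (fls_const c) = fls_const c" "fls_const c \<in> S"
  using expand_num[of P "[:c:]" 0] num_in_S[of "[:c:]" 0] by simp_all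

lemma expand_x: "expand P (X None) = X P" "X None \<in> S"
  using expand_num[of P "[:0, 1:]" 0] num_in_S[of "[:0, 1:]" 0] by simp_all

lemma expand_w: "expand P (W None) = W P" "W None \<in> S"
  using expand_num[of P 0 1] num_in_S[of 0 1] unfolding num_def by (simp_all add: ev.zero ev.one)

lemma expand_ev: "expand P (ev (X None) p) = ev (X P) p" "ev (X None) p \<in> S"
  using expand_num[of P p 0] num_in_S[of p 0] by simp_all

lemma inverse_in_S:
  assumes "s \<in> S"
  shows "inverse s \<in> S"
proof (cases "s = 0")
  case True
  then show ?thesis using assms by simp
next
  case False
  obtain A B C where s: "C \<noteq> 0" "s = num None A B / ev (X None) C" using assms by (rule S_cases)
  \<comment> \<open>The norm of the numerator: its product with the conjugate
    \<open>A - B w\<close>, a polynomial in \<open>x\<close>.\<close>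
  let ?N = "A * A + B * - B * f"
  have nz: "num None A B \<noteq> 0" using False s(2) by auto
  then have nz': "num None A (- B) \<noteq> 0" unfolding num_eq_0_iff by simp
  have eq: "num None A B * num None A (- B) = ev (X None) ?N"
    unfolding num_mult[OF None_point] by (simp add: mult.commute)
  then have "ev (X None) ?N \<noteq> 0" using nz nz' by (metis mult_eq_0_iff)
  then have N: "?N \<noteq> 0" by (metis ev.zero)
  have "inverse s = ev (X None) C / num None A B"
    unfolding s(2) by (rule inverse_divide)
  also have "\<dots> = num None (A * C) (- B * C) / ev (X None) ?N"
    unfolding num_scale[symmetric] eq[symmetric] mult.commute[of _ "ev (X None) C"]
    by (rule nonzero_mult_divide_mult_cancel_right[OF nz', symmetric])
  finally show ?thesis using S_intro[OF N] by simp
qed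

sublocale set_field S
proof
  show "1 \<in> S" using expand_const(2)[of 1] by simp
  show "x * y \<in> S" if "x \<in> S" "y \<in> S" for x y using expand_mult(2)[OF None_point that] .
  show "inverse x \<in> S" if "x \<in> S" for x using that by (rule inverse_in_S)
  show "x - y \<in> S" if "x \<in> S" "y \<in> S" for x y
    using expand_add(2)[OF None_point that(1) expand_mult(2)[OF None_point expand_const(2)[of "- 1"] that(2)]]
    by simp
qed

lemma expand_zero [simp]: "expand P 0 = 0"
  using expand_const(1)[of P 0] by simp

lemma expand_one [simp]: "expand P 1 = 1"
  using expand_const(1)[of P 1] by simp

lemma expand_nonzero: "P \<in> points \<Longrightarrow> s \<in> S
  \<Longrightarrow> s \<noteq> 0 \<Longrightarrow> expand P s \<noteq> 0"
  using expand_mult(1)[of P s "inverse s"] inverse_in_S[of s] by auto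

lemma expand_diff: "P \<in> points \<Longrightarrow> s \<in> S
  \<Longrightarrow> s' \<in> S \<Longrightarrow> expand P (s - s') = expand P s - expand P s'"
  using expand_add(1)[of P "s - s'" s'] diff_mem[of s s'] by (simp add: eq_diff_eq)

section \<open>Orders of functions at the points\<close>

definition val :: "(complex \<times> complex) option \<Rightarrow> complex fls \<Rightarrow> int" where
  "val P s = fls_subdegree (expand P s)"

lemma val_mult: "P \<in> points \<Longrightarrow> s \<in> S
  \<Longrightarrow> s' \<in> S \<Longrightarrow> s \<noteq> 0 \<Longrightarrow> s' \<noteq> 0 \<Longrightarrow>
    val P (s * s') = val P s + val P s'"
  unfolding val_def expand_mult(1) by (intro fls_subdegree_mult expand_nonzero)

lemma val_one [simp]: "val P 1 = 0"
  unfolding val_def by simp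

lemma val_const [simp]: "val P (fls_const c) = 0"
  unfolding val_def expand_const by (rule fls_const_subdegree)

lemma val_inverse: "P \<in> points \<Longrightarrow> s \<in> S
  \<Longrightarrow> s \<noteq> 0 \<Longrightarrow> val P (inverse s) = - val P s"
  using val_mult[of P s "inverse s"] inverse_in_S[of s] by simp

lemma val_power: "P \<in> points \<Longrightarrow> s \<in> S
  \<Longrightarrow> s \<noteq> 0 \<Longrightarrow> val P (s ^ n) = int n * val P s"
proof (induction n)
  case (Suc n)
  then show ?case using val_mult[of P s "s ^ n"] power_mem[of s n] by (simp add: algebra_simps)
qed simp

lemma val_add:
  assumes "P \<in> points" "s \<in> S" "s' \<in> S" "s + s' \<noteq> 0"
  shows "val P (s + s') \<ge> min (val P s) (val P s')"
  using fls_plus_subdegree[of "expand P s" "expand P s'"]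
    expand_nonzero[OF assms(1) expand_add(2)[OF assms(1-3)] assms(4)]
  unfolding val_def expand_add(1)[OF assms(1-3)] by simp

lemma expand_scale: "P \<in> points \<Longrightarrow> s \<in> S \<Longrightarrow> expand P
  (fls_const c * s) = fls_const c * expand P s"
  using expand_mult(1)[OF _ expand_const(2)] expand_const(1) by simp

lemma val_residue:
  assumes "P \<in> points" "s \<in> S" "s' \<in> S" "s \<noteq> 0" "s' \<noteq> 0" "val P s = val P s'"
  shows "\<exists>c. s - fls_const c * s' = 0 \<or> val P (s - fls_const c * s') > val P s"
proof -
  have cs: "fls_const c * s' \<in> S" for c using expand_const(2) assms(3) by (rule mult_mem)
  have eq: "expand P (s - fls_const c * s') = expand P s - fls_const c * expand P s'" for c
    using expand_diff[OF assms(1,2) cs] expand_scale[OF assms(1,3)] by simp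
  obtain c where "expand P s - fls_const c * expand P s' = 0 \<or>
      fls_subdegree (expand P s - fls_const c * expand P s') > fls_subdegree (expand P s)"
    using fls_residue[OF expand_nonzero[OF assms(1,2,4)] expand_nonzero[OF assms(1,3,5)]] assms(6)
    unfolding val_def by blast
  then show ?thesis
    unfolding val_def eq[symmetric] using expand_nonzero[OF assms(1) diff_mem[OF assms(2) cs]] by blast
qed


section \<open>Places of the function field\<close>

abbreviation K :: "complex fls set" where "K \<equiv> range fls_const"
abbreviation x where "x \<equiv> X None"
abbreviation w where "w \<equiv> W None"

definition ring_at :: "(complex \<times> complex) option \<Rightarrow> complex fls set" where
  "ring_at P = {s \<in> S. s = 0 \<or> val P s \<ge> 0}"

lemma w_sq: "w * w = ev x f"
  by (rule W_sq) simp

lemma num_None: "num None A B = ev x A + ev x B * w"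
  by (simp add: num_def)

lemma val_num: "val P (num None A B) = fls_subdegree (num P A B)"
  unfolding val_def expand_num ..

lemma val_ev: "val P (ev x p) = fls_subdegree (ev (X P) p)"
  unfolding val_def expand_ev(1) ..

lemma val_w: "val P w = fls_subdegree (W P)"
  unfolding val_def expand_w(1) ..

lemma w_S: "w \<in> S" and x_S: "x \<in> S" and ev_S: "ev x p \<in> S" and const_S: "fls_const c \<in> S"
  by (rule expand_w expand_x expand_ev expand_const)+

lemma w_nonzero: "w \<noteq> 0"
  by (rule W_nonzero) simp

lemma ev_nonzero: "p \<noteq> 0 \<Longrightarrow> ev x p \<noteq> 0"
  by (rule den_nonzero)

lemma val_linear: "Some (a, b) \<in> points \<Longrightarrow> val (Some (a, b)) (ev x [:- c, 1:]) =
    (if c = a then if b = 0 then 2 else 1 else 0)"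
  using affine_subdegree(1)[of "[:- c, 1:]" a b] order_power_n_n[of a 1] order_0I[of "[:- c, 1:]" a]
  unfolding val_ev by (cases "c = a") simp_all

lemma uniformizer_exists:
  assumes "P \<in> points"
  shows "\<exists>t\<in>S. t \<noteq> 0 \<and> val P t = 1"
proof (cases P)
  case None
  \<comment> \<open>At infinity \<open>x\<close> has order -2 and \<open>w\<close> has order
    -3.\<close>
  have "val P (x * inverse w) = 1"
    using val_mult[OF assms x_S inverse_mem[OF w_S]] val_inverse[OF assms w_S w_nonzero] w_nonzero
      val_ev[of P "[:0, 1:]"] val_w[of P] X_infinity W_infinity None ev_nonzero[of "[:0, 1:]"] by simp
  moreover have "x * inverse w \<in> S" "x * inverse w \<noteq> 0"
    using x_S w_S w_nonzero ev_nonzero[of "[:0, 1:]"] by auto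
  ultimately show ?thesis by blast
next
  case (Some ab)
  obtain a b where P: "P = Some (a, b)" using Some by (cases ab) auto
  \<comment> \<open>Here \<open>x - a\<close> serves for nonzero \<open>b\<close>, and
    \<open>w\<close> at the ramified points.\<close>
  have "val P (ev x [:- a, 1:]) = 1 \<or> val P w = 1"
    using assms val_linear[of a b a] W_subdegree[of a b] unfolding P val_w by (cases "b = 0") simp_all
  then show ?thesis using ev_S[of "[:- a, 1:]"] ev_nonzero[of "[:- a, 1:]"] w_S w_nonzero
    by (metis pCons_eq_0_iff one_neq_zero)
qed

lemma ring_at_subring: "P \<in> points \<Longrightarrow> subring (ring_at P) (set_ring S)"
proof -
  assume P: "P \<in> points"
  have mult: "s * s' \<in> ring_at P" if "s \<in> ring_at P" "s' \<in> ring_at P" for s s'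
    using that val_mult[OF P, of s s'] mult_mem[of s s'] by (cases "s = 0 \<or> s' = 0")
      (auto simp: ring_at_def)
  have add: "s + s' \<in> ring_at P" if "s \<in> ring_at P" "s' \<in> ring_at P" for s s'
  proof (cases "s = 0 \<or> s' = 0 \<or> s + s' = 0")
    case False
    then show ?thesis using that val_add[OF P, of s s'] add_mem[of s s'] by (auto simp: ring_at_def)
  qed (use that in \<open>auto simp: ring_at_def\<close>)
  have const: "fls_const c \<in> ring_at P" for c using const_S by (simp add: ring_at_def)
  have "- s \<in> ring_at P" if "s \<in> ring_at P" for s
    using mult[OF const[of "- 1"] that] by simp
  then show ?thesis
    using mult add const[of 1] by (auto simp: subring_set_ring_iff ring_at_def)
qed

lemma const_ring_at: "fls_const c \<in> ring_at P"
  using const_S by (simp add: ring_at_def)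

lemma ring_at_place: "P \<in> points \<Longrightarrow> ring_at P \<in> places K (set_ring S)"
proof -
  assume P: "P \<in> points"
  obtain t where t: "t \<in> S" "t \<noteq> 0" "val P t = 1" using uniformizer_exists[OF P] by blast
  have "t \<notin> K" using t(3) by auto
  moreover have "t \<in> ring_at P" using t by (simp add: ring_at_def)
  ultimately have 1: "K \<subset> ring_at P" using const_ring_at by blast
  have "inverse t \<notin> ring_at P" using t val_inverse[OF P t(1,2)] by (simp add: ring_at_def)
  moreover have "inverse t \<in> S" using t(1) by (rule inverse_mem)
  moreover have "ring_at P \<subseteq> S" by (auto simp: ring_at_def)
  ultimately have 2: "ring_at P \<subset> S" by blast
  have "s \<in> ring_at P \<or> inverse s \<in> ring_at P" if "s \<in> S" "s \<noteq> 0" for s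
    using that val_inverse[OF P that] inverse_mem[OF that(1)] by (auto simp: ring_at_def)
  then show ?thesis
    using ring_at_subring[OF P] 1 2 by (auto simp: places_def inv_set_ring)
qed

text \<open>The ring determines the sign of every order, hence the point: infinity is where
  \<open>x\<close> has a pole, \<open>a\<close> is read off from the vanishing of
  \<open>x - a\<close>, and \<open>b\<close> from that of \<open>w\<close> or \<open>w - b\<close>.
  Thus the degree of a divisor on places becomes a sum over points.\<close>

lemma ring_at_inj: "inj_on ring_at points"
proof (rule inj_onI)
  fix P Q assume P: "P \<in> points" and Q: "Q \<in> points" and eq: "ring_at P = ring_at Q"
  have sign: "val P s \<ge> 0 \<longleftrightarrow> val Q s \<ge> 0" if "s \<in> S" "s \<noteq> 0" for s
    using eq that unfolding ring_at_def by blast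
  have pos: "val P s > 0 \<longleftrightarrow> val Q s > 0" if "s \<in> S" "s \<noteq> 0" for s
    using sign[OF that] sign[OF inverse_mem[OF that(1)]] that
      val_inverse[OF P that] val_inverse[OF Q that] by auto
  have x: "val R x \<ge> 0 \<longleftrightarrow> R \<noteq> None" for R
    using val_ev[of R "[:0, 1:]"] X_infinity X_regular(1) by (cases R) auto
  have x0: "x \<noteq> 0" using ev_nonzero[of "[:0, 1:]"] by simp
  show "P = Q"
  proof (cases "P = None \<or> Q = None")
    case True
    then show ?thesis using x[of P] x[of Q] sign[OF x_S x0] by (cases P; cases Q) auto
  next
    case False
    then obtain a b a' b' where P': "P = Some (a, b)" and Q': "Q = Some (a', b')" by auto
    have "a = a'"
      using pos[OF ev_S ev_nonzero, of "[:- a, 1:]"] val_linear[of a b a] val_linear[of a' b' a] P Q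
      unfolding P' Q' by (auto split: if_splits)
    moreover have "b = b'"
    proof (cases "b = 0")
      case True
      then have "val P w > 0" using P W_subdegree[of a b] unfolding P' val_w by simp
      then have "val Q w > 0" using pos[OF w_S w_nonzero] by simp
      then show ?thesis using True Q W_subdegree[of a' b'] unfolding Q' val_w by (auto split: if_splits)
    next
      case False
      have nz: "num None [:- b:] 1 \<noteq> 0" unfolding num_eq_0_iff by simp
      have num: "num R [:- b:] 1 = W R - fls_const b" for R
        by (simp add: num_def ev.one fls_const_uminus)
      have reg: "fls_subdegree (num R [:- b:] 1) \<ge> 0" "fls_nth (num R [:- b:] 1) 0 = d - b"
        if R: "R = Some (c, d)" "R \<in> points" for R c d
      proof -
        have "fls_subdegree (W R) \<ge> 0" using W_subdegree[of c d] R by (simp split: if_splits)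
        then show "fls_subdegree (num R [:- b:] 1) \<ge> 0"
          unfolding num diff_conv_add_uminus fls_const_uminus[symmetric]
          by (intro fls_regular_add) (simp_all add: fls_const_subdegree del: fls_const_uminus)
        show "fls_nth (num R [:- b:] 1) 0 = d - b" unfolding num using W_nth[of c d] R by simp
      qed
      have "expand P (num None [:- b:] 1) \<noteq> 0" by (rule expand_nonzero[OF P num_in_S nz])
      then have nzP: "num P [:- b:] 1 \<noteq> 0" unfolding expand_num .
      have "fls_subdegree (num P [:- b:] 1) \<noteq> 0"
      proof
        assume "fls_subdegree (num P [:- b:] 1) = 0"
        then have "fls_nth (num P [:- b:] 1) 0 \<noteq> 0" using nth_fls_subdegree_nonzero[OF nzP] by simp
        then show False using reg(2)[OF P' P] by simp
      qed
      then have "val P (num None [:- b:] 1) > 0" unfolding val_num using reg(1)[OF P' P] by simp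
      then have "val Q (num None [:- b:] 1) > 0" using pos[OF num_in_S nz] by simp
      then have "fls_nth (num Q [:- b:] 1) 0 = 0" unfolding val_num by (rule fls_eq0_below_subdegree)
      then show ?thesis using reg(2)[OF Q' Q] by simp
    qed
    ultimately show ?thesis using P' Q' by simp
  qed
qed

subsection \<open>Functions regular over a point of the line\<close>

text \<open>The denominator of minimal degree works: a root of it over which the function is regular
  would cancel.\<close>

lemma minimal_representation:
  assumes "s \<in> S" "s \<noteq> 0"
  obtains A B C where "C \<noteq> 0" "s = num None A B / ev x C"
    "\<And>a. (\<And>b. Some (a, b) \<in> points \<Longrightarrow> val (Some
      (a, b)) s \<ge> 0) \<Longrightarrow> poly C a \<noteq> 0"
proof -
  let ?rep = "\<lambda>A B C. C \<noteq> 0 \<and> s = num None A B / ev x C"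
  have "\<exists>n A B C. ?rep A B C \<and> degree C = n" using S_cases[OF assms(1)] by metis
  then obtain A B C where C: "C \<noteq> 0" and s: "s = num None A B / ev x C"
    and min: "\<And>A' B' C'. ?rep A' B' C' \<Longrightarrow> degree C \<le> degree C'"
    using exists_least_iff[of "\<lambda>n. \<exists>A B C. ?rep A B C \<and> degree C = n"] by (metis not_le)
  have "poly C a \<noteq> 0" if reg: "\<And>b. Some (a, b) \<in> points \<Longrightarrow> val (Some
    (a, b)) s \<ge> 0" for a
  proof
    assume Ca: "poly C a = 0"
    have num_pos: "fls_subdegree (num P A B) \<ge> fls_subdegree (ev (X P) C)"
      if P: "P = Some (a, b)" "P \<in> points" for P b
    proof -
      have "num P A B / ev (X P) C \<noteq> 0"
        using expand_nonzero[OF P(2) assms] unfolding s expand_eq[OF C] .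
      then have "num P A B \<noteq> 0" by auto
      have "val P s = fls_subdegree (num P A B) - fls_subdegree (ev (X P) C)"
        unfolding val_def s expand_eq[OF C]
        by (rule fls_divide_subdegree[OF \<open>num P A B \<noteq> 0\<close> den_nonzero[OF C]])
      then show ?thesis using reg[of b] P by simp
    qed
    have "Polynomial.order a C \<noteq> 0" using Ca C by (simp add: order_root)
    have "poly A a = 0 \<and> poly B a = 0"
    proof (cases "poly f a = 0")
      case True
      \<comment> \<open>At a ramified point \<open>x - a\<close> has order two, so \<open>C\<close>
        and with it the numerator have order at least two. The two parts of the numerator cannot
        cancel, and \<open>w\<close> contributes only one order, so both \<open>A\<close> and
        \<open>B\<close> vanish at \<open>a\<close>.\<close>
      let ?P = "Some (a, 0 :: complex)"
      have P: "?P \<in> points" using True by (simp add: points_def)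
      have "fls_subdegree (ev (X ?P) C) \<ge> 2"
        using affine_subdegree(1)[OF C, of a 0] \<open>Polynomial.order a C \<noteq> 0\<close> by simp
      then have ge: "fls_subdegree (num ?P A B) \<ge> 2" using num_pos[OF refl P] by linarith
      have W: "fls_subdegree (W ?P) = 1" using W_subdegree[OF P] by simp
      have "poly A a = 0"
      proof (cases "A = 0")
        case False
        then have "fls_subdegree (ev (X ?P) A) \<ge> 2"
          using num_ramified(2)[of ?P A B] P ge by auto
        then show ?thesis using affine_subdegree(1)[OF False, of a 0] False by (simp add: order_root)
      qed simp
      moreover have "poly B a = 0"
      proof (cases "B = 0")
        case False
        then have "fls_subdegree (ev (X ?P) B) \<ge> 1"
          using num_ramified(3)[of ?P A B] P ge W by auto
        then show ?thesis using affine_subdegree(1)[OF False, of a 0] False by (simp add: order_root)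
      qed simp
      ultimately show ?thesis ..
    next
      case False
      \<comment> \<open>Now there are two points over \<open>a\<close>; the numerator vanishes at
        both, which gives \<open>A(a) + B(a) b = 0\<close> for both signs of
        \<open>b\<close>.\<close>
      let ?b = "csqrt (poly f a)"
      have b: "?b \<noteq> 0" using False by simp
      have val0: "poly A a + poly B a * b = 0" if b: "b ^ 2 = poly f a" for b
      proof -
        let ?P = "Some (a, b)"
        have P: "?P \<in> points" using b by (simp add: points_def)
        have b0: "b \<noteq> 0" using b False by auto
        have "fls_subdegree (ev (X ?P) C) > 0"
          using affine_subdegree(1)[OF C, of a b] b0 \<open>Polynomial.order a C \<noteq> 0\<close> by simp
        then have "fls_subdegree (num ?P A B) > 0" using num_pos[OF refl P] by linarith
        then have "fls_nth (num ?P A B) 0 = 0" by (rule fls_eq0_below_subdegree)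
        moreover have reg_W: "fls_subdegree (W ?P) \<ge> 0" using W_subdegree[OF P] by simp
        have "fls_nth (num ?P A B) 0 = poly A a + poly B a * b"
          unfolding num_def fls_plus_nth fls_regular_mult[OF ev_regular(1)[OF X_regular(1)] reg_W]
            ev_regular(2)[OF X_regular(1)] X_regular(2) W_nth[OF P] ..
        ultimately show ?thesis by simp
      qed
      have "poly A a + poly B a * ?b = 0" "poly A a + poly B a * - ?b = 0"
        by (rule val0; simp)+
      then have "poly B a * ?b + poly B a * ?b = 0" "poly A a = - (poly B a * ?b)"
        by (simp_all add: eq_neg_iff_add_eq_0)
      then show ?thesis using b by simp
    qed
    then obtain A' B' C' where *: "A = A' * [:- a, 1:]" "B = B' * [:- a, 1:]" "C = C' * [:- a, 1:]"
      using Ca unfolding poly_eq_0_iff_dvd dvd_def by (metis mult.commute)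
    have C': "C' \<noteq> 0" using C *(3) by auto
    have "s = num None A' B' / ev x C'"
      unfolding s * num_scale[symmetric] ev.mult
      by (rule nonzero_mult_divide_mult_cancel_right[OF ev_nonzero]) simp
    then have "degree C \<le> degree C'" using min C' by blast
    moreover have "degree C = degree C' + 1" unfolding *(3) using C' by (subst degree_mult_eq) auto
    ultimately show False by simp
  qed
  then show ?thesis using that[OF C s] by blast
qed

text \<open>At infinity \<open>A\<close> contributes a pole of order \<open>2 deg A\<close> and
  \<open>B w\<close> one of order \<open>2 deg B + 3\<close>, and poles of different parity cannot
  cancel.\<close>

lemma num_degree:
  assumes "fls_subdegree (num None A B) \<ge> - int n"
  shows "A \<noteq> 0 \<Longrightarrow> 2 * degree A \<le> n" "B \<noteq> 0
    \<Longrightarrow> 2 * degree B + 3 \<le> n"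
  using assms num_ramified(2,3)[of None A B] infinity_subdegree(1)[of A] infinity_subdegree(1)[of B]
    W_infinity by auto


subsection \<open>Classification of places\<close>

context
  fixes V assumes V: "V \<in> places K (set_ring S)"
begin

lemma V_subring: "V \<subseteq> S" "1 \<in> V" "s \<in> V \<Longrightarrow>
  - s \<in> V" "s \<in> V \<Longrightarrow> s' \<in> V \<Longrightarrow> s * s' \<in> V"
    "s \<in> V \<Longrightarrow> s' \<in> V \<Longrightarrow> s + s' \<in> V"
  using V by (auto simp: places_def subring_set_ring_iff)

lemma V_const: "fls_const c \<in> V"
  using V unfolding places_def by blast

lemma V_proper: "V \<noteq> S"
  using V by (auto simp: places_def)

lemma V_valuation: "s \<in> S \<Longrightarrow> s \<notin> V \<Longrightarrow> inverse s \<in> V"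
  using V V_const[of 0] by (cases "s = 0") (auto simp: places_def inv_set_ring)

lemma V_diff: "s \<in> V \<Longrightarrow> s' \<in> V \<Longrightarrow> s - s' \<in> V"
  using V_subring(3,5)[of s' ] V_subring(5)[of s "- s'"] by simp

lemma V_power: "s \<in> V \<Longrightarrow> s ^ n \<in> V"
  by (induction n) (auto simp: V_subring)

lemma V_ev: "s \<in> V \<Longrightarrow> ev s p \<in> V"
  by (induction p) (auto simp: ev_pCons V_const[of 0, simplified] intro!: V_subring V_const)

text \<open>Valuation rings are integrally closed; for square roots this is the remark that
  otherwise \<open>1 / s\<close> is in \<open>V\<close>, and so is its product \<open>s\<close> with
  \<open>s * s\<close>.\<close>

lemma V_integral: "s \<in> S \<Longrightarrow> s * s \<in> V \<Longrightarrow> s \<in> V"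
proof (rule ccontr)
  assume s: "s \<in> S" "s * s \<in> V" "s \<notin> V"
  then have "s \<noteq> 0" using V_const[of 0] by auto
  then have eq: "s * s * inverse s = s" by (simp add: mult.assoc)
  show False using V_subring(4)[OF s(2) V_valuation[OF s(1,3)]] s(3) unfolding eq by blast
qed

text \<open>The maximal ideal of \<open>V\<close>. Zero is listed separately because
  \<open>inverse 0 = 0\<close> belongs to \<open>V\<close>.\<close>

definition M where "M = {s \<in> V. s = 0 \<or> inverse s \<notin> V}"

lemma M_mult: "r \<in> V \<Longrightarrow> s \<in> M \<Longrightarrow> r * s \<in> M"
proof -
  assume r: "r \<in> V" and s: "s \<in> M"
  have "inverse (r * s) \<notin> V" if "r * s \<noteq> 0"
  proof
    assume "inverse (r * s) \<in> V"
    then have "r * inverse (r * s) \<in> V" using r by (intro V_subring(4))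
    moreover have "r * inverse (r * s) = inverse s" using that by simp
    ultimately have "inverse s \<in> V" by (simp only:)
    then show False using s that by (auto simp: M_def)
  qed
  then show ?thesis using r s V_subring(4)[of r s] by (auto simp: M_def)
qed

text \<open>Since \<open>r + s = s (r / s + 1)\<close>, the element \<open>s\<close> would be a unit
  along with the sum. One of \<open>r / s\<close> and \<open>s / r\<close> always lies in
  \<open>V\<close>, so \<open>M_add\<close> follows by symmetry.\<close>

lemma M_add_aux:
  assumes "r \<in> M" "s \<in> M" "s \<noteq> 0" "r + s \<noteq> 0" "r * inverse s \<in> V"
  shows "inverse (r + s) \<notin> V"
proof
  assume i: "inverse (r + s) \<in> V"
  have eq: "r * inverse s + 1 = inverse s * (r + s)"
    using right_inverse[OF assms(3)] by (simp only: distrib_left mult.commute[of "inverse s"])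
  have "(r * inverse s + 1) * inverse (r + s) \<in> V"
    by (intro V_subring(4,5) assms(5) i V_subring(2))
  then have "inverse s \<in> V"
    unfolding eq mult.assoc right_inverse[OF assms(4)] mult_1_right .
  then show False using assms(2,3) unfolding M_def by blast
qed

lemma M_add: "r \<in> M \<Longrightarrow> s \<in> M \<Longrightarrow> r + s \<in> M"
proof (cases "r = 0 \<or> s = 0 \<or> r + s = 0")
  case True
  assume "r \<in> M" "s \<in> M"
  then show ?thesis using True V_const[of 0] by (auto simp: M_def)
next
  case False
  assume rs: "r \<in> M" "s \<in> M"
  then have "r * inverse s \<in> S" "r \<in> V" "s \<in> V" using V_subring(1) by (auto simp: M_def)
  moreover have "inverse (r * inverse s) = s * inverse r" by simp
  ultimately have "r * inverse s \<in> V \<or> s * inverse r \<in> V" using V_valuation by metis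
  then have "inverse (r + s) \<notin> V"
    using M_add_aux[OF rs] M_add_aux[OF rs(2,1)] False by (auto simp: add.commute)
  then show ?thesis using V_subring(5)[OF \<open>r \<in> V\<close> \<open>s \<in> V\<close>] by
    (simp add: M_def)
qed

lemma M_const: "fls_const c \<in> M \<longleftrightarrow> c = 0"
  using V_const[of "inverse c"] V_const[of c] by (auto simp: M_def fls_inverse_const)

lemma M_uminus: "s \<in> M \<Longrightarrow> - s \<in> M"
  using M_mult[OF V_const[of "- 1"]] by simp

lemma unit_mod_M:
  assumes "s - fls_const c \<in> M" "c \<noteq> 0" "s \<in> V"
  shows "inverse s \<in> V" "s \<noteq> 0"
proof -
  have "s \<notin> M"
  proof
    assume "s \<in> M"
    from M_add[OF this M_uminus[OF assms(1)]] have "fls_const c \<in> M" by simp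
    then show False using assms(2) M_const by simp
  qed
  then show "inverse s \<in> V" "s \<noteq> 0" using assms(3) by (auto simp: M_def)
qed

text \<open>The linear factor with root \<open>a\<close> divides \<open>p - p(a)\<close>, and it
  evaluates to \<open>s - a\<close>, which lies in \<open>M\<close>.\<close>

lemma ev_mod_M:
  assumes "s \<in> V" "s - fls_const a \<in> M"
  shows "ev s p - fls_const (poly p a) \<in> M"
proof -
  obtain q where q: "p - [:poly p a:] = [:- a, 1:] * q"
    using poly_eq_0_iff_dvd[of "p - [:poly p a:]" a] by (auto elim: dvdE)
  have "ev s p - fls_const (poly p a) = ev s [:- a, 1:] * ev s q"
    by (simp only: ev.diff[symmetric] ev_const[of s "poly p a", symmetric] q ev.mult)
  also have "ev s [:- a, 1:] = s - fls_const a" by (simp add: fls_const_uminus)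
  finally show ?thesis
    using M_mult[OF V_ev[OF assms(1), of q] assms(2)] by (simp only: mult.commute)
qed

lemma ev_unit:
  assumes "s \<in> V" "s - fls_const a \<in> M" "poly p a \<noteq> 0"
  shows "inverse (ev s p) \<in> V"
  using unit_mod_M(1)[OF ev_mod_M[OF assms(1,2)] assms(3) V_ev[OF assms(1)]] .

lemma quotient_V:
  assumes "x \<in> V" "w \<in> V" "inverse (ev x C) \<in> V"
  shows "num None A B / ev x C \<in> V"
  unfolding num_None divide_inverse using assms V_ev by (intro V_subring) auto

text \<open>If \<open>x\<close> had no residue in C, all \<open>x - a\<close> would be units, hence
  all nonzero polynomials in \<open>x\<close>, and \<open>V\<close> would be the whole field. The
  residue of \<open>w\<close> is then one of the square roots of \<open>f(a)\<close>.\<close>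

lemma affine_center:
  assumes "x \<in> V"
  shows "\<exists>a b. b ^ 2 = poly f a \<and> x - fls_const a \<in> M \<and> w
    - fls_const b \<in> M \<and> w \<in> V"
proof -
  have w: "w \<in> V" by (rule V_integral[OF w_S]) (use w_sq V_ev[OF assms] in simp)
  have "\<exists>a. x - fls_const a \<in> M"
  proof (rule ccontr)
    assume no: "\<not> ?thesis"
    have lin: "inverse (ev x [:- a, 1:]) \<in> V" for a
      using no V_diff[OF assms V_const[of a]] by (auto simp: M_def fls_const_uminus)
    have inv: "inverse (ev x C) \<in> V" if "C \<noteq> 0" for C
      using that
    proof (induction "degree C" arbitrary: C)
      case 0
      then obtain c where "C = [:c:]" by (metis degree_eq_zeroE)
      then show ?case using V_const[of "inverse c"] by (simp add: fls_inverse_const)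
    next
      case (Suc n)
      then have "\<not> constant (poly C)" by (simp add: constant_degree)
      then obtain a where "poly C a = 0" using fundamental_theorem_of_algebra by blast
      then obtain C' where C': "C = [:- a, 1:] * C'" by (auto simp: poly_eq_0_iff_dvd elim: dvdE)
      have "C' \<noteq> 0" using Suc(3) C' by auto
      moreover have "degree C = degree [:- a, 1:] + degree C'"
        unfolding C' by (rule degree_mult_eq) (use \<open>C' \<noteq> 0\<close> in simp_all)
      then have "n = degree C'" using Suc(2) by simp
      ultimately have "inverse (ev x C') \<in> V" using Suc(1) by blast
      then show ?case unfolding C' ev.mult inverse_mult_distrib using lin by (intro V_subring(4))
    qed
    have "S \<subseteq> V"
    proof
      fix s assume "s \<in> S"
      then obtain A B C where "C \<noteq> 0" "s = num None A B / ev x C" by (rule S_cases)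
      then show "s \<in> V" using quotient_V[OF assms w inv] by simp
    qed
    then show False using V_proper V_subring(1) by blast
  qed
  then obtain a where a: "x - fls_const a \<in> M" by blast
  let ?b = "csqrt (poly f a)"
  \<comment> \<open>The product equals \<open>f(x) - f(a)\<close>, which lies in \<open>M\<close>
    because \<open>x\<close> has residue \<open>a\<close>.\<close>
  have prod: "(w - fls_const ?b) * (w - fls_const (- ?b)) \<in> M"
  proof -
    have "(w - fls_const ?b) * (w - fls_const (- ?b)) = w * w - fls_const (?b * ?b)"
      by (simp add: algebra_simps fls_const_mult_const[symmetric] del: fls_const_mult_const)
    also have "?b * ?b = poly f a" using power2_csqrt[of "poly f a"] by (simp only: power2_eq_square)
    finally show ?thesis using ev_mod_M[OF assms a, of f] unfolding w_sq by simp
  qed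
  have "w - fls_const ?b \<in> M \<or> w - fls_const (- ?b) \<in> M"
  proof (rule ccontr)
    assume "\<not> ?thesis"
    then have n: "w - fls_const ?b \<notin> M" "w - fls_const (- ?b) \<notin> M" by blast+
    have V': "w - fls_const ?b \<in> V" "w - fls_const (- ?b) \<in> V" by (intro V_diff w V_const)+
    then have nz: "w - fls_const ?b \<noteq> 0" "w - fls_const (- ?b) \<noteq> 0"
      and i: "inverse (w - fls_const ?b) \<in> V" "inverse (w - fls_const (- ?b)) \<in> V"
      using n unfolding M_def by blast+
    have "inverse ((w - fls_const ?b) * (w - fls_const (- ?b))) \<in> V"
      unfolding inverse_mult_distrib by (rule V_subring(4)[OF i])
    moreover have "(w - fls_const ?b) * (w - fls_const (- ?b)) \<noteq> 0" using nz by (metis mult_eq_0_iff)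
    ultimately show False using prod unfolding M_def by blast
  qed
  moreover have "?b ^ 2 = poly f a" "(- ?b) ^ 2 = poly f a" by simp_all
  ultimately show ?thesis using a w by blast
qed

text \<open>A function regular at all points over \<open>a\<close> has a denominator that does not
  vanish at \<open>a\<close> and is a unit of \<open>V\<close>. If regularity is known at
  \<open>(a, b)\<close> only, a power of \<open>w + b\<close> removes the pole at the conjugate
  point; its residue in \<open>V\<close> is a power of \<open>2 * b\<close>, so it can be divided
  out again.\<close>

lemma affine_ring_at:
  assumes x: "x \<in> V" and w: "w \<in> V" and a: "x - fls_const a \<in> M" and b: "w - fls_const b \<in> M"
    and P: "b ^ 2 = poly f a" and s: "s \<in> S" "s \<noteq> 0" "val (Some (a, b)) s \<ge> 0"
  shows "s \<in> V"
proof -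
  have over: "s' \<in> V" if s': "s' \<in> S" "s' \<noteq> 0" "val (Some (a, b)) s' \<ge> 0" "val (Some
    (a, - b)) s' \<ge> 0" for s'
  proof -
    obtain A B C where C: "C \<noteq> 0" "s' = num None A B / ev x C"
      and reg: "\<And>c. (\<And>d. Some (c, d) \<in> points \<Longrightarrow> val (Some
        (c, d)) s' \<ge> 0) \<Longrightarrow> poly C c \<noteq> 0"
      by (rule minimal_representation[OF s'(1,2)]) blast
    have "poly C a \<noteq> 0"
    proof (rule reg)
      fix d assume "Some (a, d) \<in> points"
      then have "d ^ 2 = b ^ 2" using P by (simp add: points_def)
      then have "d = b \<or> d = - b" by (simp add: power2_eq_iff)
      then show "val (Some (a, d)) s' \<ge> 0" using s' by blast
    qed
    then show ?thesis unfolding C(2) by (intro quotient_V x w ev_unit[OF x a])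
  qed
  show ?thesis
  proof (cases "b = 0")
    case True
    then show ?thesis using over[OF s(1,2)] s(3) by simp
  next
    case False
    let ?P = "Some (a, b)" and ?Q = "Some (a, - b)"
    have points: "?P \<in> points" "?Q \<in> points" using P by (simp_all add: points_def)
    let ?h = "num None [:b:] 1"
    have h: "?h = w + fls_const b" by (simp add: num_def ev.one)
    have h0: "?h \<noteq> 0" unfolding num_eq_0_iff by simp
    have num: "num R [:b:] 1 = fls_const b + W R" for R by (simp add: num_def ev.one)
    have W: "fls_subdegree (W ?P) \<ge> 0" "fls_subdegree (W ?Q) \<ge> 0"
      using W_subdegree[OF points(1)] W_subdegree[OF points(2)] by simp_all
    have reg: "fls_subdegree (num ?P [:b:] 1) \<ge> 0" "fls_subdegree (num ?Q [:b:] 1) \<ge> 0"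
      unfolding num by (intro fls_regular_add W; simp add: fls_const_subdegree)+
    have "fls_nth (num ?P [:b:] 1) 0 = 2 * b" unfolding num using W_nth[OF points(1)] by simp
    then have "fls_nth (num ?P [:b:] 1) 0 \<noteq> 0" using False by simp
    from fls_subdegree_leI[OF this] have hP: "val ?P ?h = 0" unfolding val_num using reg(1) by simp
    have "num ?Q [:b:] 1 \<noteq> 0" using expand_nonzero[OF points(2) num_in_S h0] unfolding expand_num .
    moreover have "fls_nth (num ?Q [:b:] 1) 0 = 0" unfolding num using W_nth[OF points(2)] by simp
    ultimately have "fls_subdegree (num ?Q [:b:] 1) \<noteq> 0" using nth_fls_subdegree_nonzero by metis
    then have hQ: "val ?Q ?h \<ge> 1" unfolding val_num using reg(2) by simp
    \<comment> \<open>The pole order of \<open>s\<close> at the conjugate point, zero if there is no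
      pole.\<close>
    define k where "k = nat (- val ?Q s)"
    have hk: "?h ^ k \<in> S" "?h ^ k \<noteq> 0" using h0 num_in_S by auto
    have "val ?P (s * ?h ^ k) = val ?P s"
      using val_mult[OF points(1) s(1) hk(1) s(2) hk(2)] val_power[OF points(1) num_in_S h0] hP by simp
    moreover have "val ?Q (s * ?h ^ k) \<ge> 0"
    proof -
      have "int k * 1 \<le> int k * val ?Q ?h" using hQ by (intro mult_left_mono) auto
      then show ?thesis
        using val_mult[OF points(2) s(1) hk(1) s(2) hk(2)] val_power[OF points(2) num_in_S h0, of k]
        by (simp add: k_def split: if_splits)
    qed
    ultimately have "s * ?h ^ k \<in> V" using over[of "s * ?h ^ k"] s hk by auto
    moreover have "inverse ?h \<in> V"
    proof (rule unit_mod_M(1))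
      have "?h - fls_const (2 * b) = w - fls_const b"
        unfolding h mult_2 fls_plus_const[symmetric] by (rule add_diff_cancel_right)
      then show "?h - fls_const (2 * b) \<in> M" using b by simp
      show "?h \<in> V" unfolding h using w V_const by (rule V_subring(5))
    qed (use False in simp)
    ultimately have "s * ?h ^ k * inverse ?h ^ k \<in> V" by (rule V_subring(4)[OF _ V_power])
    moreover have "s * ?h ^ k * inverse ?h ^ k = s"
      by (simp only: power_inverse mult.assoc right_inverse[OF hk(2)] mult_1_right)
    ultimately show ?thesis by simp
  qed
qed

text \<open>The coefficients of \<open>p\<close>, padded to degree \<open>n\<close>, are reversed.
  The value at zero decides whether the result is a unit where \<open>1 / x\<close>
  vanishes.\<close>

lemma ev_inverse:
  assumes "degree p \<le> n"
  shows "\<exists>q. ev x p = x ^ n * ev (inverse x) q \<and> poly q 0 = poly.coeff p n"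
  using assms
proof (induction n arbitrary: p)
  case 0
  then obtain c where "p = [:c:]" by (metis degree_eq_zeroE le_zero_eq)
  then show ?case by (intro exI[of _ "[:c:]"]) simp
next
  case (Suc n)
  obtain c p' where p: "p = pCons c p'" by (cases p)
  then have "degree p' \<le> n" using Suc(2) by (simp split: if_splits)
  then obtain q where q: "ev x p' = x ^ n * ev (inverse x) q" "poly q 0 = poly.coeff p' n" using Suc(1) by blast
  have x0: "x \<noteq> 0" using ev_nonzero[of "[:0, 1:]"] by simp
  have "ev (inverse x) ([:c:] * [:0, 1:] ^ Suc n + q) = fls_const c * inverse x ^ Suc n + ev (inverse x) q"
    unfolding ev.add ev.mult ev.power by simp
  moreover have "x ^ Suc n * (fls_const c * inverse x ^ Suc n) = fls_const c"
    using x0 unfolding power_inverse by (simp del: power_Suc add: mult.left_commute)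
  ultimately have "ev x p = x ^ Suc n * ev (inverse x) ([:c:] * [:0, 1:] ^ Suc n + q)"
    unfolding p ev_pCons q(1) by (simp add: distrib_left mult.assoc)
  moreover have "poly ([:c:] * [:0, 1:] ^ Suc n + q) 0 = poly.coeff p (Suc n)" using q(2) p by simp
  ultimately show ?case by blast
qed

text \<open>Near infinity \<open>1 / x\<close> and \<open>w / x^2\<close> are suitable coordinates:
  the square of the second is \<open>1 / x\<close> times a polynomial in \<open>1 / x\<close>, so it
  lies in \<open>V\<close>. Divided by \<open>x ^ degree C\<close>, numerator and denominator become
  polynomials in them, and the denominator has a nonzero residue.\<close>

lemma infinity_ring_at:
  assumes x: "x \<notin> V" and s: "s \<in> S" "s \<noteq> 0" "val None s \<ge> 0"
  shows "s \<in> V"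
proof -
  let ?y = "inverse x"
  have x0: "x \<noteq> 0" using ev_nonzero[of "[:0, 1:]"] by simp
  have y: "?y \<in> V" using V_valuation[OF x_S x] .
  then have yM: "?y - fls_const 0 \<in> M" using x by (simp add: M_def)
  obtain A B C where C: "C \<noteq> 0" "s = num None A B / ev x C" using s(1) by (rule S_cases)
  let ?n = "degree C"
  have num0: "num None A B \<noteq> 0" using s(2) C(2) by auto
  have "val None s = fls_subdegree (num None A B) - fls_subdegree (ev x C)"
    unfolding val_def C(2) expand_eq[OF C(1)] by (rule fls_divide_subdegree[OF num0 ev_nonzero[OF C(1)]])
  then have "fls_subdegree (num None A B) \<ge> - int (2 * ?n)"
    using s(3) infinity_subdegree(1)[OF C(1)] by simp
  note deg = num_degree[OF this]
  obtain qC where qC: "ev x C = x ^ ?n * ev ?y qC" "poly qC 0 = lead_coeff C"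
    using ev_inverse[of C ?n] by blast
  have iC: "inverse (ev ?y qC) \<in> V" using ev_unit[OF y yM, of qC] qC(2) C(1) by simp
  obtain qf where qf: "ev x f = x ^ 3 * ev ?y qf" using ev_inverse[of f 3] degree_f by auto
  have "degree A \<le> ?n" using deg(1) by (cases "A = 0") auto
  then obtain qA where qA: "ev x A = x ^ ?n * ev ?y qA" using ev_inverse by blast
  let ?v = "w * ?y ^ 2"
  have "?v * ?v = (w * w) * ?y ^ 4" by (simp add: power2_eq_square power4_eq_xxxx)
  also have "\<dots> = ev ?y qf * ?y * (x ^ 3 * ?y ^ 3)" unfolding w_sq qf by
    (simp add: power4_eq_xxxx power3_eq_cube)
  also have "x ^ 3 * ?y ^ 3 = 1" using x0 by (simp add: power_inverse)
  finally have vv: "?v * ?v = ev ?y qf * ?y" by simp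
  have "?v \<in> S" using w_S x_S by auto
  then have v: "?v \<in> V" by (rule V_integral) (unfold vv, intro V_subring(4) V_ev y)
  have "\<exists>qB. ev x B * w = x ^ ?n * (ev ?y qB * ?v)"
  proof (cases "B = 0")
    case True
    then show ?thesis by (intro exI[of _ 0]) (simp add: ev.zero)
  next
    case False
    \<comment> \<open>Regularity gives \<open>2 * degree B + 3 \<le> 2 * degree C\<close>, and by
      parity one more degree is gained, enough to turn \<open>w\<close> into
      \<open>w / x^2\<close>.\<close>
    then have n: "degree B \<le> ?n - 2" "?n = (?n - 2) + 2" using deg(2) by auto
    obtain qB where qB: "ev x B = x ^ (?n - 2) * ev ?y qB" using ev_inverse[OF n(1)] by blast
    have "x ^ ?n = x ^ (?n - 2) * x ^ 2" using n(2) power_add[of x "?n - 2" 2] by simp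
    moreover have "x ^ 2 * ?y ^ 2 = 1" using x0 by (simp add: power_inverse)
    moreover have "x ^ (?n - 2) * x ^ 2 * (ev ?y qB * ?v) = (x ^ (?n - 2) * ev ?y qB * w) * (x ^ 2 * ?y ^ 2)"
      by (simp only: ac_simps)
    ultimately show ?thesis unfolding qB by (intro exI[of _ qB]) simp
  qed
  then obtain qB where qB: "ev x B * w = x ^ ?n * (ev ?y qB * ?v)" by blast
  have "s = (x ^ ?n * (ev ?y qA + ev ?y qB * ?v)) / (x ^ ?n * ev ?y qC)"
    unfolding C(2) num_None qA qB qC(1) distrib_left ..
  also have "\<dots> = (ev ?y qA + ev ?y qB * ?v) / ev ?y qC"
    using x0 by (intro mult_divide_mult_cancel_left) simp
  finally show ?thesis
    unfolding divide_inverse using y v iC V_ev by (auto intro!: V_subring)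
qed

text \<open>The ring at the center is contained in \<open>V\<close>, and it is maximal because its
  value group is the integers: if an element of \<open>V\<close> had a pole at \<open>P\<close>, its
  powers would absorb the pole of any function, and \<open>V\<close> would be the whole
  field.\<close>

lemma place_eq_ring_at:
  obtains P where "P \<in> points" "V = ring_at P"
proof -
  have "\<exists>P\<in>points. \<forall>s\<in>S. s \<noteq> 0 \<longrightarrow> val P s \<ge> 0
    \<longrightarrow> s \<in> V"
  proof (cases "x \<in> V")
    case True
    obtain a b where ab: "b ^ 2 = poly f a" "x - fls_const a \<in> M" "w - fls_const b \<in> M" "w \<in> V"
      using affine_center[OF True] by blast
    then have "Some (a, b) \<in> points" by (simp add: points_def)
    then show ?thesis using affine_ring_at[OF True ab(4,2,3,1)] by blast
  next
    case False
    then show ?thesis using infinity_ring_at None_point by blast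
  qed
  then obtain P where P: "P \<in> points" and sub: "\<And>s. s \<in> S
    \<Longrightarrow> s \<noteq> 0 \<Longrightarrow> val P s \<ge> 0 \<Longrightarrow> s \<in> V"
    by blast
  have "s \<in> ring_at P" if s: "s \<in> V" for s
  proof (rule ccontr)
    assume no: "s \<notin> ring_at P"
    have sS: "s \<in> S" using s V_subring(1) by blast
    then have s0: "s \<noteq> 0" and neg: "val P s < 0" using no by (auto simp: ring_at_def)
    have "r \<in> V" if r: "r \<in> S" for r
    proof (cases "r = 0")
      case False
      define n where "n = nat (- val P r)"
      have sn: "s ^ n \<in> S" "s ^ n \<noteq> 0" using sS s0 by auto
      have "val P (inverse (s ^ n) * r) = - (int n * val P s) + val P r"
        using val_mult[OF P inverse_mem[OF sn(1)] r] val_inverse[OF P sn] val_power[OF P sS s0, of n] sn False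
        by simp
      moreover have "int n * val P s \<le> int n * (- 1)" using neg by (intro mult_left_mono) auto
      ultimately have "val P (inverse (s ^ n) * r) \<ge> 0" by (simp add: n_def split: if_splits)
      then have "inverse (s ^ n) * r \<in> V" using sub[of "inverse (s ^ n) * r"] sn r False by auto
      then have "s ^ n * (inverse (s ^ n) * r) \<in> V" by (rule V_subring(4)[OF V_power[OF s]])
      then show ?thesis using sn(2) by (simp add: mult.assoc[symmetric])
    qed (use V_const[of 0] in simp)
    then show False using V_proper V_subring(1) by blast
  qed
  moreover have "ring_at P \<subseteq> V" using sub V_const[of 0] by (auto simp: ring_at_def)
  ultimately show ?thesis using that[OF P] by blast
qed

end

lemma places_eq: "places K (set_ring S) = ring_at ` points"
proof (intro subset_antisym subsetI)
  fix V assume "V \<in> places K (set_ring S)"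
  then show "V \<in> ring_at ` points" by (rule place_eq_ring_at) blast
qed (use ring_at_place in blast)


section \<open>The genus is one\<close>

sublocale VF: valued_field S K points val
proof (intro valued_field.intro set_field_axioms valued_field_axioms.intro)
  show "K \<subseteq> S" using const_S by blast
  show "val P (r + s) \<ge> min (val P r) (val P s)"
    if "P \<in> points" "r \<in> S" "s \<in> S" "r \<noteq> 0" "s \<noteq> 0" "r + s \<noteq> 0" for P r s
    using val_add that by blast
  show "val P (k * r) = val P r"
    if k: "P \<in> points" "k \<in> K" "r \<in> S" "k \<noteq> 0" "r \<noteq> 0" for P k r
  proof -
    obtain c where "k = fls_const c" using k(2) by blast
    then show ?thesis using val_mult[OF k(1) const_S k(3) _ k(5), of c] k(4) by simp
  qed
  show "\<exists>k\<in>K. r - k * s = 0 \<or> val P (r - k * s) > val P r"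
    if "P \<in> points" "r \<in> S" "s \<in> S" "r \<noteq> 0" "s \<noteq> 0" "val P r = val P s" for P r s
    using val_residue[OF that] by blast
qed (rule set_field_constants)

lemma place_ord_val:
  assumes "P \<in> points" "s \<in> S" "s \<noteq> 0"
  shows "place_ord (set_ring S) (ring_at P) s = val P s"
proof -
  obtain t where "t \<in> S" "t \<noteq> 0" "val P t = 1" using uniformizer_exists[OF assms(1)] by blast
  then show ?thesis
    using assms by (intro place_ord_eqI[OF ring_at_def val_mult]) auto
qed

lemma riemann_roch_eq: "riemann_roch_space K (set_ring S) D = VF.L (\<lambda>P. D (ring_at P))"
proof -
  have "s \<in> riemann_roch_space K (set_ring S) D \<longleftrightarrow> s \<in> VF.L (\<lambda>P. D
    (ring_at P))" for s
    unfolding riemann_roch_space_def VF.L_def places_eq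
    using place_ord_val[of _ s] by (cases "s = 0") auto
  then show ?thesis by blast
qed

text \<open>Without affine poles the minimal denominator has no root and is constant. A pole of
  order at most one then forces \<open>2 * degree A \<le> 1\<close> and excludes \<open>B\<close>.
  This missing pole order is the source of the genus.\<close>

lemma L_infinity: "VF.L (\<lambda>P. if P = None then 1 else 0) = K"
proof (intro subset_antisym subsetI)
  fix s assume s: "s \<in> VF.L (\<lambda>P. if P = None then 1 else 0)"
  show "s \<in> K"
  proof (cases "s = 0")
    case True
    then show ?thesis by (intro range_eqI[of _ _ 0]) simp
  next
    case False
    have sS: "s \<in> S" and val: "\<And>P. P \<in> points \<Longrightarrow> val P s \<ge> - (if P
      = None then 1 else 0)"
      using s False unfolding VF.L_def by blast+
    obtain A B C where C: "C \<noteq> 0" "s = num None A B / ev x C"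
      and roots: "\<And>a. (\<And>b. Some (a, b) \<in> points \<Longrightarrow> val (Some
        (a, b)) s \<ge> 0) \<Longrightarrow> poly C a \<noteq> 0"
      by (rule minimal_representation[OF sS False]) blast
    have "poly C a \<noteq> 0" for a
      using roots[of a] val[of "Some (a, _)"] by simp
    then have "constant (poly C)" using fundamental_theorem_of_algebra by blast
    then have deg: "degree C = 0" by (simp add: constant_degree)
    have num0: "num None A B \<noteq> 0" using False C(2) by auto
    have "val None s = fls_subdegree (num None A B) - fls_subdegree (ev x C)"
      unfolding val_def C(2) expand_eq[OF C(1)] by (rule fls_divide_subdegree[OF num0 ev_nonzero[OF C(1)]])
    then have "fls_subdegree (num None A B) \<ge> - int 1"
      using val[OF None_point] infinity_subdegree(1)[OF C(1)] deg by simp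
    from num_degree[OF this] have "degree A = 0" "B = 0" by fastforce+
    moreover obtain c where c: "C = [:c:]" using deg by (rule degree_eq_zeroE)
    moreover obtain a where "A = [:a:]" using \<open>degree A = 0\<close> by (rule degree_eq_zeroE)
    ultimately have "s = fls_const a * inverse (fls_const c)"
      unfolding C(2) divide_inverse by simp
    also have "\<dots> = fls_const (a * inverse c)" unfolding fls_inverse_const fls_const_mult_const ..
    finally show ?thesis by blast
  qed
next
  fix s assume "s \<in> K"
  then show "s \<in> VF.L (\<lambda>P. if P = None then 1 else 0)"
    using const_S by (auto simp: VF.L_def)
qed

lemma dimension_L_infinity: "T.dimension 1 K (VF.L (\<lambda>P. if P = None then 1 else 0))"
  unfolding L_infinity using T.dimension_one[OF VF.subfield_K] .

lemma L_zero: "VF.L (\<lambda>_. 0) = K"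
proof
  have "VF.L (\<lambda>_. 0) \<subseteq> VF.L (\<lambda>P. if P = None then 1 else 0)"
    by (rule VF.L_mono) simp
  then show "VF.L (\<lambda>_. 0) \<subseteq> K" unfolding L_infinity .
  show "K \<subseteq> VF.L (\<lambda>_. 0)" using const_S by (auto simp: VF.L_def)
qed

lemma dimension_L_zero: "T.dimension 1 K (VF.L (\<lambda>_. 0))"
  unfolding L_zero using T.dimension_one[OF VF.subfield_K] .

section \<open>Fibres of x and functions with prescribed poles along them\<close>

lemma square_roots: "{b. b ^ 2 = c} = {csqrt c, - csqrt c}"
proof (intro subset_antisym subsetI)
  fix b assume "b \<in> {b. b ^ 2 = c}"
  then have "b ^ 2 = csqrt c ^ 2" by simp
  then show "b \<in> {csqrt c, - csqrt c}" by (auto simp only: power2_eq_iff)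
qed auto

lemma finite_sqrt: "finite {b :: complex. b ^ 2 = c}"
  unfolding square_roots by simp

text \<open>This is the degree of a fibre of \<open>x\<close>: two points, or one ramified point
  counted twice.\<close>

lemma sum_over_sqrt: "(\<Sum>b | b ^ 2 = (c :: complex). if b = 0 then 2 else 1) = (2 :: int)"
proof (cases "c = 0")
  case False
  then have "csqrt c \<noteq> 0" "csqrt c \<noteq> - csqrt c"
    by (simp_all add: eq_neg_iff_add_eq_0 flip: mult_2)
  then show ?thesis unfolding square_roots by simp
qed (simp add: square_roots)

text \<open>The divisors \<open>k \<cdot> None\<close> plus the zeros of
  \<open>fibre_fun = \<Prod>a\<in>As. (x - a)\<^sup>N\<close>: their degree is at most the dimension of their Riemann--Roch space because the functions
  \<open>x\<^sup>i w\<^sup>e / fibre_fun\<close> realize every pole order at infinity but one.\<close>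

context
  fixes As :: "complex set" and N :: nat
  assumes As: "finite As"
begin

definition fibre_divisor :: "int \<Rightarrow> (complex \<times> complex) option \<Rightarrow> int" where
  "fibre_divisor k P = (case P of None \<Rightarrow> k
     | Some (a, b) \<Rightarrow> if P \<in> points \<and> a \<in> As then int N * (if b
       = 0 then 2 else 1) else 0)"

definition fibre_points :: "(complex \<times> complex) option set" where
  "fibre_points = insert None (Some ` (SIGMA a:As. {b. b ^ 2 = poly f a}))"

definition fibre_fun :: "complex fls" where
  "fibre_fun = ev x (\<Prod>a\<in>As. [:- a, 1:] ^ N)"

lemma fibre_points: "finite fibre_points" "fibre_points \<subseteq> points" "P \<notin> fibre_points
  \<Longrightarrow> fibre_divisor k P = 0"
proof -
  show "finite fibre_points" unfolding fibre_points_def using As finite_sqrt by (simp add: finite_SigmaI)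
  show "fibre_points \<subseteq> points" by (auto simp: fibre_points_def points_def)
  show "fibre_divisor k P = 0" if "P \<notin> fibre_points"
    using that by (auto simp: fibre_points_def fibre_divisor_def points_def split: option.split)
qed

lemma fibre_degree: "(\<Sum>P\<in>fibre_points. fibre_divisor k P) = k + 2 * int (N * card As)"
proof -
  let ?B = "SIGMA a:As. {b. b ^ 2 = poly f a}"
  have fin: "finite ?B" using As finite_sqrt by (simp add: finite_SigmaI)
  have "(\<Sum>P\<in>fibre_points. fibre_divisor k P) = k + (\<Sum>P\<in>Some ` ?B. fibre_divisor k P)"
    unfolding fibre_points_def using fin by (subst sum.insert) (auto simp: fibre_divisor_def)
  also have "(\<Sum>P\<in>Some ` ?B. fibre_divisor k P) = (\<Sum>(a, b)\<in>?B. int N * (if b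
    = 0 then 2 else 1))"
    by (subst sum.reindex) (auto simp: fibre_divisor_def points_def intro!: sum.cong)
  also have "\<dots> = (\<Sum>a\<in>As. \<Sum>b | b ^ 2 = poly f a. int N * (if b = 0 then 2 else 1))"
    using As finite_sqrt by (subst sum.Sigma) auto
  also have "\<dots> = (\<Sum>a\<in>As. int N * 2)"
    unfolding sum_distrib_left[symmetric] sum_over_sqrt ..
  finally show ?thesis by simp
qed

lemma fibre_fun_facts: "fibre_fun \<in> S" "fibre_fun \<noteq> 0"
proof -
  show "fibre_fun \<in> S" unfolding fibre_fun_def by (rule ev_S)
  have "(\<Prod>a\<in>As. [:- a, 1:] ^ N) \<noteq> 0" using As by (simp add: prod_zero_iff)
  then show "fibre_fun \<noteq> 0" unfolding fibre_fun_def by (rule ev_nonzero)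
qed

lemma val_F:
  assumes "P \<in> points"
  shows "val P fibre_fun = (\<Sum>a\<in>As. int N * val P (ev x [:- a, 1:]))"
proof -
  have "val P (\<Prod>a\<in>B. ev x [:- a, 1:] ^ N) = (\<Sum>a\<in>B. int N * val P (ev x [:- a, 1:])) \<and>
      (\<Prod>a\<in>B. ev x [:- a, 1:] ^ N) \<in> S \<and>
        (\<Prod>a\<in>B. ev x [:- a, 1:] ^ N) \<noteq> 0" if "finite B" for B
    using that
  proof induction
    case (insert a B)
    have nz: "ev x [:- a, 1:] \<noteq> 0" by (rule ev_nonzero) simp
    have p: "ev x [:- a, 1:] ^ N \<in> S" "ev x [:- a, 1:] ^ N \<noteq> 0"
      by (intro power_mem ev_S power_not_zero nz)+
    note IH = insert.IH[THEN conjunct1] insert.IH[THEN conjunct2, THEN conjunct1]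
      insert.IH[THEN conjunct2, THEN conjunct2]
    have "val P (ev x [:- a, 1:] ^ N * (\<Prod>a\<in>B. ev x [:- a, 1:] ^ N)) =
        int N * val P (ev x [:- a, 1:]) + (\<Sum>a\<in>B. int N * val P (ev x [:- a, 1:]))"
      unfolding val_mult[OF assms p(1) IH(2) p(2) IH(3)] val_power[OF assms ev_S nz] IH(1) ..
    then show ?case
      unfolding prod.insert[OF insert.hyps] sum.insert[OF insert.hyps]
      using mult_mem[OF p(1) IH(2)] no_zero_divisors[OF p(2) IH(3)] by blast
  qed simp
  then show ?thesis using As unfolding fibre_fun_def ev.prod ev.power by blast
qed

lemma val_F_affine:
  assumes "Some (a, b) \<in> points"
  shows "val (Some (a, b)) fibre_fun = fibre_divisor k (Some (a, b))"
proof -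
  have "val (Some (a, b)) fibre_fun = (\<Sum>c\<in>As. if c = a then int N * (if b = 0 then 2 else 1) else 0)"
    unfolding val_F[OF assms] val_linear[OF assms] by (intro sum.cong) auto
  then show ?thesis using As assms by (simp add: fibre_divisor_def)
qed

lemma val_F_infinity: "val None fibre_fun = - 2 * int (N * card As)"
  unfolding val_F[OF None_point] val_ev using infinity_subdegree(1)[of "[:- _, 1:]"] by simp

lemma monomial_over_F:
  fixes i e :: nat
  defines "s \<equiv> x ^ i * w ^ e * inverse fibre_fun"
  shows "s \<in> S" "s \<noteq> 0" "val None s = 2 * int (N * card As) - 2 * int i - 3 * int e"
    "Some (a, b) \<in> points \<Longrightarrow> val (Some (a, b)) s \<ge> - fibre_divisor k (Some (a, b))"
proof -
  have x0: "x \<noteq> 0" using ev_nonzero[of "[:0, 1:]"] by simp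
  have p: "x ^ i \<in> S" "w ^ e \<in> S" "x ^ i \<noteq> 0" "w ^ e \<noteq> 0"
    using x_S w_S x0 w_nonzero by auto
  have q: "x ^ i * w ^ e \<in> S" "x ^ i * w ^ e \<noteq> 0" using p by auto
  show s: "s \<in> S" "s \<noteq> 0" unfolding s_def using q fibre_fun_facts by auto
  have val: "val P s = int i * val P x + int e * val P w - val P fibre_fun" if P: "P \<in> points" for P
    unfolding s_def
    using val_mult[OF P q(1) inverse_mem[OF fibre_fun_facts(1)] q(2)] val_mult[OF P p(1,2,3,4)]
      val_power[OF P x_S x0] val_power[OF P w_S w_nonzero] val_inverse[OF P fibre_fun_facts]
        fibre_fun_facts(2) by simp
  have vx: "val P x = fls_subdegree (X P)" for P using val_ev[of P "[:0, 1:]"] by simp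
  show "val None s = 2 * int (N * card As) - 2 * int i - 3 * int e"
    unfolding val[OF None_point] vx val_w X_infinity W_infinity val_F_infinity by simp
  show "val (Some (a, b)) s \<ge> - fibre_divisor k (Some (a, b))" if P: "Some (a, b) \<in> points"
  proof -
    have "int i * val (Some (a, b)) x \<ge> 0" unfolding vx using X_regular(1) by simp
    moreover have "int e * val (Some (a, b)) w \<ge> 0" unfolding val_w W_subdegree[OF P] by simp
    ultimately show ?thesis unfolding val[OF P] val_F_affine[OF P, of k] by simp
  qed
qed

text \<open>At affine points all poles come from \<open>fibre_fun\<close> and are allowed, so
  membership is decided by the order at infinity.\<close>

lemma monomial_in_L:
  "x ^ i * w ^ e * inverse fibre_fun \<in> VF.L (fibre_divisor k) \<longleftrightarrow> 2 * int i
    + 3 * int e - 2 * int (N * card As) \<le> k"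
proof -
  let ?s = "x ^ i * w ^ e * inverse fibre_fun"
  have "(\<forall>P\<in>points. val P ?s \<ge> - fibre_divisor k P) \<longleftrightarrow> val None ?s \<ge> - k"
  proof
    assume "\<forall>P\<in>points. val P ?s \<ge> - fibre_divisor k P"
    from bspec[OF this None_point] show "val None ?s \<ge> - k" by (simp add: fibre_divisor_def)
  next
    assume None: "val None ?s \<ge> - k"
    show "\<forall>P\<in>points. val P ?s \<ge> - fibre_divisor k P"
    proof
      fix P assume P: "P \<in> points"
      show "val P ?s \<ge> - fibre_divisor k P"
      proof (cases P)
        case None
        then show ?thesis using \<open>val None ?s \<ge> - k\<close> by (simp add: fibre_divisor_def)
      next
        case (Some ab)
        then show ?thesis using monomial_over_F(4)[where a = "fst ab" and b = "snd ab" and i = i and e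
          = e and k = k] P by simp
      qed
    qed
  qed
  then show ?thesis
    using monomial_over_F(1,2)[of i e] unfolding VF.L_def monomial_over_F(3) by auto
qed

text \<open>By \<open>fibre_degree\<close> this divisor has degree \<open>j\<close>. For
  \<open>j = 1\<close> its space contains \<open>1 / fibre_fun\<close>, and each further degree
  admits a new monomial over \<open>fibre_fun\<close>.\<close>

lemma fibre_dimension:
  assumes "j \<ge> 1"
  shows "\<exists>m. T.dimension m K (VF.L (fibre_divisor (int j - 2 * int (N * card As)))) \<and> m \<ge> j"
  using assms
proof (induction j rule: nat_induct_at_least)
  case base
  let ?D = "fibre_divisor (int 1 - 2 * int (N * card As))"
  obtain m where m: "T.dimension m K (VF.L ?D)"
    using VF.finite_dimension_L[OF dimension_L_zero fibre_points(1,2)] fibre_points(3) by blast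
  have "x ^ 0 * w ^ 0 * inverse fibre_fun \<in> VF.L ?D" unfolding monomial_in_L by simp
  then have "VF.L ?D \<noteq> {0}" using monomial_over_F(2)[of 0 0] by blast
  then have "m \<noteq> 0" using T.dimension_zero[OF VF.subfield_K, of "VF.L ?D"] m by auto
  then show ?case using m by (intro exI[of _ m]) auto
next
  case (Suc j)
  let ?k = "int j - 2 * int (N * card As)" and ?D = "fibre_divisor (int (Suc j) - 2 * int (N * card As))"
  obtain m where m: "T.dimension m K (VF.L (fibre_divisor ?k))" "m \<ge> j" using Suc by blast
  have upd: "(fibre_divisor ?k)(None := fibre_divisor ?k None + 1) = ?D"
    by (intro ext) (simp add: fibre_divisor_def split: option.split)
  \<comment> \<open>At most one factor \<open>w\<close> is used, to adjust the parity. One is the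
    only positive integer not of this form, and \<open>Suc j\<close> is at least two.\<close>
  obtain i e :: nat where ie: "2 * i + 3 * e = Suc j"
  proof (cases "even (Suc j)")
    case True
    then obtain i where "Suc j = 2 * i" by (rule evenE)
    then show ?thesis using that[of i 0] by simp
  next
    case False
    then have "even (Suc j - 3)" "Suc j \<ge> 3" using Suc(1) by presburger+
    then obtain i where "Suc j - 3 = 2 * i" by (blast elim: evenE)
    then show ?thesis using that[of i 1] \<open>Suc j \<ge> 3\<close> by simp
  qed
  then have ie': "2 * int i + 3 * int e = int (Suc j)" by linarith
  have "x ^ i * w ^ e * inverse fibre_fun \<in> VF.L (?D)"
    "x ^ i * w ^ e * inverse fibre_fun \<notin> VF.L (fibre_divisor ?k)"
    unfolding monomial_in_L ie' by simp_all
  then have "VF.L (fibre_divisor ?k) \<noteq> VF.L (?D)" by blast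
  then obtain m' where "T.dimension m' K (VF.L (?D))" "m' = m + 1"
    using VF.dimension_step[OF None_point m(1)] unfolding upd by metis
  then show ?case using m(2) by (intro exI[of _ m']) auto
qed

end

text \<open>Every \<open>D\<close> lies below a fibre divisor \<open>E\<close> with
  \<open>deg E - l(E) \<le> 0\<close>, and \<open>deg - l\<close> is monotone by
  \<open>dimension_mono\<close>.\<close>

lemma degree_le_dimension:
  fixes D :: "(complex \<times> complex) option \<Rightarrow> int"
  assumes A: "finite A" "A \<subseteq> points" "\<And>P. P \<notin> A \<Longrightarrow> D P
    = 0" and n: "T.dimension n K (VF.L D)"
  shows "(\<Sum>P\<in>A. D P) \<le> int n"
proof -
  define As where "As = fst ` {ab. Some ab \<in> A}"
  \<comment> \<open>A common bound for the coefficients of \<open>D\<close>; the added one keeps the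
    degree \<open>?j\<close> positive.\<close>
  define N where "N = nat (\<Sum>P\<in>A. \<bar>D P\<bar>) + 1"
  have "finite (Some -` A)" using A(1) by (intro finite_vimageI) auto
  then have As: "finite As" unfolding As_def by (simp add: vimage_def)
  have le_N: "D P \<le> int N" if "P \<in> A" for P
  proof -
    have "\<bar>D P\<bar> \<le> (\<Sum>P\<in>A. \<bar>D P\<bar>)" using A(1) that by (intro member_le_sum) auto
    then show ?thesis by (simp add: N_def)
  qed
  \<comment> \<open>The degree of \<open>?E\<close>: \<open>N\<close> at infinity and
    \<open>2 * N\<close> for each fibre.\<close>
  let ?j = "N + 2 * (N * card As)"
  let ?E = "fibre_divisor As N (int N)"
  let ?B = "A \<union> fibre_points As"
  have j: "int ?j - 2 * int (N * card As) = int N" by simp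
  have "?j \<ge> 1" by (simp add: N_def)
  from fibre_dimension[where N = N, OF As this, unfolded j]
  obtain m where m: "T.dimension m K (VF.L ?E)" "m \<ge> ?j" by blast
  have D_le: "D P \<le> ?E P" for P
  proof (cases "P \<in> A")
    case True
    show ?thesis
    proof (cases P)
      case None
      then show ?thesis using le_N[OF True] by (simp add: fibre_divisor_def[OF As])
    next
      case (Some ab)
      then have "fst ab \<in> As" using True unfolding As_def by blast
      moreover have "int N \<le> int N * (if snd ab = 0 then 2 else 1)" by simp
      ultimately show ?thesis
        using le_N[OF True] Some True A(2) by (auto simp: fibre_divisor_def[OF As] split: prod.split)
    qed
  next
    case False
    then show ?thesis using A(3) by (auto simp: fibre_divisor_def[OF As] split: option.split)
  qed
  have fin: "finite ?B" "?B \<subseteq> points" using A fibre_points(1,2)[OF As] by auto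
  have "\<And>P. P \<notin> ?B \<Longrightarrow> D P = ?E P" using A(3) fibre_points(3)[OF As] by auto
  from VF.dimension_mono[OF fin D_le this n]
  obtain m' where m': "T.dimension m' K (VF.L ?E)" "int m' \<le> int n + (\<Sum>P\<in>?B. ?E P - D P)" by blast
  have "m' = m" using VF.dim_L[OF m(1)] VF.dim_L[OF m'(1)] by simp
  moreover have "(\<Sum>P\<in>?B. D P) = (\<Sum>P\<in>A. D P)"
    by (rule sum.mono_neutral_right) (use fin(1) A(3) in auto)
  moreover have "(\<Sum>P\<in>?B. ?E P) = (\<Sum>P\<in>fibre_points As. ?E P)"
    by (rule sum.mono_neutral_right) (use fin(1) fibre_points(3)[OF As] in auto)
  moreover have "(\<Sum>P\<in>?B. ?E P - D P) = (\<Sum>P\<in>?B. ?E P) - (\<Sum>P\<in>?B. D P)"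
    by (rule sum_subtractf)
  ultimately show ?thesis
    using m'(2) m(2) fibre_degree[OF As, of N "int N"] by linarith
qed

theorem genus_one: "function_field_genus K (set_ring S) = 1"
  unfolding function_field_genus_def
proof (rule cSup_eq_maximum)
  \<comment> \<open>The point at infinity has degree one and admits only constants, so it attains
    the value \<open>1 - 1 + 1\<close>.\<close>
  define D :: "complex fls set \<Rightarrow> int" where "D = (\<lambda>V. if V = ring_at None then 1 else 0)"
  have supp: "{V. D V \<noteq> 0} = {ring_at None}" by (auto simp: D_def)
  have "D \<in> divisors K (set_ring S)"
    unfolding divisors_def mem_Collect_eq supp using ring_at_place[OF None_point] by simp
  moreover have "divisor_degree D = 1" unfolding divisor_degree_def supp by (simp add: D_def)
  moreover have "VF.L (\<lambda>P. D (ring_at P)) = VF.L (\<lambda>P. if P = None then 1 else 0)"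
  proof -
    have "D (ring_at P) = (if P = None then 1 else 0)" if "P \<in> points" for P
      using inj_onD[OF ring_at_inj _ that None_point] by (auto simp: D_def)
    then show ?thesis unfolding VF.L_def by auto
  qed
  then have "T.dim K (riemann_roch_space K (set_ring S) D) = 1"
    unfolding riemann_roch_eq using VF.dim_L[OF dimension_L_infinity] by simp
  ultimately show "1 \<in> (\<lambda>D. divisor_degree D - int (T.dim K (riemann_roch_space K
    (set_ring S) D)) + 1) `
      divisors K (set_ring S)"
    by (intro image_eqI[of _ _ D]) simp_all
next
  fix g assume "g \<in> (\<lambda>D. divisor_degree D - int (T.dim K (riemann_roch_space K
    (set_ring S) D)) + 1) `
      divisors K (set_ring S)"
  then obtain D where D: "D \<in> divisors K (set_ring S)"
    and g: "g = divisor_degree D - int (T.dim K (riemann_roch_space K (set_ring S) D)) + 1" by blast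
  define A where "A = {P \<in> points. D (ring_at P) \<noteq> 0}"
  define E where "E = (\<lambda>P. if P \<in> points then D (ring_at P) else 0)"
  have supp: "{V. D V \<noteq> 0} = ring_at ` A"
    using D unfolding divisors_def places_eq A_def by blast
  have inj: "inj_on ring_at A" by (rule inj_on_subset[OF ring_at_inj]) (auto simp: A_def)
  have "finite (ring_at ` A)" using D unfolding divisors_def supp[symmetric] by simp
  then have A: "finite A" "A \<subseteq> points" using inj finite_imageD by (auto simp: A_def)
  have E0: "\<And>P. P \<notin> A \<Longrightarrow> E P = 0" by (auto simp: E_def A_def)
  have "divisor_degree D = (\<Sum>P\<in>A. E P)"
    unfolding divisor_degree_def supp sum.reindex[OF inj] using A(2) by (intro sum.cong) (auto simp: E_def)
  moreover have "riemann_roch_space K (set_ring S) D = VF.L E"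
    unfolding riemann_roch_eq VF.L_def by (auto simp: E_def)
  moreover obtain n where n: "T.dimension n K (VF.L E)"
    using VF.finite_dimension_L[where D = E, OF dimension_L_zero A] E0 by blast
  ultimately show "g \<le> 1"
    using degree_le_dimension[OF A E0 n] VF.dim_L[OF n] g by simp
qed

end

section \<open>The function field of a plane curve with a rational map to a field of Laurent series\<close>

lemma fls_const_hom_eval: "hom_of_rings (eval_along (ev z) y)"
  by (rule hom_of_rings.hom_eval_along[OF ev.hom_of_rings_axioms])

lemma eval_var:
  "eval_along (ev z) y var_z = z" "eval_along (ev z) y var_y = y" "eval_along (ev z) y (cst c) = fls_const c"
  using hom_of_rings.eval_along_pCons[OF ev.hom_of_rings_axioms, of z y]
    hom_of_rings.eval_along_0[OF ev.hom_of_rings_axioms, of z y]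
  by (simp_all add: var_z_def var_y_def cst_def ev.zero ev.one one_pCons)

text \<open>The pair \<open>(z, y)\<close> is a generic point of the curve: a zero of
  \<open>g\<close> with \<open>z\<close> transcendental over C.\<close>

locale curve_map =
  fixes g :: "complex poly poly" and z y :: "complex fls"
  assumes irreducible_g: "Factorial_Ring.irreducible g" and degree_g: "degree g > 0"
    and root: "eval_along (ev z) y g = 0"
    and transcendental: "ev z p = 0 \<Longrightarrow> p = 0"
begin

definition eval :: "complex poly poly \<Rightarrow> complex fls" where
  "eval = eval_along (ev z) y"

sublocale E: hom_of_rings eval
  unfolding eval_def by (rule fls_const_hom_eval)

lemma eval_const: "eval [:p:] = ev z p"
  unfolding eval_def by (simp add: hom_of_rings.eval_along_pCons[OF ev.hom_of_rings_axioms]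
    hom_of_rings.eval_along_0[OF ev.hom_of_rings_axioms])

lemma prime_g: "prime_elem g"
  using irreducible_g by (rule irreducible_imp_prime_elem)

lemma eval_g: "eval g = 0"
  unfolding eval_def by (rule root)

lemma eval_smult: "eval (Polynomial.smult a b) = eval [:a:] * eval b"
  unfolding E.mult[symmetric] by simp

lemma g_dvd_degree: "g dvd r \<Longrightarrow> r = 0 \<or> degree g \<le> degree r"
  using divides_degree by blast

text \<open>Take a counterexample \<open>b\<close> of least degree in \<open>y\<close>.
  Pseudo-division by \<open>g\<close> puts its degree below that of \<open>g\<close>, and
  pseudo-division of \<open>g\<close> by \<open>b\<close> then leaves no remainder. The prime
  \<open>g\<close> divides the quotient, so cancelling \<open>g\<close> shows that \<open>b\<close>
  divides a nonzero polynomial in \<open>z\<close> alone. Thus \<open>b\<close> is itself such a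
  polynomial, and its vanishing contradicts transcendence.\<close>

lemma kernel_eq_ideal: "eval b = 0 \<longleftrightarrow> g dvd b"
proof
  assume "g dvd b"
  then show "eval b = 0" by (auto elim!: dvdE simp: E.mult eval_g)
next
  assume b: "eval b = 0"
  show "g dvd b"
  proof (rule ccontr)
    assume nb: "\<not> g dvd b"
    obtain b where b: "eval b = 0" "\<not> g dvd b"
      and min: "\<And>b'. eval b' = 0 \<Longrightarrow> \<not> g dvd b'
        \<Longrightarrow> degree b \<le> degree b'"
      using ex_has_least_nat[of "\<lambda>b. eval b = 0 \<and> \<not> g dvd b" b degree] b nb by blast
    have g0: "g \<noteq> 0" using degree_g by auto
    have b0: "b \<noteq> 0" using b(2) by auto
    have not_const: "\<not> g dvd [:a:]" if "a \<noteq> 0" for a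
      using g_dvd_degree[of "[:a:]"] that degree_g by auto
    have "degree b < degree g"
    proof -
      obtain a q where a: "a \<noteq> 0" "Polynomial.smult a b = g * q + pseudo_mod b g"
        using pseudo_mod(1)[OF g0] by blast
      have "eval (pseudo_mod b g) = eval (Polynomial.smult a b - g * q)" using a(2) by simp
      then have ev0: "eval (pseudo_mod b g) = 0"
        unfolding E.diff E.mult eval_smult b(1) eval_g by simp
      have "\<not> g dvd pseudo_mod b g"
      proof
        assume "g dvd pseudo_mod b g"
        then have "g dvd Polynomial.smult a b" unfolding a(2) by simp
        then have "g dvd [:a:] * b" by simp
        then show False using prime_elem_dvd_multD[OF prime_g] not_const[OF a(1)] b(2) by blast
      qed
      moreover from this have "pseudo_mod b g \<noteq> 0" by auto
      ultimately show ?thesis using min[OF ev0] pseudo_mod(2)[OF g0, of b] by auto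
    qed
    obtain a q where a: "a \<noteq> 0" "Polynomial.smult a g = b * q + pseudo_mod g b"
      using pseudo_mod(1)[OF b0] by blast
    have "eval (pseudo_mod g b) = eval (Polynomial.smult a g - b * q)" using a(2) by simp
    then have ev0: "eval (pseudo_mod g b) = 0"
      unfolding E.diff E.mult eval_smult b(1) eval_g by simp
    have r0: "pseudo_mod g b = 0"
    proof (rule ccontr)
      assume r: "pseudo_mod g b \<noteq> 0"
      then have less: "degree (pseudo_mod g b) < degree b" using pseudo_mod(2)[OF b0, of g] by blast
      then have "g dvd pseudo_mod g b" using min[OF ev0] by force
      then show False using g_dvd_degree r less \<open>degree b < degree g\<close> by fastforce
    qed
    have "g dvd b * q" using a(2) unfolding r0 by (metis add.right_neutral dvd_smult dvd_refl)
    then have "g dvd q" using prime_elem_dvd_multD[OF prime_g] b(2) by blast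
    then obtain q' where "q = g * q'" by (rule dvdE)
    then have "g * [:a:] = g * (b * q')" using a(2) unfolding r0 by (simp add: mult.left_commute)
    then have "[:a:] = b * q'" by (rule mult_left_cancel[OF g0, THEN iffD1])
    moreover from this a(1) have "q' \<noteq> 0" by auto
    ultimately have "degree b = 0" using b0 degree_mult_eq[of b q'] by (metis add_is_0 degree_pCons_0)
    then obtain c where c: "b = [:c:]" by (rule degree_eq_zeroE)
    have "c = 0" using b(1) unfolding c eval_const by (rule transcendental)
    then show False using b0 c by simp
  qed
qed

section \<open>The local ring of the curve and its image in the Laurent series\<close>

definition value_field :: "complex fls set" where
  "value_field = {eval a / eval b | a b. \<not> g dvd b}"

definition fract_eval :: "complex poly poly fract \<Rightarrow> complex fls" where
  "fract_eval u = (SOME v. \<exists>a b. \<not> g dvd b \<and> u = Fract a b \<and> v = eval a / eval b)"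

lemma eval_nonzero: "\<not> g dvd b \<Longrightarrow> eval b \<noteq> 0"
  using kernel_eq_ideal by blast

lemma not_dvd_nonzero: "\<not> g dvd b \<Longrightarrow> b \<noteq> 0"
  by auto

lemma fract_eval: "\<not> g dvd b \<Longrightarrow> fract_eval (Fract a b) = eval a / eval b"
  unfolding fract_eval_def
proof (rule some_equality)
  assume b: "\<not> g dvd b"
  then show "\<exists>a' b'. \<not> g dvd b' \<and> Fract a b = Fract a' b' \<and> eval a / eval b
    = eval a' / eval b'" by blast
  fix v assume "\<exists>a' b'. \<not> g dvd b' \<and> Fract a b = Fract a' b' \<and> v = eval a' / eval b'"
  then obtain a' b' where b': "\<not> g dvd b'" "Fract a b = Fract a' b'" and v: "v
    = eval a' / eval b'" by blast
  have "a * b' = a' * b"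
    using b'(2) eq_fract(1)[OF not_dvd_nonzero[OF b] not_dvd_nonzero[OF b'(1)]] by blast
  then have "eval a * eval b' = eval a' * eval b" by (simp only: E.mult[symmetric])
  then show "v = eval a / eval b"
    unfolding v frac_eq_eq[OF eval_nonzero[OF b'(1)] eval_nonzero[OF b]] by (rule sym)
qed

lemma not_dvd_mult: "\<not> g dvd b \<Longrightarrow> \<not> g dvd b' \<Longrightarrow> \<not> g dvd b * b'"
  using prime_elem_dvd_multD[OF prime_g] by blast

lemma not_dvd_one: "\<not> g dvd 1"
  using prime_g prime_elem_not_unit by blast

lemma carrier_local_ring: "carrier (local_ring g) = {Fract a b | a b. \<not> g dvd b}"
  by (simp add: local_ring_def)

lemma local_ring_simps [simp]:
  "u \<otimes>\<^bsub>local_ring g\<^esub> v = u * v" "\<one>\<^bsub>local_ring g\<^esub>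
    = 1" "\<zero>\<^bsub>local_ring g\<^esub> = 0" "u \<oplus>\<^bsub>local_ring g\<^esub> v = u + v"
  by (simp_all add: local_ring_def)

lemma local_ring_closed:
  assumes "u \<in> carrier (local_ring g)" "v \<in> carrier (local_ring g)"
  shows "u + v \<in> carrier (local_ring g)" "u * v \<in> carrier (local_ring g)"
    "fract_eval (u + v) = fract_eval u + fract_eval v" "fract_eval (u * v) = fract_eval u * fract_eval v"
proof -
  obtain a b where u: "u = Fract a b" "\<not> g dvd b" using assms(1) unfolding carrier_local_ring by blast
  obtain a' b' where v: "v = Fract a' b'" "\<not> g dvd b'" using assms(2) unfolding carrier_local_ring by blast
  note bb = not_dvd_mult[OF u(2) v(2)]
  have sum: "u + v = Fract (a * b' + a' * b) (b * b')"
    unfolding u(1) v(1) by (rule add_fract) (use u v in auto)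
  have prod: "u * v = Fract (a * a') (b * b')" unfolding u(1) v(1) by (rule mult_fract)
  show "u + v \<in> carrier (local_ring g)" unfolding carrier_local_ring sum using bb by blast
  show "u * v \<in> carrier (local_ring g)" unfolding carrier_local_ring prod using bb by blast
  show "fract_eval (u + v) = fract_eval u + fract_eval v"
    unfolding sum fract_eval[OF bb] unfolding u(1) v(1) fract_eval[OF u(2)] fract_eval[OF v(2)]
      add_frac_eq[OF eval_nonzero[OF u(2)] eval_nonzero[OF v(2)]] E.add E.mult ..
  show "fract_eval (u * v) = fract_eval u * fract_eval v"
    unfolding prod fract_eval[OF bb] unfolding u(1) v(1) fract_eval[OF u(2)] fract_eval[OF v(2)]
      times_divide_times_eq E.mult ..
qed

lemma cst_in_local_ring: "Fract a 1 \<in> carrier (local_ring g)"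
  unfolding carrier_local_ring using not_dvd_one by blast

lemma ring_local_ring: "cring (local_ring g)"
proof (rule cringI)
  have one: "1 \<in> carrier (local_ring g)" using cst_in_local_ring[of 1] by (simp add: One_fract_def)
  have zero: "0 \<in> carrier (local_ring g)" using cst_in_local_ring[of 0] by (simp add: Zero_fract_def)
  have neg: "- u \<in> carrier (local_ring g)" if "u \<in> carrier (local_ring g)" for u
    using local_ring_closed(2)[OF cst_in_local_ring[of "- 1"] that]
    by (simp add: minus_fract[symmetric] One_fract_def[symmetric])
  show "abelian_group (local_ring g)"
  proof (rule abelian_groupI)
    fix u assume "u \<in> carrier (local_ring g)"
    then show "\<exists>v\<in>carrier (local_ring g). v \<oplus>\<^bsub>local_ring g\<^esub> u
      = \<zero>\<^bsub>local_ring g\<^esub>"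
      using neg by (intro bexI[of _ "- u"]) auto
  qed (use zero local_ring_closed in \<open>auto simp: algebra_simps\<close>)
  show "comm_monoid (local_ring g)"
    by (rule comm_monoidI) (use one local_ring_closed in \<open>auto simp: algebra_simps\<close>)
qed (auto simp: algebra_simps)

lemma value_field_eq: "value_field = fract_eval ` carrier (local_ring g)"
  unfolding value_field_def carrier_local_ring using fract_eval by (auto simp: image_iff) metis+

lemma set_field_value_field: "set_field value_field"
proof
  show "1 \<in> value_field" unfolding value_field_def using not_dvd_one E.one by force
  fix r s assume "r \<in> value_field" "s \<in> value_field"
  then obtain a b a' b' where r: "r = eval a / eval b" "\<not> g dvd b" and s: "s
    = eval a' / eval b'" "\<not> g dvd b'"
    unfolding value_field_def by blast
  have "r - s = eval (a * b' - a' * b) / eval (b * b')"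
    unfolding r(1) s(1) diff_frac_eq[OF eval_nonzero[OF r(2)] eval_nonzero[OF s(2)]] E.diff E.mult ..
  then show "r - s \<in> value_field" unfolding value_field_def using not_dvd_mult[OF r(2) s(2)] by blast
  have "r * s = eval (a * a') / eval (b * b')" unfolding r(1) s(1) times_divide_times_eq E.mult ..
  then show "r * s \<in> value_field" unfolding value_field_def using not_dvd_mult[OF r(2) s(2)] by blast
next
  fix r assume r: "r \<in> value_field"
  then obtain a b where ab: "r = eval a / eval b" "\<not> g dvd b" unfolding value_field_def by blast
  show "inverse r \<in> value_field"
  proof (cases "g dvd a")
    case True
    then have "r = 0" using ab kernel_eq_ideal by simp
    then show ?thesis using r by simp
  next
    case False
    then show ?thesis unfolding ab(1) inverse_divide value_field_def using ab(2) by blast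
  qed
qed

lemma in_value_field: "z \<in> value_field" "y \<in> value_field" "fls_const c \<in> value_field"
proof -
  have "eval a \<in> value_field" for a
  proof -
    have "eval a = eval a / eval 1" by (simp only: E.one div_by_1)
    then show ?thesis unfolding value_field_def using not_dvd_one by blast
  qed
  from this[of var_z] this[of var_y] this[of "cst c"]
  show "z \<in> value_field" "y \<in> value_field" "fls_const c \<in> value_field"
    unfolding eval_def eval_var by simp_all
qed

text \<open>This is the first isomorphism theorem for \<open>fract_eval\<close>, whose kernel is the
  maximal ideal of the local ring, combined with the invariance of the genus.\<close>

theorem curve_genus_eq:
  shows "function_field_genus (constants g) (function_field g) =
    function_field_genus (range fls_const) (set_ring value_field)"
proof -
  interpret Vf: set_field value_field by (rule set_field_value_field)
  interpret R: cring "local_ring g" by (rule ring_local_ring)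
  interpret H: ring_hom_ring "local_ring g" "set_ring value_field" fract_eval
  proof (rule ring_hom_ringI[OF R.ring_axioms Vf.T.ring_axioms])
    show "fract_eval u \<in> carrier (set_ring value_field)" if "u \<in> carrier (local_ring g)" for u
      using that by (simp add: value_field_eq)
    show "fract_eval \<one>\<^bsub>local_ring g\<^esub> = \<one>\<^bsub>set_ring value_field\<^esub>"
      using fract_eval[OF not_dvd_one, of 1] by (simp add: One_fract_def[symmetric] E.one)
  qed (simp_all add: local_ring_closed)
  have kernel: "a_kernel (local_ring g) (set_ring value_field) fract_eval = local_ring_ideal g"
  proof -
    have "fract_eval (Fract a b) = 0 \<longleftrightarrow> g dvd a" if "\<not> g dvd b" for a b
      unfolding fract_eval[OF that] using eval_nonzero[OF that] kernel_eq_ideal by simp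
    then show ?thesis
      unfolding a_kernel_def' carrier_local_ring local_ring_ideal_def by auto
  qed
  let ?FF = "function_field g"
  let ?T = "set_ring value_field"
  define h where "h = (\<lambda>X. the_elem (fract_eval ` X))"
  have FF: "?FF = local_ring g Quot a_kernel (local_ring g) ?T fract_eval"
    unfolding kernel function_field_def ..
  have h: "h \<in> ring_iso ?FF ?T"
    unfolding FF h_def by (rule H.FactRing_iso_set) (simp add: value_field_eq)
  have ring_FF: "ring ?FF"
    unfolding FF by (rule ideal.quotient_is_ring[OF H.kernel_is_ideal])
  \<comment> \<open>The genus is transported along the inverse isomorphism: its source is known to
    be a field, and this makes the quotient a field too.\<close>
  define i where "i = inv_into (carrier ?FF) h"
  have i: "i \<in> ring_iso ?T ?FF" unfolding i_def by (rule ring_iso_set_sym[OF ring_FF h])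
  then have "i \<in> ring_hom ?T ?FF" by (simp add: ring_iso_def)
  then have "i \<zero>\<^bsub>?T\<^esub> = \<zero>\<^bsub>?FF\<^esub>" by
    (rule ring_hom_zero[OF _ Vf.T.ring_axioms ring_FF])
  then have "Ring.field ?FF" using Vf.T.ring_iso_imp_img_field[OF i] by simp
  then interpret FI: field_iso ?T ?FF i
    by (intro field_iso.intro Vf.field_set_ring field_iso_axioms.intro i)
  have sub: "subfield (range fls_const) ?T"
    by (rule Vf.subfield_set_ring[OF set_field_constants]) (use in_value_field in auto)
  have "i (fls_const c) = local_ring_ideal g +>\<^bsub>local_ring g\<^esub> Fract (cst c) 1" for c
  proof -
    let ?X = "local_ring_ideal g +>\<^bsub>local_ring g\<^esub> Fract (cst c) 1"
    have "h ?X = fract_eval (Fract (cst c) 1)"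
      unfolding h_def kernel[symmetric] by (rule H.the_elem_simp[OF cst_in_local_ring])
    also have "\<dots> = fls_const c"
      unfolding fract_eval[OF not_dvd_one] E.one div_by_1 unfolding eval_def eval_var ..
    finally have "h ?X = fls_const c" .
    moreover have "?X \<in> carrier ?FF"
      unfolding function_field_def FactRing_def A_RCOSETS_def' using cst_in_local_ring by auto
    moreover have "inj_on h (carrier ?FF)" using h by (simp add: ring_iso_def bij_betw_def)
    ultimately show ?thesis unfolding i_def by (metis inv_into_f_f)
  qed
  then have "i ` range fls_const = constants g" unfolding constants_def by (auto simp: image_iff)
  then show ?thesis using FI.function_field_genus_image[OF sub] by simp
qed

end

context elliptic begin

text \<open>By the last hypothesis the field generated by \<open>z\<close> and \<open>y\<close>
  contains \<open>x\<close>, hence also \<open>w = c x / z\<close>; so it is all of C(x, w).\<close>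

lemma curve_has_genus_one:
  fixes g c y
  defines "z \<equiv> fls_const c * x / w"
  assumes c: "c \<noteq> 0" and irr: "Factorial_Ring.irreducible g" "degree g > 0"
    and y: "y \<in> S" and root: "eval_along (ev z) y g = 0"
    and x: "\<And>E. set_field E \<Longrightarrow> z \<in> E
      \<Longrightarrow> y \<in> E \<Longrightarrow> range fls_const \<subseteq> E \<Longrightarrow> x \<in> E"
  shows "curve_has_genus g 1"
proof -
  have x0: "x \<noteq> 0" using ev_nonzero[of "[:0, 1:]"] by simp
  have cx: "fls_const c * x \<noteq> 0" using c x0 by simp
  \<comment> \<open>The orders of \<open>x\<close> and \<open>w\<close> at infinity are -2 and -3. A
    series of order one is a root of no nonzero polynomial.\<close>
  have "fls_subdegree z = 1"
    unfolding z_def fls_divide_subdegree[OF cx w_nonzero] W_infinity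
    using fls_subdegree_mult[of "fls_const c" x] c x0 X_infinity by (simp add: fls_const_subdegree)
  then have trans: "ev z p = 0 \<Longrightarrow> p = 0" for p
    using ev_subdegree_affine(2)[of z 0 z 1 p] by auto
  interpret C: curve_map g z y
    by unfold_locales (use irr root trans in auto)
  interpret E: set_field C.value_field by (rule C.set_field_value_field)
  have xE: "x \<in> C.value_field"
    using x[OF C.set_field_value_field] C.in_value_field by blast
  have z0: "z \<noteq> 0" unfolding z_def using cx w_nonzero by simp
  have "w = fls_const c * x / z" unfolding z_def using cx w_nonzero by simp
  then have wE: "w \<in> C.value_field" using xE C.in_value_field by auto
  have ev_E: "ev x p \<in> C.value_field" for p
    by (induction p) (auto simp: ev_pCons intro!: E.add_mem E.mult_mem xE C.in_value_field)
  have "S \<subseteq> C.value_field"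
  proof
    fix s assume "s \<in> S"
    then obtain A B D where "s = num None A B / ev x D" by (rule S_cases)
    then show "s \<in> C.value_field" unfolding num_None using ev_E wE by auto
  qed
  moreover have "C.value_field \<subseteq> S"
  proof -
    have zS: "z \<in> S" unfolding z_def using x_S w_S const_S by auto
    have "ev z p \<in> S" for p
      by (induction p) (auto simp: ev_pCons intro!: add_mem mult_mem zS const_S)
    then have "eval_along (ev z) y p \<in> S" for p
      by (induction p) (auto simp: hom_of_rings.eval_along_pCons[OF ev.hom_of_rings_axioms]
        hom_of_rings.eval_along_0[OF ev.hom_of_rings_axioms] intro!: add_mem mult_mem y)
    then show ?thesis unfolding C.value_field_def C.eval_def by auto
  qed
  ultimately have "C.value_field = S" by blast
  then show ?thesis
    unfolding curve_has_genus_def using irr(1) C.curve_genus_eq genus_one by simp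
qed

end

section \<open>Cubic curves that are odd in both variables\<close>

lemma total_degree_eqI:
  assumes "poly.coeff (poly.coeff p j) i \<noteq> 0" "i + j = n"
    and "\<And>i j. poly.coeff (poly.coeff p j) i \<noteq> 0 \<Longrightarrow> i + j \<le> n"
  shows "total_degree p = n"
proof -
  let ?A = "{i + j | i j. poly.coeff (poly.coeff p j) i \<noteq> 0}"
  have "?A \<subseteq> {..n}" using assms(3) by auto
  then have "finite ?A" by (rule finite_subset) simp
  moreover have "n \<in> ?A" using assms(1,2) by blast
  ultimately have "Max ?A = n" using assms(3) by (intro Max_eqI) auto
  moreover have "p \<noteq> 0" using assms(1) by auto
  ultimately show ?thesis by (simp add: total_degree_def)
qed

text \<open>The alternative \<open>p3 = 0\<close> admits total degree two, so that the right-hand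
  sides of the systems are covered along with the curves.\<close>

lemma total_degree_cubic:
  assumes "degree p0 \<le> n" "degree p1 + 1 \<le> n" "degree p2 + 2 \<le> n" "degree p3
    + 3 \<le> n \<or> p3 = 0"
    and "poly.coeff (poly.coeff [:p0, p1, p2, p3:] j) i \<noteq> 0" "i + j = n"
  shows "total_degree [:p0, p1, p2, p3:] = n"
proof (rule total_degree_eqI[OF assms(5,6)])
  fix i j assume nz: "poly.coeff (poly.coeff [:p0, p1, p2, p3:] j) i \<noteq> 0"
  then have i: "i \<le> degree (poly.coeff [:p0, p1, p2, p3:] j)" by (rule le_degree)
  consider "j = 0" | "j = 1" | "j = 2" | "j = 3" | l where "j = Suc (Suc (Suc (Suc l)))"
    by (metis One_nat_def Suc_1 numeral_3_eq_3 not0_implies_Suc)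
  then show "i + j \<le> n"
    using i nz assms(1-4) by cases (auto simp: numeral_2_eq_2 numeral_3_eq_3)
qed

text \<open>One of two factors has degree at most one. Its leading coefficient is a unit because the
  product is monic, so it is a unit or has a root in the coefficient ring.\<close>

lemma irreducible_monic_cubic:
  fixes g :: "'a::idom_divide poly"
  assumes deg: "degree g = 3" and monic: "lead_coeff g = 1" and no_root: "\<And>r. poly g r \<noteq> 0"
  shows "Factorial_Ring.irreducible g"
proof (rule Factorial_Ring.irreducibleI)
  show "g \<noteq> 0" using deg by auto
  show "\<not> is_unit g" using deg by (auto simp: is_unit_poly_iff)
  have factor: "is_unit a" if g: "g = a * b" and small: "degree a \<le> 1" for a b
  proof -
    have "lead_coeff a * lead_coeff b = 1" using monic unfolding g lead_coeff_mult .
    then obtain u where u: "lead_coeff a * u = 1" by blast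
    show ?thesis
    proof (cases "degree a = 0")
      case True
      then obtain c where c: "a = [:c:]" by (rule degree_eq_zeroE)
      then have "c * u = 1" using u by simp
      then show ?thesis unfolding c by (simp add: is_unit_const_poly_iff dvdI[of 1 c u])
    next
      case False
      then have a1: "degree a = 1" using small by simp
      then obtain p q where a: "a = [:p, q:]"
        by (metis degree_eq_zeroE degree_pCons_eq_if One_nat_def Suc_inject nat.distinct(1) pCons_cases)
      have "q * u = 1" using u a1 unfolding a by simp
      then have "poly a (- p * u) = 0" unfolding a by (simp add: algebra_simps)
      then have "poly g (- p * u) = 0" unfolding g by simp
      then show ?thesis using no_root by blast
    qed
  qed
  fix a b assume g: "g = a * b"
  have "a \<noteq> 0" "b \<noteq> 0" using g deg by auto
  then have "degree a + degree b = 3" using deg unfolding g by (simp add: degree_mult_eq)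
  then have "degree a \<le> 1 \<or> degree b \<le> 1" by linarith
  then show "is_unit a \<or> is_unit b" using factor[of a b] factor[of b a] g by (auto simp: mult.commute)
qed

text \<open>Only monomials of odd total degree occur. The letters \<open>a\<close>,
  \<open>b\<close>, \<open>d\<close> belong to the coefficients of \<open>y ^ 2\<close>,
  \<open>y\<close> and 1, and the indices are exponents of \<open>z\<close>.\<close>

definition cubic_curve :: "complex \<Rightarrow> complex \<Rightarrow> complex \<Rightarrow> complex
  \<Rightarrow> complex \<Rightarrow> complex \<Rightarrow>
    complex \<Rightarrow> complex \<Rightarrow> complex \<Rightarrow> complex \<Rightarrow> complex
      \<Rightarrow> complex poly poly" where
  "cubic_curve a1 a3 b0 b2 b4 b6 d1 d3 d5 d7 d9 =
     [:[:0, d1, 0, d3, 0, d5, 0, d7, 0, d9:], [:b0, 0, b2, 0, b4, 0, b6:], [:0, a1, 0, a3:], 1:]"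

lemma var_z_power:
  "var_z ^ 2 = [:[:0, 0, 1:]:]" "var_z ^ 3 = [:[:0, 0, 0, 1:]:]" "var_z ^ 4 = [:[:0, 0, 0, 0, 1:]:]"
  "var_z ^ 5 = [:[:0, 0, 0, 0, 0, 1:]:]" "var_z ^ 6 = [:[:0, 0, 0, 0, 0, 0, 1:]:]"
  "var_z ^ 7 = [:[:0, 0, 0, 0, 0, 0, 0, 1:]:]" "var_z ^ 9 = [:[:0, 0, 0, 0, 0, 0, 0, 0, 0, 1:]:]"
  by (simp_all add: var_z_def eval_nat_numeral)

lemma var_y_power: "var_y ^ 2 = [:0, 0, 1:]" "var_y ^ 3 = [:0, 0, 0, 1:]"
  by (simp_all add: var_y_def eval_nat_numeral)

lemma cubic_curve_eq:
  "cubic_curve a1 a3 b0 b2 b4 b6 d1 d3 d5 d7 d9 = var_y ^ 3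
     + cst a1 * var_y ^ 2 * var_z + cst a3 * var_y ^ 2 * var_z ^ 3
     + cst b0 * var_y + cst b2 * var_y * var_z ^ 2 + cst b4 * var_y * var_z ^ 4 + cst b6 * var_y * var_z ^ 6
     + cst d1 * var_z + cst d3 * var_z ^ 3 + cst d5 * var_z ^ 5 + cst d7 * var_z ^ 7 + cst d9 * var_z ^ 9"
  unfolding var_z_power var_y_power by (simp add: cubic_curve_def cst_def var_z_def var_y_def)

lemma cst_minus: "cst (- c) = - cst c"
  by (simp add: cst_def)

lemma degree_cubic_curve: "degree (cubic_curve a1 a3 b0 b2 b4 b6 d1 d3 d5 d7 d9) = 3"
  "lead_coeff (cubic_curve a1 a3 b0 b2 b4 b6 d1 d3 d5 d7 d9) = 1"
  by (simp_all add: cubic_curve_def)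

lemma total_degree_cubic_curve:
  assumes "d9 \<noteq> 0"
  shows "total_degree (cubic_curve a1 a3 b0 b2 b4 b6 d1 d3 d5 d7 d9) = 9"
  unfolding cubic_curve_def
  by (rule total_degree_cubic[of _ _ _ _ _ 0 9])
    (use assms in \<open>simp_all add: eval_nat_numeral\<close>)

text \<open>Oddness under the involution: with \<open>y = z k\<close> and one factor
  \<open>z\<close> removed, only the invariants \<open>z ^ 2\<close> and \<open>k\<close> remain,
  the coordinates of the quotient.\<close>

lemma odd_cubic_factorization:
  fixes z k a1 a3 b0 b2 b4 b6 d1 d3 d5 d7 d9 :: "'a::comm_ring_1"
  shows "(z * k) ^ 3 + a1 * (z * k) ^ 2 * z + a3 * (z * k) ^ 2 * z ^ 3
      + b0 * (z * k) + b2 * (z * k) * z ^ 2 + b4 * (z * k) * z ^ 4 + b6 * (z * k) * z ^ 6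
      + d1 * z + d3 * z ^ 3 + d5 * z ^ 5 + d7 * z ^ 7 + d9 * z ^ 9 =
    z * (z ^ 2 * k ^ 3 + (a1 + a3 * z ^ 2) * z ^ 2 * k ^ 2
      + (b0 + b2 * z ^ 2 + b4 * (z ^ 2) ^ 2 + b6 * (z ^ 2) ^ 3) * k
      + (d1 + d3 * z ^ 2 + d5 * (z ^ 2) ^ 2 + d7 * (z ^ 2) ^ 3 + d9 * (z ^ 2) ^ 4))"
  by (simp add: eval_nat_numeral algebra_simps)

lemma eval_cubic_curve:
  "eval_along (ev z) (z * k) (cubic_curve a1 a3 b0 b2 b4 b6 d1 d3 d5 d7 d9) =
    z * (z ^ 2 * k ^ 3 + (fls_const a1 + fls_const a3 * z ^ 2) * z ^ 2 * k ^ 2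
      + (fls_const b0 + fls_const b2 * z ^ 2 + fls_const b4 * (z ^ 2) ^ 2 + fls_const b6 * (z ^ 2) ^ 3) * k
      + (fls_const d1 + fls_const d3 * z ^ 2 + fls_const d5 * (z ^ 2) ^ 2 + fls_const d7 * (z ^ 2) ^ 3
        + fls_const d9 * (z ^ 2) ^ 4))"
proof -
  interpret E: hom_of_rings "eval_along (ev z) (z * k)" by (rule fls_const_hom_eval)
  show ?thesis
    unfolding cubic_curve_eq E.add E.mult E.power eval_var by (rule odd_cubic_factorization)
qed

text \<open>A root has degree at most three. Its top coefficient satisfies the cubic from degree
  nine; simplicity of that zero eliminates the even coefficients, degrees one and three determine
  the odd ones as \<open>r1\<close> and \<open>r3\<close>, and \<open>r3\<close> violates the
  cubic.\<close>

lemma cubic_curve_no_root: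
  fixes a1 a3 b0 b2 b4 b6 d1 d3 d5 d7 d9 :: complex
  defines "r1 \<equiv> - d1 / b0"
  defines "r3 \<equiv> - (r1 ^ 3 + a1 * r1 ^ 2 + b2 * r1 + d3) / b0"
  assumes b0: "b0 \<noteq> 0"
    and simple: "\<And>s. s ^ 3 + a3 * s ^ 2 + b6 * s + d9 = 0 \<Longrightarrow> 3 * s ^ 2
      + 2 * a3 * s + b6 \<noteq> 0"
    and r3: "r3 ^ 3 + a3 * r3 ^ 2 + b6 * r3 + d9 \<noteq> 0"
  shows "poly (cubic_curve a1 a3 b0 b2 b4 b6 d1 d3 d5 d7 d9) p \<noteq> 0"
proof
  let ?g0 = "[:0, d1, 0, d3, 0, d5, 0, d7, 0, d9:]" and ?g1 = "[:b0, 0, b2, 0, b4, 0, b6:]"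
    and ?g2 = "[:0, a1, 0, a3:]"
  assume "poly (cubic_curve a1 a3 b0 b2 b4 b6 d1 d3 d5 d7 d9) p = 0"
  then have eq: "p * p * p + ?g2 * (p * p) + ?g1 * p + ?g0 = 0"
    by (simp only: cubic_curve_def poly_pCons poly_0 mult_zero_right add_0_right mult_1_right
        mult_1_left mult_zero_left ring_distribs ac_simps)
  \<comment> \<open>From degree four on, the cube of \<open>p\<close> has larger degree than all
    other terms together.\<close>
  have "degree p \<le> 3"
  proof (rule ccontr)
    assume "\<not> degree p \<le> 3"
    then have n: "degree p \<ge> 4" by simp
    then have p0: "p \<noteq> 0" by auto
    have g: "degree ?g0 \<le> 9" "degree ?g1 \<le> 6" "degree ?g2 \<le> 3" by simp_all
    have "degree (?g2 * (p * p)) < 3 * degree p"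
      using degree_mult_le[of ?g2 "p * p"] degree_mult_le[of p p] g(3) n by linarith
    moreover have "degree (?g1 * p) < 3 * degree p"
      using degree_mult_le[of ?g1 p] g(2) n by linarith
    moreover have "degree ?g0 < 3 * degree p" using g(1) n by linarith
    ultimately have "degree (?g2 * (p * p) + ?g1 * p + ?g0) < 3 * degree p"
      by (intro degree_add_less)
    moreover have "p * p * p = - (?g2 * (p * p) + ?g1 * p + ?g0)"
      using eq by (simp only: eq_neg_iff_add_eq_0 add.assoc)
    then have "degree (p * p * p) = degree (?g2 * (p * p) + ?g1 * p + ?g0)" by (simp only: degree_minus)
    moreover have "degree (p * p * p) = 3 * degree p" using p0 by (simp add: degree_mult_eq)
    ultimately show False by linarith
  qed
  moreover obtain p0 p1 p2 p3 p4 where "p = pCons p0 (pCons p1 (pCons p2 (pCons p3 p4)))"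
    by (metis pCons_cases)
  ultimately have p: "p = [:p0, p1, p2, p3:]" by (simp split: if_splits)
  have coeff: "poly.coeff (p * p * p + ?g2 * (p * p) + ?g1 * p + ?g0) n = 0" for n unfolding eq by simp
  have E9: "p3 ^ 3 + a3 * p3 ^ 2 + b6 * p3 + d9 = 0"
    using coeff[of 9] unfolding p by (simp add: eval_nat_numeral algebra_simps)
  \<comment> \<open>The second factor is the derivative of the cubic in \<open>E9\<close>, nonzero
    by \<open>simple\<close>.\<close>
  have E8: "p2 * (3 * p3 ^ 2 + 2 * a3 * p3 + b6) = 0"
    using coeff[of 8] unfolding p by (simp add: eval_nat_numeral algebra_simps)
  have p2: "p2 = 0" using E8 simple[OF E9] by simp
  have E6: "p0 * (3 * p3 ^ 2 + 2 * a3 * p3 + b6) = 0"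
    using coeff[of 6] unfolding p p2 by (simp add: eval_nat_numeral algebra_simps)
  have p0: "p0 = 0" using E6 simple[OF E9] by simp
  have "b0 * p1 + d1 = 0"
    using coeff[of 1] unfolding p p2 p0 by (simp add: eval_nat_numeral algebra_simps)
  then have p1: "p1 = r1" using b0 unfolding r1_def by (simp add: field_simps eq_neg_iff_add_eq_0)
  have "p1 ^ 3 + a1 * p1 ^ 2 + b0 * p3 + b2 * p1 + d3 = 0"
    using coeff[of 3] unfolding p p2 p0 by (simp add: eval_nat_numeral algebra_simps)
  then have "p3 = r3" unfolding p1 r3_def using b0 by (simp add: field_simps eq_neg_iff_add_eq_0)
  then show False using E9 r3 by simp
qed

section \<open>The three curves\<close>

lemma poly_cubic: "poly [:c0, c1, c2, c3:] a = c0 + c1 * a + c2 * a ^ 2 + c3 * a ^ 3"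
  for a :: "'a::comm_ring_1"
  by (simp add: algebra_simps eval_nat_numeral)

lemma poly_pderiv_cubic: "poly (pderiv [:c0, c1, c2, c3:]) a = c1 + 2 * c2 * a + 3 * c3 * a ^ 2"
  for a :: "'a::field"
  by (simp add: pderiv_pCons algebra_simps eval_nat_numeral)

text \<open>The lists are padded with zeros to the shape required by
  \<open>total_degree_cubic\<close>.\<close>

lemma system_coeffs:
  "var_z * var_y + 1 = [:1, [:0, 1:], 0, 0:]"
  "3 * var_y^2 - cst a * var_z * var_y - cst b * var_z^2 + cst q = [:[:q, 0, - b:], [:0, - a:], [:3:], 0:]"
  subgoal by (simp add: var_z_def var_y_def one_pCons)
  subgoal unfolding var_z_power var_y_power by (simp add: var_z_def var_y_def cst_def numeral_poly)
  done

lemma quadratic: "quadratic_system (var_z * var_y + 1) (3 * var_y^2 - cst a * var_z * var_y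
  - cst b * var_z^2 + cst q)"
proof -
  have "total_degree [:1, [:0, 1:], 0, 0:] = 2"
    by (rule total_degree_cubic[of _ _ _ _ _ 1 1]) simp_all
  moreover have "total_degree [:[:q, 0, - b:], [:0, - a:], [:3:], 0:] = 2"
    by (rule total_degree_cubic[of _ _ _ _ _ 2 0]) (simp_all add: eval_nat_numeral)
  ultimately show ?thesis unfolding system_coeffs quadratic_system_def by simp
qed

lemmas fls_const_hom = fls_const_mult_const[symmetric] fls_const_divide_const[symmetric]
  fls_const_numeral fls_const_uminus fls_const_power

lemma inverse_powers:
  fixes t x :: "'a::comm_semiring_1"
  assumes "t * x = 1"
  shows "t * x ^ 3 = x ^ 2" "t ^ 2 * x ^ 3 = x" "t ^ 3 * x ^ 3 = 1"
    "t * x ^ 4 = x ^ 3" "t ^ 2 * x ^ 4 = x ^ 2" "t ^ 3 * x ^ 4 = x" "t ^ 4 * x ^ 4 = 1"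
proof -
  have cancel: "t ^ i * x ^ (i + j) = x ^ j" for i j
    using assms by (simp add: power_add mult.assoc[symmetric] power_mult_distrib[symmetric])
  show "t * x ^ 3 = x ^ 2" "t ^ 2 * x ^ 3 = x" "t ^ 3 * x ^ 3 = 1"
    "t * x ^ 4 = x ^ 3" "t ^ 2 * x ^ 4 = x ^ 2" "t ^ 3 * x ^ 4 = x" "t ^ 4 * x ^ 4 = 1"
    using cancel[of 1 2] cancel[of 2 1] cancel[of 3 0] cancel[of 1 3] cancel[of 2 2] cancel[of 3 1]
      cancel[of 4 0] by (simp_all add: eval_nat_numeral)
qed

context elliptic begin

lemma x_nonzero: "x \<noteq> 0"
  using ev_nonzero[of "[:0, 1:]"] by simp

lemma z_squared:
  assumes "F * x ^ 3 = ev x f"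
  shows "(fls_const c * x / w) ^ 2 * F = fls_const (c ^ 2) * inverse x" "F \<noteq> 0"
proof -
  show "F \<noteq> 0" using assms ev_nonzero[OF f_nonzero] by auto
  have "w ^ 2 = F * x ^ 3" unfolding power2_eq_square w_sq assms ..
  then have "(fls_const c * x / w) ^ 2 * F = (fls_const c * x) ^ 2 * F / (F * x ^ 3)"
    by (simp only: power_divide times_divide_eq_left)
  also have "\<dots> = fls_const c ^ 2 * (F * x ^ 2) / (x * (F * x ^ 2))"
    by (simp only: power_mult_distrib power2_eq_square power3_eq_cube ac_simps)
  also have "\<dots> = fls_const c ^ 2 / x"
    by (rule nonzero_mult_divide_mult_cancel_right) (use \<open>F \<noteq> 0\<close> x_nonzero in simp)
  finally show "(fls_const c * x / w) ^ 2 * F = fls_const (c ^ 2) * inverse x"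
    by (simp only: divide_inverse fls_const_power)
qed

text \<open>With \<open>z = c x / w\<close> and \<open>k = r q H / F\<close> the two equations of
  the parametrisation hold. Conversely \<open>z ^ 2\<close> and \<open>k\<close> give
  \<open>F x\<close> and \<open>H x\<close> up to constant factors, and the last hypothesis recovers
  \<open>x\<close> from these.\<close>

lemma curve_has_genus_oneI:
  fixes q C r :: complex and F H :: "complex fls"
  assumes q: "q \<noteq> 0" "C \<noteq> 0" "r \<noteq> 0" and irr: "Factorial_Ring.irreducible g" "degree g > 0"
    and F: "F * x ^ 3 = ev x f" "F \<in> S" and H: "H \<in> S"
    and root: "\<And>z k. fls_const q * (z ^ 2 * F) = fls_const C * inverse x \<Longrightarrow>
      k * F = fls_const r * (fls_const q * H) \<Longrightarrow> eval_along (ev z) (z * k) g = 0"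
    and x: "\<And>E. set_field E \<Longrightarrow> F * x \<in> E
      \<Longrightarrow> H * x \<in> E \<Longrightarrow> range fls_const \<subseteq> E
      \<Longrightarrow> x \<in> E"
  shows "curve_has_genus g 1"
proof -
  \<comment> \<open>Chosen so that \<open>q * c ^ 2 = C\<close>.\<close>
  define c where "c = csqrt (C / q)"
  define z where "z = fls_const c * x / w"
  define \<kappa> where "\<kappa> = fls_const (r * q)"
  define k where "k = \<kappa> * H / F"
  have c: "c \<noteq> 0" unfolding c_def using q by simp
  have \<kappa>: "\<kappa> \<in> range fls_const" "\<kappa> \<noteq> 0" unfolding \<kappa>_def
    using q by simp_all
  note z_sq = z_squared(1)[OF F(1), of c, folded z_def] and F0 = z_squared(2)[OF F(1)]
  have "fls_const q * (z ^ 2 * F) = fls_const (q * c ^ 2) * inverse x"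
    unfolding z_sq fls_const_mult_const[symmetric] mult.assoc ..
  also have "q * c ^ 2 = C" unfolding c_def power2_csqrt using q(1) by simp
  finally have Z: "fls_const q * (z ^ 2 * F) = fls_const C * inverse x" .
  have zS: "z \<in> S" unfolding z_def using x_S w_S const_S by auto
  have z0: "z \<noteq> 0" unfolding z_def using c x_nonzero w_nonzero by simp
  have kF: "k * F = \<kappa> * H" unfolding k_def using F0 by simp
  then have kF': "k * F = fls_const r * (fls_const q * H)"
    unfolding \<kappa>_def fls_const_mult_const[symmetric] mult.assoc .
  have "k \<in> S" unfolding k_def using F(2) H \<kappa>(1) const_S by auto
  then have y: "z * k \<in> S" using zS by (intro mult_mem)
  have xE: "x \<in> E" if E: "set_field E" "z \<in> E" "z * k \<in> E" "range fls_const \<subseteq> E" for E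
  proof (rule x[OF E(1) _ _ E(4)])
    interpret E: set_field E by (rule E(1))
    have "z ^ 2 * (F * x) = fls_const (c ^ 2) * (inverse x * x)"
      using z_sq by (simp only: mult.assoc[symmetric])
    then have "z ^ 2 * (F * x) = fls_const (c ^ 2)" using x_nonzero by simp
    then have "F * x = inverse (z ^ 2) * fls_const (c ^ 2)"
      using z0 by (metis left_inverse mult.assoc mult_1 power_not_zero)
    then show Fx: "F * x \<in> E" using E(2,4) by auto
    have "z * k * inverse z = k" using z0 by (simp add: mult.assoc mult.left_commute[of z])
    with E.mult_mem[OF E(3) E.inverse_mem[OF E(2)]] have k: "k \<in> E" by (simp only:)
    have "\<kappa> * (H * x) = k * (F * x)" using kF by (simp only: mult.assoc[symmetric])
    then have "H * x = inverse \<kappa> * (k * (F * x))"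
      using \<kappa>(2) by (metis left_inverse mult.assoc mult_1)
    moreover have "inverse \<kappa> * (k * (F * x)) \<in> E"
      by (intro E.mult_mem E.inverse_mem k Fx) (use \<kappa>(1) E(4) in blast)
    ultimately show "H * x \<in> E" by (simp only:)
  qed
  show ?thesis
    by (rule curve_has_genus_one[OF c irr y, folded z_def, OF root[OF Z kF']]) (rule xE)
qed

lemma x_in_field:
  assumes "set_field E" "A \<in> E" "B \<in> E" "A * inverse x + B = 0" "A \<noteq> 0"
  shows "x \<in> E"
proof -
  interpret E: set_field E by fact
  have "A * inverse x = - B" using assms(4) by (simp only: eq_neg_iff_add_eq_0)
  then have "inverse x = inverse A * - B" using assms(5) by (metis left_inverse mult.assoc mult_1)
  then have "inverse x \<in> E" using assms(2,3) by auto
  then show ?thesis using E.inverse_mem by force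
qed

end

section \<open>Curve (i) and the cubic x^3 - x^2 - 3 x - 1\<close>

text \<open>In the identities below \<open>t = 1 / x\<close> and \<open>F = w\<^sup>2 / x\<^sup>3\<close>, while
  \<open>z\<^sup>2\<close> and \<open>y / z\<close> are constant multiples of \<open>t / F\<close> and
  \<open>H / F\<close>. Reducing \<open>H = n t\<close> modulo \<open>F = m t\<close> leaves a linear equation
  \<open>A t + B = 0\<close>, by which \<open>t\<close> is a rational function of
  \<open>z\<close> and \<open>y\<close>.\<close>

definition curve1 :: "complex \<Rightarrow> complex poly poly" where
  "curve1 q = cubic_curve (- (12/13 * q)) (- (120/169 * q^2)) ((9/26 * q)) (- (60/169 * q^2))
    ((960/2197 * q^3)) (- (1536/28561 * q^4)) (- (9/26 * q^2)) ((296/2197 * q^3)) (-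
    (2784/28561 * q^4)) ((6144/371293 * q^5)) (- (4096/4826809 * q^6))"

lemma identity1:
  fixes Q Z k t F H :: "'a::field_char_0"
  assumes Q: "Q \<noteq> 0" and F0: "F \<noteq> 0" and Z: "2 * Q * (Z * F) = 13 * t" and k: "13 *
    (k * F) = Q * H"
    and F: "F = 1 - t - 3 * t ^ 2 - t ^ 3" and H: "H = 13 + 22 * t + 24 * t ^ 2 + 14 * t ^ 3 + 3 * t ^ 4"
  shows "Z * k ^ 3 + (- (12/13 * Q) + - (120/169 * Q^2) * Z) * Z * k ^ 2 + ((9/26 * Q) + -
    (60/169 * Q^2) * Z + (960/2197 * Q^3) * Z ^ 2 + - (1536/28561 * Q^4) * Z ^ 3) * k + (-
    (9/26 * Q^2) + (296/2197 * Q^3) * Z + - (2784/28561 * Q^4) * Z ^ 2 + (6144/371293 * Q^5) * Z ^ 3 +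
    - (4096/4826809 * Q^6) * Z ^ 4) = 0" (is "?lhs = 0")
proof -
  \<comment> \<open>\<open>G\<close> stands for a multiple of \<open>F\<close> with integer
    coefficients; here \<open>F\<close> has them already.\<close>
  define G where "G = 1 * F"
  have G0: "G \<noteq> 0" unfolding G_def using F0 by simp
  have G: "G = 1 - t - 3 * t ^ 2 - t ^ 3" unfolding G_def F by (simp add: algebra_simps)
  have Z': "Z = 13 * t / (2 * Q * G)" and k': "k = 1 * Q * H / (13 * G)"
    using Z k Q F0 unfolding G_def by (simp_all add: field_simps)
  \<comment> \<open>All of \<open>Q\<close> comes out as a factor. What remains is a homogeneous
    quartic in \<open>t\<close>, \<open>H\<close>, \<open>G\<close>, the equation of the quotient
    curve, which holds identically in \<open>t\<close>.\<close>
  have "?lhs = Q ^ 2 / (338 * G ^ 4) * ((1) * (t * H ^ 3) + (- 12) * (t * H ^ 2 * G) + (- 60) *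
    (t ^ 2 * H ^ 2) + (9) * (H * G ^ 3) + (- 60) * (t * H * G ^ 2) + (480) * (t ^ 2 * H * G) +
    (- 384) * (t ^ 3 * H) + (- 117) * (G ^ 4) + (296) * (t * G ^ 3) + (- 1392) * (t ^ 2 * G ^ 2) +
    (1536) * (t ^ 3 * G) + (- 512) * (t ^ 4))" (is "_ = _ * ?N")
    unfolding Z' k' using Q G0 by (simp add: divide_simps) (simp add: eval_nat_numeral algebra_simps)
  also have "?N = 0"
    unfolding G H by (simp add: algebra_simps eval_nat_numeral)
  finally show ?thesis by simp
qed

lemma linear1:
  fixes t m n :: "'a::field_char_0"
  assumes t: "t \<noteq> 0" and "1 - t - 3 * t ^ 2 - t ^ 3 = m * t" and "13 + 22 * t + 24 * t ^ 2
    + 14 * t ^ 3 + 3 * t ^ 4 = n * t"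
  shows "((2 - n + 4 * m) * (20 - n - 5 * m) - (6 - 3 * m) * (12 - 3 * m + 3 * m ^ 2)) * t + (18 * (2
    - n + 4 * m) - (6 - 3 * m) ^ 2) = 0" (is "?lhs = 0")
proof -
  have "t ^ 3 + 3 * t ^ 2 + (1 + m) * t - 1 = -1 * (1 - t - 3 * t ^ 2 - t ^ 3 - m * t)" by
    (simp add: algebra_simps)
  then have E1: "t ^ 3 + 3 * t ^ 2 + (1 + m) * t - 1 = 0" unfolding assms(2) by simp
  have "3 * t ^ 4 + 14 * t ^ 3 + 24 * t ^ 2 + (22 - n) * t + 13 = 13 + 22 * t + 24 * t ^ 2
    + 14 * t ^ 3 + 3 * t ^ 4 - n * t" by (simp add: algebra_simps)
  then have E2: "3 * t ^ 4 + 14 * t ^ 3 + 24 * t ^ 2 + (22 - n) * t + 13 = 0" unfolding assms(3) by simp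
  \<comment> \<open>Division of the quartic by the cubic, with quotient \<open>3 * t + 5\<close>,
    leaves R = \<open>(6 - 3 * m) * t ^ 2 + (20 - n - 5 * m) * t + 18\<close>. Then t R minus
    \<open>6 - 3 * m\<close> times the cubic is a quadratic with leading coefficient
    \<open>2 - n + 4 * m\<close>, and cross-multiplication with R removes
    \<open>t ^ 2\<close>.\<close>
  have "?lhs = (2 - n + 4 * m) * ((3 * t ^ 4 + 14 * t ^ 3 + 24 * t ^ 2 + (22 - n) * t + 13) - (3 * t
    + 5) * (t ^ 3 + 3 * t ^ 2 + (1 + m) * t - 1)) - (6 - 3 * m) * (t * ((3 * t ^ 4 + 14 * t ^ 3
    + 24 * t ^ 2 + (22 - n) * t + 13) - (3 * t + 5) * (t ^ 3 + 3 * t ^ 2 + (1 + m) * t - 1)) - (6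
    - 3 * m) * (t ^ 3 + 3 * t ^ 2 + (1 + m) * t - 1))" by (simp add: algebra_simps eval_nat_numeral)
  also have "\<dots> = 0" unfolding E1 E2 by simp
  finally show ?thesis .
qed

lemma elliptic1: "elliptic [:- 1, - 3, - 1, 1:]"
proof
  fix a :: complex
  assume f: "poly [:- 1, - 3, - 1, 1:] a = 0"
  show "poly (pderiv [:- 1, - 3, - 1, 1:]) a \<noteq> 0"
  proof
    assume f': "poly (pderiv [:- 1, - 3, - 1, 1:]) a = 0"
    \<comment> \<open>A Bezout identity for the cubic and its derivative excludes a common
      root.\<close>
    have "1 = (19/8 + (- (15/8)) * a) * poly [:- 1, - 3, - 1, 1:] a + (- (9/8) + (- 1) * a +
      (5/8) * a ^ 2) * poly (pderiv [:- 1, - 3, - 1, 1:]) a"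
      unfolding poly_cubic poly_pderiv_cubic by (simp add: field_simps eval_nat_numeral)
    then show False unfolding f f' by simp
  qed
qed simp_all

lemma irreducible1:
  assumes q: "q \<noteq> 0"
  shows "Factorial_Ring.irreducible (curve1 q)"
proof -
  let ?C = "\<lambda>s. s ^ 3 + (- (120/169 * q^2)) * s ^ 2 + (- (1536/28561 * q^4)) * s + (-
    (4096/4826809 * q^6))"
    and ?C' = "\<lambda>s. 3 * s ^ 2 + 2 * (- (120/169 * q^2)) * s + (- (1536/28561 * q^4))"
  \<comment> \<open>The linear part of the curve is a multiple of \<open>y - q z\<close>.\<close>
  have r1: "- (- (9/26 * q^2)) / ((9/26 * q)) = q" using q by (simp add: field_simps eval_nat_numeral)
  have r3: "- (q ^ 3 + (- (12/13 * q)) * q ^ 2 + (- (60/169 * q^2)) * q + ((296/2197 * q^3))) /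
    ((9/26 * q)) = (70/169) * q ^ 2"
    using q by (simp add: field_simps eval_nat_numeral)
  have "?C ((70/169) * q ^ 2) = (- (27432/371293)) * q ^ 6"
    by (simp add: field_simps eval_nat_numeral)
  then have C_r3: "?C ((70/169) * q ^ 2) \<noteq> 0" using q by simp
  have simple: "?C' s \<noteq> 0" if C: "?C s = 0" for s
  proof
    assume C': "?C' s = 0"
    \<comment> \<open>Again a Bezout identity. It is homogeneous when \<open>s\<close> has weight
      two in \<open>q\<close>, so a power of \<open>q\<close> takes the place of the
      constant.\<close>
    have "q ^ 8 = ((284781731/36864) * q ^ 2 + (- (8973037931/589824)) * s) * ?C s
      + ((- (485537/3456)) * q ^ 4 + (- (835037957/221184)) * q ^ 2 * s + (8973037931/1769472) * s ^ 2) * ?C' s"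
      by (simp add: field_simps eval_nat_numeral)
    then show False unfolding C C' using q by simp
  qed
  have b0: "((9/26 * q)) \<noteq> 0" using q by simp
  show ?thesis
    unfolding curve1_def
    by (rule irreducible_monic_cubic[OF degree_cubic_curve], rule cubic_curve_no_root[OF b0 simple])
      (assumption, unfold r1 r3, rule C_r3)
qed

lemma genus1:
  assumes q: "q \<noteq> 0"
  shows "curve_has_genus (curve1 q) 1"
proof -
  interpret elliptic "[:- 1, - 3, - 1, 1:]" by (rule elliptic1)
  define t where "t = inverse x"
  define F H where "F = 1 - t - 3 * t ^ 2 - t ^ 3" and "H = 13 + 22 * t + 24 * t ^ 2 + 14 * t ^ 3 + 3 * t ^ 4"
  have tx: "t * x = 1" "t \<noteq> 0" unfolding t_def using x_nonzero by simp_all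
  note tx_powers = inverse_powers[OF tx(1)]
  have t_S: "t \<in> S" unfolding t_def using x_S by auto
  have num_S: "numeral l \<in> S" for l using const_S[of "numeral l"] by simp
  have evf: "ev x [:- 1, - 3, - 1, 1:] = x ^ 3 + (- 1) * x ^ 2 + (- 3) * x + (- 1)"
    by (simp add: ev_pCons fls_const_hom algebra_simps eval_nat_numeral)
  have Fx: "F * x ^ 3 = ev x [:- 1, - 3, - 1, 1:]"
    unfolding evf F_def left_diff_distrib distrib_right times_divide_eq_left mult.assoc tx_powers by simp
  let ?Q = "fls_const q"
  have Q0: "?Q \<noteq> 0" using q by simp
  show ?thesis
  \<comment> \<open>The parametrisation is \<open>z ^ 2 = C t / (q F)\<close> and
    \<open>y / z = r q H / F\<close>; the value \<open>r = 1 / H(0)\<close> gives the slope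
    \<open>q\<close> at \<open>t = 0\<close>.\<close>
  proof (rule curve_has_genus_oneI[where q = q and C = "13 / 2" and r = "1 / 13" and F = F and H = H])
    show "Factorial_Ring.irreducible (curve1 q)" using q by (rule irreducible1)
    show "degree (curve1 q) > 0" unfolding curve1_def degree_cubic_curve by simp
    show "F \<in> S" "H \<in> S" unfolding F_def H_def
      by (intro add_mem diff_mem mult_mem divide_mem power_mem t_S num_S one_mem)+
  next
    fix z k assume z: "?Q * (z ^ 2 * F) = fls_const (13 / 2) * inverse x"
      and k: "k * F = fls_const (1 / 13) * (?Q * H)"
    have "2 * ?Q * (z ^ 2 * F) = 13 * t"
      unfolding mult.assoc z t_def fls_const_hom by simp
    moreover have "13 * (k * F) = ?Q * H" unfolding k fls_const_hom by (simp add: fls_const_hom)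
    ultimately show "eval_along (ev z) (z * k) (curve1 q) = 0"
      unfolding curve1_def eval_cubic_curve fls_const_hom
      using identity1[OF Q0 z_squared(2)[OF Fx] _ _ F_def H_def] by (simp only: mult_zero_right)
  next
    fix E assume E: "set_field E" and m: "F * x \<in> E" and n: "H * x \<in> E" and K: "range fls_const
      \<subseteq> E"
    interpret E: set_field E by (rule E)
    have num_E: "numeral l \<in> E" for l using K by (metis fls_const_numeral rangeI subsetD)
    have Ft: "1 - t - 3 * t ^ 2 - t ^ 3 = F * x * t" and Ht: "13 + 22 * t + 24 * t ^ 2 + 14 * t ^ 3
      + 3 * t ^ 4 = H * x * t"
      unfolding F_def[symmetric] H_def[symmetric] mult.assoc mult.commute[of x t] tx(1) by
        (rule mult_1_right[symmetric])+
    let ?A = "\<lambda>m n. ((2 - n + 4 * m) * (20 - n - 5 * m) - (6 - 3 * m) * (12 - 3 * m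
      + 3 * m ^ 2))" and ?B = "\<lambda>m n. (18 * (2 - n + 4 * m) - (6 - 3 * m) ^ 2)"
    show "x \<in> E"
    proof (rule x_in_field[OF E])
      show "?A (F * x) (H * x) \<in> E" "?B (F * x) (H * x) \<in> E"
        by (intro m n num_E E.one_mem E.add_mem E.diff_mem E.mult_mem E.power_mem E.uminus_mem)+
      show "?A (F * x) (H * x) * inverse x + ?B (F * x) (H * x) = 0"
        unfolding t_def[symmetric] by (rule linear1[OF tx(2) Ft Ht])
      \<comment> \<open>Since \<open>F * x * x ^ 2\<close> and \<open>H * x * x ^ 3\<close> are the
        polynomials \<open>?f\<close> and \<open>?h\<close> in \<open>x\<close>, multiplication by
        \<open>x ^ 6\<close> turns the coefficient into the polynomial \<open>?a\<close>; its value
        at 1 shows that it is nonzero.\<close>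
      let ?f = "[:- 1, - 3, - 1, 1:] :: complex poly" and ?h = "[:3, 14, 24, 22, 13:] :: complex poly"
      let ?a = "([:0, 0, 0, 2:] - ?h + 4 * [:0, 1:] * ?f) * ([:0, 0, 0, 20:] - ?h - 5 * [:0, 1:] * ?f)
        - ([:0, 0, 6:] - 3 * ?f) * ([:0, 0, 0, 0, 12:] - 3 * [:0, 0, 1:] * ?f + 3 * ?f ^ 2)"
      have hx: "ev x ?h = H * x * x ^ 3"
      proof -
        have "ev x ?h = 3 + 14 * x + 24 * x ^ 2 + 22 * x ^ 3 + 13 * x ^ 4"
          by (simp add: ev_pCons fls_const_hom algebra_simps eval_nat_numeral)
        also have "\<dots> = H * x * x ^ 3"
          unfolding H_def mult.assoc power_Suc[symmetric] left_diff_distrib distrib_right by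
            (simp add: tx_powers)
        finally show ?thesis .
      qed
      have "poly ?a 1 \<noteq> 0" by simp
      then have "?a \<noteq> 0" by (metis poly_0)
      then have "ev x ?a \<noteq> 0" by (rule ev_nonzero)
      moreover have "ev x ?a = ?A (F * x) (H * x) * x ^ 6"
        unfolding ev.diff ev.add ev.mult ev.power ev.numeral hx Fx[symmetric]
        by (simp add: ev_pCons algebra_simps eval_nat_numeral)
      ultimately show "?A (F * x) (H * x) \<noteq> 0" by (metis mult_zero_left)
    qed
  qed (use q Fx in auto)
qed

lemma invariant1: "invariant_curve (var_z * var_y + 1)
    (3 * var_y^2 - cst (8/13 * q) * var_z * var_y - cst (24/169 * q^2) * var_z^2 + cst q) (curve1 q)
      (9 * var_y)"
  unfolding system_coeffs invariant_curve_def curve1_def cubic_curve_def partial_z_def partial_y_def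
  by (simp add: map_poly_pCons pderiv_pCons var_y_def numeral_poly field_simps)
    (simp add: field_simps eval_nat_numeral one_pCons)

section \<open>Curve (ii) and the cubic x^3 - x^2 - 1/2\<close>

definition curve2 :: "complex \<Rightarrow> complex poly poly" where
  "curve2 q = cubic_curve (- (21/25 * q)) (- (192/625 * q^2)) ((9/25 * q)) (- (312/625 * q^2))
    ((2688/15625 * q^3)) (- (9408/78125 * q^4)) (- (9/25 * q^2)) ((772/3125 * q^3)) (-
    (39648/390625 * q^4)) ((65856/1953125 * q^5)) (- (87808/9765625 * q^6))"

lemma identity2:
  fixes Q Z k t F H :: "'a::field_char_0"
  assumes Q: "Q \<noteq> 0" and F0: "F \<noteq> 0" and Z: "8 * Q * (Z * F) = 25 * t" and k: "25 *
    (k * F) = Q * H"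
    and F: "F = 1 - t - t ^ 3 / 2" and H: "H = 25 - 5 * t + 18 * t ^ 2 + t ^ 3 + 3 * t ^ 4"
  shows "Z * k ^ 3 + (- (21/25 * Q) + - (192/625 * Q^2) * Z) * Z * k ^ 2 + ((9/25 * Q) + -
    (312/625 * Q^2) * Z + (2688/15625 * Q^3) * Z ^ 2 + - (9408/78125 * Q^4) * Z ^ 3) * k + (-
    (9/25 * Q^2) + (772/3125 * Q^3) * Z + - (39648/390625 * Q^4) * Z ^ 2 +
    (65856/1953125 * Q^5) * Z ^ 3 + - (87808/9765625 * Q^6) * Z ^ 4) = 0" (is "?lhs = 0")
proof -
  \<comment> \<open>The denominator in \<open>F\<close> comes from the normalisation to constant
    term one, which makes the cubic in \<open>x\<close> monic; doubling clears it.\<close>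
  define G where "G = 2 * F"
  have G0: "G \<noteq> 0" unfolding G_def using F0 by simp
  have G: "G = 2 - 2 * t - t ^ 3" unfolding G_def F by (simp add: algebra_simps)
  have Z': "Z = 50 * t / (8 * Q * G)" and k': "k = 2 * Q * H / (25 * G)"
    using Z k Q F0 unfolding G_def by (simp_all add: field_simps)
  have "?lhs = Q ^ 2 / (625 * G ^ 4) * ((2) * (t * H ^ 3) + (- 21) * (t * H ^ 2 * G) + (- 48) *
    (t ^ 2 * H ^ 2) + (18) * (H * G ^ 3) + (- 156) * (t * H * G ^ 2) + (336) * (t ^ 2 * H * G) +
    (- 1470) * (t ^ 3 * H) + (- 225) * (G ^ 4) + (965) * (t * G ^ 3) + (- 2478) * (t ^ 2 * G ^ 2) +
    (5145) * (t ^ 3 * G) + (- 8575) * (t ^ 4))" (is "_ = _ * ?N")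
    unfolding Z' k' using Q G0 by (simp add: divide_simps) (simp add: eval_nat_numeral algebra_simps)
  also have "?N = 0"
    unfolding G H by (simp add: algebra_simps eval_nat_numeral)
  finally show ?thesis by simp
qed

lemma linear2:
  fixes t m n :: "'a::field_char_0"
  assumes t: "t \<noteq> 0" and "1 - t - t ^ 3 / 2 = m * t" and "25 - 5 * t + 18 * t ^ 2 + t ^ 3
    + 3 * t ^ 4 = n * t"
  shows "((1 + n + 2 * m) ^ 2 - (12 - 6 * m) * (27 - (12 - 6 * m) * (2 + 2 * m))) * t + (- 27 * (1 + n
    + 2 * m) - 2 * (12 - 6 * m) ^ 2) = 0" (is "?lhs = 0")
proof -
  have "t ^ 3 + (2 + 2 * m) * t - 2 = -2 * (1 - t - t ^ 3 / 2 - m * t)" by (simp add: algebra_simps)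
  then have E1: "t ^ 3 + (2 + 2 * m) * t - 2 = 0" unfolding assms(2) by simp
  have "3 * t ^ 4 + t ^ 3 + 18 * t ^ 2 - (5 + n) * t + 25 = 25 - 5 * t + 18 * t ^ 2 + t ^ 3
    + 3 * t ^ 4 - n * t" by (simp add: algebra_simps)
  then have E2: "3 * t ^ 4 + t ^ 3 + 18 * t ^ 2 - (5 + n) * t + 25 = 0" unfolding assms(3) by simp
  \<comment> \<open>The quotient \<open>3 * t + 1\<close> leaves the remainder
    \<open>(12 - 6 * m) * t ^ 2 - (1 + n + 2 * m) * t + 27\<close>. As the cubic has no square term,
    the second quadratic has the linear coefficient of this one as its leading coefficient, whence
    the square in the result.\<close>
  have "?lhs = (- 1 - n - 2 * m) * ((3 * t ^ 4 + t ^ 3 + 18 * t ^ 2 - (5 + n) * t + 25) - (3 * t + 1) *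
    (t ^ 3 + (2 + 2 * m) * t - 2)) - (12 - 6 * m) * (t * ((3 * t ^ 4 + t ^ 3 + 18 * t ^ 2 - (5
    + n) * t + 25) - (3 * t + 1) * (t ^ 3 + (2 + 2 * m) * t - 2)) - (12 - 6 * m) * (t ^ 3 + (2
    + 2 * m) * t - 2))" by (simp add: algebra_simps eval_nat_numeral)
  also have "\<dots> = 0" unfolding E1 E2 by simp
  finally show ?thesis .
qed

lemma elliptic2: "elliptic [:- (1/2), 0, - 1, 1:]"
proof
  fix a :: complex
  assume f: "poly [:- (1/2), 0, - 1, 1:] a = 0"
  show "poly (pderiv [:- (1/2), 0, - 1, 1:]) a \<noteq> 0"
  proof
    assume f': "poly (pderiv [:- (1/2), 0, - 1, 1:]) a = 0"
    have "1 = (- 2 + (24/35) * a) * poly [:- (1/2), 0, - 1, 1:] a + (- (6/35) + (26/35) * a + (-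
      (8/35)) * a ^ 2) * poly (pderiv [:- (1/2), 0, - 1, 1:]) a"
      unfolding poly_cubic poly_pderiv_cubic by (simp add: field_simps eval_nat_numeral)
    then show False unfolding f f' by simp
  qed
qed simp_all

lemma irreducible2:
  assumes q: "q \<noteq> 0"
  shows "Factorial_Ring.irreducible (curve2 q)"
proof -
  let ?C = "\<lambda>s. s ^ 3 + (- (192/625 * q^2)) * s ^ 2 + (- (9408/78125 * q^4)) * s + (-
    (87808/9765625 * q^6))"
    and ?C' = "\<lambda>s. 3 * s ^ 2 + 2 * (- (192/625 * q^2)) * s + (- (9408/78125 * q^4))"
  have r1: "- (- (9/25 * q^2)) / ((9/25 * q)) = q" using q by (simp add: field_simps eval_nat_numeral)
  have r3: "- (q ^ 3 + (- (21/25 * q)) * q ^ 2 + (- (312/625 * q^2)) * q + ((772/3125 * q^3))) /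
    ((9/25 * q)) = (32/125) * q ^ 2"
    using q by (simp add: field_simps eval_nat_numeral)
  have "?C ((32/125) * q ^ 2) = (- (421632/9765625)) * q ^ 6"
    by (simp add: field_simps eval_nat_numeral)
  then have C_r3: "?C ((32/125) * q ^ 2) \<noteq> 0" using q by simp
  have simple: "?C' s \<noteq> 0" if C: "?C s = 0" for s
  proof
    assume C': "?C' s = 0"
    have "q ^ 8 = ((- (840390625/790272)) * q ^ 2 + (5029296875/1580544) * s) * ?C s
      + ((26875/378) * q ^ 4 + (1097890625/2370816) * q ^ 2 * s + (- (5029296875/4741632)) * s ^ 2) * ?C' s"
      by (simp add: field_simps eval_nat_numeral)
    then show False unfolding C C' using q by simp
  qed
  have b0: "((9/25 * q)) \<noteq> 0" using q by simp
  show ?thesis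
    unfolding curve2_def
    by (rule irreducible_monic_cubic[OF degree_cubic_curve], rule cubic_curve_no_root[OF b0 simple])
      (assumption, unfold r1 r3, rule C_r3)
qed

lemma genus2:
  assumes q: "q \<noteq> 0"
  shows "curve_has_genus (curve2 q) 1"
proof -
  interpret elliptic "[:- (1/2), 0, - 1, 1:]" by (rule elliptic2)
  define t where "t = inverse x"
  define F H where "F = 1 - t - t ^ 3 / 2" and "H = 25 - 5 * t + 18 * t ^ 2 + t ^ 3 + 3 * t ^ 4"
  have tx: "t * x = 1" "t \<noteq> 0" unfolding t_def using x_nonzero by simp_all
  note tx_powers = inverse_powers[OF tx(1)]
  have t_S: "t \<in> S" unfolding t_def using x_S by auto
  have num_S: "numeral l \<in> S" for l using const_S[of "numeral l"] by simp
  have evf: "ev x [:- (1/2), 0, - 1, 1:] = x ^ 3 + (- 1) * x ^ 2 + (0) * x + (- (1/2))"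
    by (simp add: ev_pCons fls_const_hom algebra_simps eval_nat_numeral)
  have Fx: "F * x ^ 3 = ev x [:- (1/2), 0, - 1, 1:]"
    unfolding evf F_def left_diff_distrib distrib_right times_divide_eq_left mult.assoc tx_powers by simp
  let ?Q = "fls_const q"
  have Q0: "?Q \<noteq> 0" using q by simp
  show ?thesis
  proof (rule curve_has_genus_oneI[where q = q and C = "25 / 8" and r = "1 / 25" and F = F and H = H])
    show "Factorial_Ring.irreducible (curve2 q)" using q by (rule irreducible2)
    show "degree (curve2 q) > 0" unfolding curve2_def degree_cubic_curve by simp
    show "F \<in> S" "H \<in> S" unfolding F_def H_def
      by (intro add_mem diff_mem mult_mem divide_mem power_mem t_S num_S one_mem)+
  next
    fix z k assume z: "?Q * (z ^ 2 * F) = fls_const (25 / 8) * inverse x"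
      and k: "k * F = fls_const (1 / 25) * (?Q * H)"
    have "8 * ?Q * (z ^ 2 * F) = 25 * t"
      unfolding mult.assoc z t_def fls_const_hom by simp
    moreover have "25 * (k * F) = ?Q * H" unfolding k fls_const_hom by (simp add: fls_const_hom)
    ultimately show "eval_along (ev z) (z * k) (curve2 q) = 0"
      unfolding curve2_def eval_cubic_curve fls_const_hom
      using identity2[OF Q0 z_squared(2)[OF Fx] _ _ F_def H_def] by (simp only: mult_zero_right)
  next
    fix E assume E: "set_field E" and m: "F * x \<in> E" and n: "H * x \<in> E" and K: "range fls_const
      \<subseteq> E"
    interpret E: set_field E by (rule E)
    have num_E: "numeral l \<in> E" for l using K by (metis fls_const_numeral rangeI subsetD)
    have Ft: "1 - t - t ^ 3 / 2 = F * x * t" and Ht: "25 - 5 * t + 18 * t ^ 2 + t ^ 3 + 3 * t ^ 4 = H * x * t"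
      unfolding F_def[symmetric] H_def[symmetric] mult.assoc mult.commute[of x t] tx(1) by
        (rule mult_1_right[symmetric])+
    let ?A = "\<lambda>m n. ((1 + n + 2 * m) ^ 2 - (12 - 6 * m) * (27 - (12 - 6 * m) * (2
      + 2 * m)))" and ?B = "\<lambda>m n. (- 27 * (1 + n + 2 * m) - 2 * (12 - 6 * m) ^ 2)"
    show "x \<in> E"
    proof (rule x_in_field[OF E])
      show "?A (F * x) (H * x) \<in> E" "?B (F * x) (H * x) \<in> E"
        by (intro m n num_E E.one_mem E.add_mem E.diff_mem E.mult_mem E.power_mem E.uminus_mem)+
      show "?A (F * x) (H * x) * inverse x + ?B (F * x) (H * x) = 0"
        unfolding t_def[symmetric] by (rule linear2[OF tx(2) Ft Ht])
      let ?f = "[:- (1/2), 0, - 1, 1:] :: complex poly" and ?h = "[:3, 1, 18, - 5, 25:] :: complex poly"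
      \<comment> \<open>\<open>?A\<close> multiplied by \<open>x ^ 6\<close>, written as a
        polynomial in \<open>x\<close>.\<close>
      let ?a = "([:0, 0, 0, 1:] + ?h + 2 * [:0, 1:] * ?f) ^ 2 - ([:0, 0, 12:] - 6 * ?f) *
        ([:0, 0, 0, 0, 27:] - ([:0, 0, 12:] - 6 * ?f) * ([:0, 0, 2:] + 2 * ?f))"
      have hx: "ev x ?h = H * x * x ^ 3"
      proof -
        have "ev x ?h = 3 + x + 18 * x ^ 2 - 5 * x ^ 3 + 25 * x ^ 4"
          by (simp add: ev_pCons fls_const_hom algebra_simps eval_nat_numeral)
        also have "\<dots> = H * x * x ^ 3"
          unfolding H_def mult.assoc power_Suc[symmetric] left_diff_distrib distrib_right by
            (simp add: tx_powers)
        finally show ?thesis .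
      qed
      have "poly ?a 1 \<noteq> 0" by simp
      then have "?a \<noteq> 0" by (metis poly_0)
      then have "ev x ?a \<noteq> 0" by (rule ev_nonzero)
      moreover have "ev x ?a = ?A (F * x) (H * x) * x ^ 6"
        unfolding ev.diff ev.add ev.mult ev.power ev.numeral hx Fx[symmetric]
        by (simp add: ev_pCons algebra_simps eval_nat_numeral)
      ultimately show "?A (F * x) (H * x) \<noteq> 0" by (metis mult_zero_left)
    qed
  qed (use q Fx in auto)
qed

lemma invariant2: "invariant_curve (var_z * var_y + 1)
    (3 * var_y^2 - cst (14/25 * q) * var_z * var_y - cst (84/125 * q^2) * var_z^2 + cst q) (curve2 q)
      (9 * var_y)"
  unfolding system_coeffs invariant_curve_def curve2_def cubic_curve_def partial_z_def partial_y_def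
  by (simp add: map_poly_pCons pderiv_pCons var_y_def numeral_poly field_simps)
    (simp add: field_simps eval_nat_numeral one_pCons)

section \<open>Curve (iii) and the cubic x^3 - x^2 + 9/11 x - 1/11\<close>

definition curve3 :: "complex \<Rightarrow> complex poly poly" where
  "curve3 q = cubic_curve (- (132/53 * q)) ((3840/2809 * q^2)) ((9/106 * q)) ((6240/2809 * q^2)) (-
    (337920/148877 * q^3)) ((4325376/7890481 * q^4)) (- (9/106 * q^2)) (- (105344/148877 * q^3))
    ((7655424/7890481 * q^4)) (- (190316544/418195493 * q^5)) ((1568669696/22164361129 * q^6))"

lemma identity3:
  fixes Q Z k t F H :: "'a::field_char_0"
  assumes Q: "Q \<noteq> 0" and F0: "F \<noteq> 0" and Z: "22 * Q * (Z * F) = 53 * t" and k: "583 *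
    (k * F) = Q * H"
    and F: "F = 1 - t + 9 / 11 * t ^ 2 - t ^ 3 / 11" and H: "H = 583 - 968 * t + 414 * t ^ 2
      - 80 * t ^ 3 + 3 * t ^ 4"
  shows "Z * k ^ 3 + (- (132/53 * Q) + (3840/2809 * Q^2) * Z) * Z * k ^ 2 + ((9/106 * Q) +
    (6240/2809 * Q^2) * Z + - (337920/148877 * Q^3) * Z ^ 2 + (4325376/7890481 * Q^4) * Z ^ 3) * k + (-
    (9/106 * Q^2) + - (105344/148877 * Q^3) * Z + (7655424/7890481 * Q^4) * Z ^ 2 + -
    (190316544/418195493 * Q^5) * Z ^ 3 + (1568669696/22164361129 * Q^6) * Z ^ 4) = 0" (is "?lhs = 0")
proof -
  \<comment> \<open>The factor 11 clears the denominators of \<open>F\<close>; it is also contained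
    in \<open>583 = 11 * 53\<close>, the constant term of \<open>H\<close>.\<close>
  define G where "G = 11 * F"
  have G0: "G \<noteq> 0" unfolding G_def using F0 by simp
  have G: "G = 11 - 11 * t + 9 * t ^ 2 - t ^ 3" unfolding G_def F by (simp add: algebra_simps)
  have Z': "Z = 583 * t / (22 * Q * G)" and k': "k = 11 * Q * H / (583 * G)"
    using Z k Q F0 unfolding G_def by (simp_all add: field_simps)
  have "?lhs = Q ^ 2 / (5618 * G ^ 4) * ((1) * (t * H ^ 3) + (- 132) * (t * H ^ 2 * G) + (1920) *
    (t ^ 2 * H ^ 2) + (9) * (H * G ^ 3) + (6240) * (t * H * G ^ 2) + (- 168960) * (t ^ 2 * H * G) +
    (1081344) * (t ^ 3 * H) + (- 477) * (G ^ 4) + (- 105344) * (t * G ^ 3) + (3827712) *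
    (t ^ 2 * G ^ 2) + (- 47579136) * (t ^ 3 * G) + (196083712) * (t ^ 4))" (is "_ = _ * ?N")
    unfolding Z' k' using Q G0 by (simp add: divide_simps) (simp add: eval_nat_numeral algebra_simps)
  also have "?N = 0"
    unfolding G H by (simp add: algebra_simps eval_nat_numeral)
  finally show ?thesis by simp
qed

lemma linear3:
  fixes t m n :: "'a::field_char_0"
  assumes t: "t \<noteq> 0" and "1 - t + 9 / 11 * t ^ 2 - t ^ 3 / 11 = m * t" and "583 - 968 * t
    + 414 * t ^ 2 - 80 * t ^ 3 + 3 * t ^ 4 = n * t"
  shows "(- 96 - 33 * m) * t + (583 * m - 352 - n) = 0" (is "?lhs = 0")
proof -
  have "t ^ 3 - 9 * t ^ 2 + (11 + 11 * m) * t - 11 = -11 * (1 - t + 9 / 11 * t ^ 2 - t ^ 3 / 11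
    - m * t)" by (simp add: algebra_simps)
  then have E1: "t ^ 3 - 9 * t ^ 2 + (11 + 11 * m) * t - 11 = 0" unfolding assms(2) by simp
  have "3 * t ^ 4 - 80 * t ^ 3 + 414 * t ^ 2 - (968 + n) * t + 583 = 583 - 968 * t + 414 * t ^ 2
    - 80 * t ^ 3 + 3 * t ^ 4 - n * t" by (simp add: algebra_simps)
  then have E2: "3 * t ^ 4 - 80 * t ^ 3 + 414 * t ^ 2 - (968 + n) * t + 583 = 0" unfolding assms(3) by simp
  \<comment> \<open>Here the remainder has no constant term, so a single division already leaves
    \<open>t\<close> times a linear expression.\<close>
  have "t * ?lhs = ((3 * t ^ 4 - 80 * t ^ 3 + 414 * t ^ 2 - (968 + n) * t + 583) - (3 * t - 53) *
    (t ^ 3 - 9 * t ^ 2 + (11 + 11 * m) * t - 11))" by (simp add: algebra_simps eval_nat_numeral)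
  also have "\<dots> = 0" unfolding E1 E2 by simp
  finally show ?thesis using t by simp
qed

lemma elliptic3: "elliptic [:- (1/11), 9/11, - 1, 1:]"
proof
  fix a :: complex
  assume f: "poly [:- (1/11), 9/11, - 1, 1:] a = 0"
  show "poly (pderiv [:- (1/11), 9/11, - 1, 1:]) a \<noteq> 0"
  proof
    assume f': "poly (pderiv [:- (1/11), 9/11, - 1, 1:]) a = 0"
    have "1 = (121/16 + (- (363/32)) * a) * poly [:- (1/11), 9/11, - 1, 1:] a + (33/16 + (-
      (121/32)) * a + (121/32) * a ^ 2) * poly (pderiv [:- (1/11), 9/11, - 1, 1:]) a"
      unfolding poly_cubic poly_pderiv_cubic by (simp add: field_simps eval_nat_numeral)
    then show False unfolding f f' by simp
  qed
qed simp_all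

lemma irreducible3:
  assumes q: "q \<noteq> 0"
  shows "Factorial_Ring.irreducible (curve3 q)"
proof -
  let ?C = "\<lambda>s. s ^ 3 + ((3840/2809 * q^2)) * s ^ 2 + ((4325376/7890481 * q^4)) * s +
    ((1568669696/22164361129 * q^6))"
    and ?C' = "\<lambda>s. 3 * s ^ 2 + 2 * ((3840/2809 * q^2)) * s + ((4325376/7890481 * q^4))"
  have r1: "- (- (9/106 * q^2)) / ((9/106 * q)) = q" using q by (simp add: field_simps eval_nat_numeral)
  have r3: "- (q ^ 3 + (- (132/53 * q)) * q ^ 2 + ((6240/2809 * q^2)) * q + (-
    (105344/148877 * q^3))) / ((9/106 * q)) = (- (770/2809)) * q ^ 2"
    using q by (simp add: field_simps eval_nat_numeral)
  have "?C ((- (770/2809)) * q ^ 2) = (58333176/22164361129) * q ^ 6"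
    by (simp add: field_simps eval_nat_numeral)
  then have C_r3: "?C ((- (770/2809)) * q ^ 2) \<noteq> 0" using q by simp
  have simple: "?C' s \<noteq> 0" if C: "?C s = 0" for s
  proof
    assume C': "?C' s = 0"
    have "q ^ 8 = ((642766472741/830472192) * q ^ 2 + (62259690411361/53150220288) * s) * ?C s
      + ((- (86795291/884736)) * q ^ 4 + (- (1086053695321/2491416576)) * q ^ 2 * s + (-
        (62259690411361/159450660864)) * s ^ 2) * ?C' s"
      by (simp add: field_simps eval_nat_numeral)
    then show False unfolding C C' using q by simp
  qed
  have b0: "((9/106 * q)) \<noteq> 0" using q by simp
  show ?thesis
    unfolding curve3_def
    by (rule irreducible_monic_cubic[OF degree_cubic_curve], rule cubic_curve_no_root[OF b0 simple])
      (assumption, unfold r1 r3, rule C_r3)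
qed

lemma genus3:
  assumes q: "q \<noteq> 0"
  shows "curve_has_genus (curve3 q) 1"
proof -
  interpret elliptic "[:- (1/11), 9/11, - 1, 1:]" by (rule elliptic3)
  define t where "t = inverse x"
  define F H where "F = 1 - t + 9 / 11 * t ^ 2 - t ^ 3 / 11" and "H = 583 - 968 * t + 414 * t ^ 2
    - 80 * t ^ 3 + 3 * t ^ 4"
  have tx: "t * x = 1" "t \<noteq> 0" unfolding t_def using x_nonzero by simp_all
  note tx_powers = inverse_powers[OF tx(1)]
  have t_S: "t \<in> S" unfolding t_def using x_S by auto
  have num_S: "numeral l \<in> S" for l using const_S[of "numeral l"] by simp
  have evf: "ev x [:- (1/11), 9/11, - 1, 1:] = x ^ 3 + (- 1) * x ^ 2 + (9/11) * x + (- (1/11))"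
    by (simp add: ev_pCons fls_const_hom algebra_simps eval_nat_numeral)
  have Fx: "F * x ^ 3 = ev x [:- (1/11), 9/11, - 1, 1:]"
    unfolding evf F_def left_diff_distrib distrib_right times_divide_eq_left mult.assoc tx_powers by simp
  let ?Q = "fls_const q"
  have Q0: "?Q \<noteq> 0" using q by simp
  show ?thesis
  proof (rule curve_has_genus_oneI[where q = q and C = "53 / 22" and r = "1 / 583" and F = F and H = H])
    show "Factorial_Ring.irreducible (curve3 q)" using q by (rule irreducible3)
    show "degree (curve3 q) > 0" unfolding curve3_def degree_cubic_curve by simp
    show "F \<in> S" "H \<in> S" unfolding F_def H_def
      by (intro add_mem diff_mem mult_mem divide_mem power_mem t_S num_S one_mem)+
  next
    fix z k assume z: "?Q * (z ^ 2 * F) = fls_const (53 / 22) * inverse x"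
      and k: "k * F = fls_const (1 / 583) * (?Q * H)"
    have "22 * ?Q * (z ^ 2 * F) = 53 * t"
      unfolding mult.assoc z t_def fls_const_hom by simp
    moreover have "583 * (k * F) = ?Q * H" unfolding k fls_const_hom by (simp add: fls_const_hom)
    ultimately show "eval_along (ev z) (z * k) (curve3 q) = 0"
      unfolding curve3_def eval_cubic_curve fls_const_hom
      using identity3[OF Q0 z_squared(2)[OF Fx] _ _ F_def H_def] by (simp only: mult_zero_right)
  next
    fix E assume E: "set_field E" and m: "F * x \<in> E" and n: "H * x \<in> E" and K: "range fls_const
      \<subseteq> E"
    interpret E: set_field E by (rule E)
    have num_E: "numeral l \<in> E" for l using K by (metis fls_const_numeral rangeI subsetD)
    have Ft: "1 - t + 9 / 11 * t ^ 2 - t ^ 3 / 11 = F * x * t" and Ht: "583 - 968 * t + 414 * t ^ 2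
      - 80 * t ^ 3 + 3 * t ^ 4 = H * x * t"
      unfolding F_def[symmetric] H_def[symmetric] mult.assoc mult.commute[of x t] tx(1) by
        (rule mult_1_right[symmetric])+
    let ?A = "\<lambda>m n. (- 96 - 33 * m)" and ?B = "\<lambda>m n. (583 * m - 352 - n)"
    show "x \<in> E"
    proof (rule x_in_field[OF E])
      show "?A (F * x) (H * x) \<in> E" "?B (F * x) (H * x) \<in> E"
        by (intro m n num_E E.one_mem E.add_mem E.diff_mem E.mult_mem E.power_mem E.uminus_mem)+
      show "?A (F * x) (H * x) * inverse x + ?B (F * x) (H * x) = 0"
        unfolding t_def[symmetric] by (rule linear3[OF tx(2) Ft Ht])
      let ?f = "[:- (1/11), 9/11, - 1, 1:] :: complex poly"
      \<comment> \<open>Only \<open>F\<close> enters \<open>?A\<close>, so the factor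
        \<open>x ^ 2\<close> suffices to reach a polynomial.\<close>
      let ?a = "[:0, 0, - 96:] - 33 * ?f"
      have "poly ?a 1 \<noteq> 0" by simp
      then have "?a \<noteq> 0" by (metis poly_0)
      then have "ev x ?a \<noteq> 0" by (rule ev_nonzero)
      moreover have "ev x ?a = ?A (F * x) (H * x) * x ^ 2"
        unfolding ev.diff ev.add ev.mult ev.power ev.numeral Fx[symmetric]
        by (simp add: ev_pCons algebra_simps eval_nat_numeral)
      ultimately show "?A (F * x) (H * x) \<noteq> 0" by (metis mult_zero_left)
    qed
  qed (use q Fx in auto)
qed

lemma invariant3: "invariant_curve (var_z * var_y + 1)
    (3 * var_y^2 - cst (88/53 * q) * var_z * var_y - cst (3264/2809 * q^2) * var_z^2 + cst q)
      (curve3 q) (9 * var_y)"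
  unfolding system_coeffs invariant_curve_def curve3_def cubic_curve_def partial_z_def partial_y_def
  by (simp add: map_poly_pCons pderiv_pCons var_y_def numeral_poly field_simps)
    (simp add: field_simps eval_nat_numeral one_pCons)

section \<open>Total degrees and the curves in expanded form\<close>

lemma degree_curves:
  assumes "q \<noteq> 0"
  shows "total_degree (curve1 q) = 9" "total_degree (curve2 q) = 9" "total_degree (curve3 q) = 9"
  unfolding curve1_def curve2_def curve3_def by (rule total_degree_cubic_curve; use assms in simp)+

lemma curve1_eq: "curve1 q = var_y^3 - cst (9/26 * q^2) * var_z - cst (2784/28561 * q^4) * var_z^5
              + cst (296/2197 * q^3) * var_z^3 + cst (6144/371293 * q^5) * var_z^7
              - cst (4096/4826809 * q^6) * var_z^9 + cst (9/26 * q) * var_y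
              - cst (60/169 * q^2) * var_y * var_z^2
              + cst (960/2197 * q^3) * var_y * var_z^4
              - cst (1536/28561 * q^4) * var_y * var_z^6
              - cst (12/13 * q) * var_y^2 * var_z
              - cst (120/169 * q^2) * var_y^2 * var_z^3"
  unfolding curve1_def cubic_curve_eq by (simp add: cst_minus algebra_simps)

lemma curve2_eq: "curve2 q = var_y^3 + cst (772/3125 * q^3) * var_z^3
              - cst (39648/390625 * q^4) * var_z^5 - cst (9/25 * q^2) * var_z
              + cst (9/25 * q) * var_y - cst (312/625 * q^2) * var_y * var_z^2
              + cst (2688/15625 * q^3) * var_y * var_z^4
              - cst (9408/78125 * q^4) * var_y * var_z^6
              - cst (21/25 * q) * var_y^2 * var_z
              - cst (192/625 * q^2) * var_y^2 * var_z^3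
              - cst (87808/9765625 * q^6) * var_z^9
              + cst (65856/1953125 * q^5) * var_z^7"
  unfolding curve2_def cubic_curve_eq by (simp add: cst_minus algebra_simps)

lemma curve3_eq: "curve3 q = var_y^3 - cst (9/106 * q^2) * var_z
              + cst (7655424/7890481 * q^4) * var_z^5
              - cst (190316544/418195493 * q^5) * var_z^7
              - cst (105344/148877 * q^3) * var_z^3 - cst (132/53 * q) * var_y^2 * var_z
              + cst (3840/2809 * q^2) * var_y^2 * var_z^3
              + cst (1568669696/22164361129 * q^6) * var_z^9 + cst (9/106 * q) * var_y
              + cst (6240/2809 * q^2) * var_y * var_z^2
              - cst (337920/148877 * q^3) * var_y * var_z^4
              + cst (4325376/7890481 * q^4) * var_y * var_z^6"
  unfolding curve3_def cubic_curve_eq by (simp add: cst_minus algebra_simps)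

text \<open>At \<open>q = 0\<close> each curve degenerates to \<open>y ^ 3 = 0\<close>, which is
  reducible and of degree three. Invariance is a polynomial identity valid for every
  \<open>q\<close>, while degree and genus are claimed for nonzero \<open>q\<close>.\<close>

theorem corollary1:
  fixes q :: complex
  shows
    "(let P = var_z * var_y + 1;
          Q = 3 * var_y^2 - cst (8/13 * q) * var_z * var_y
              - cst (24/169 * q^2) * var_z^2 + cst q;
          g = var_y^3 - cst (9/26 * q^2) * var_z - cst (2784/28561 * q^4) * var_z^5
              + cst (296/2197 * q^3) * var_z^3 + cst (6144/371293 * q^5) * var_z^7
              - cst (4096/4826809 * q^6) * var_z^9 + cst (9/26 * q) * var_y
              - cst (60/169 * q^2) * var_y * var_z^2
              + cst (960/2197 * q^3) * var_y * var_z^4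
              - cst (1536/28561 * q^4) * var_y * var_z^6
              - cst (12/13 * q) * var_y^2 * var_z
              - cst (120/169 * q^2) * var_y^2 * var_z^3
      in quadratic_system P Q \<and> invariant_curve P Q g (9 * var_y) \<and>
         (q \<noteq> 0 \<longrightarrow> total_degree g = 9 \<and> curve_has_genus g 1)) \<and>
     (let P = var_z * var_y + 1;
          Q = 3 * var_y^2 - cst (14/25 * q) * var_z * var_y
              - cst (84/125 * q^2) * var_z^2 + cst q;
          g = var_y^3 + cst (772/3125 * q^3) * var_z^3
              - cst (39648/390625 * q^4) * var_z^5 - cst (9/25 * q^2) * var_z
              + cst (9/25 * q) * var_y - cst (312/625 * q^2) * var_y * var_z^2
              + cst (2688/15625 * q^3) * var_y * var_z^4
              - cst (9408/78125 * q^4) * var_y * var_z^6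
              - cst (21/25 * q) * var_y^2 * var_z
              - cst (192/625 * q^2) * var_y^2 * var_z^3
              - cst (87808/9765625 * q^6) * var_z^9
              + cst (65856/1953125 * q^5) * var_z^7
      in quadratic_system P Q \<and> invariant_curve P Q g (9 * var_y) \<and>
         (q \<noteq> 0 \<longrightarrow> total_degree g = 9 \<and> curve_has_genus g 1)) \<and>
     (let P = var_z * var_y + 1;
          Q = 3 * var_y^2 - cst (88/53 * q) * var_z * var_y
              - cst (3264/2809 * q^2) * var_z^2 + cst q;
          g = var_y^3 - cst (9/106 * q^2) * var_z
              + cst (7655424/7890481 * q^4) * var_z^5
              - cst (190316544/418195493 * q^5) * var_z^7
              - cst (105344/148877 * q^3) * var_z^3 - cst (132/53 * q) * var_y^2 * var_z
              + cst (3840/2809 * q^2) * var_y^2 * var_z^3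
              + cst (1568669696/22164361129 * q^6) * var_z^9 + cst (9/106 * q) * var_y
              + cst (6240/2809 * q^2) * var_y * var_z^2
              - cst (337920/148877 * q^3) * var_y * var_z^4
              + cst (4325376/7890481 * q^4) * var_y * var_z^6
      in quadratic_system P Q \<and> invariant_curve P Q g (9 * var_y) \<and>
         (q \<noteq> 0 \<longrightarrow> total_degree g = 9 \<and> curve_has_genus g 1))"
  using quadratic invariant1[of q] invariant2[of q] invariant3[of q] degree_curves[of q]
    genus1[of q] genus2[of q] genus3[of q]
  unfolding Let_def curve1_eq[symmetric] curve2_eq[symmetric] curve3_eq[symmetric] by blast

end
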